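(* Suppose that $e_1^{\max}|_{e_0^{\min}}\ne a_{0n}-a_{00}$ and let $$\delta=(a_{0n}-a_{0R}^-)(a_{1L}^+-a_{10})-(a_{0L}^--a_{00})(a_{1m}-a_{1R}^+).$$ Then, under Selection2: (1) $a_{00}$ is selected and $a_{10}$ is not, or $a_{0n}$ is selected and $a_{1m}$ is not, which also implies that $e_0^{\min}|_{e_1^{\max}}\ne 0$; (2) the upper left corner of $N(\phi)$ consists of a single edge connecting the points $(0,e_1^{\max}|_{e_0^{\min}})$ and $(e_0^{\min}|_{e_1^{\max}},a_{0n}-a_{00})$, unless $a_{00},a_{0n}$ are selected, $a_{10},a_{1m}$ are non-selected, and $\delta\neq0$, in which case the corner consists of two edges connecting the point $(0,e_1^{\max}|_{e_0^{\min}})$ to a point $p$, and $p$ to $(e_0^{\min}|_{e_1^{\max}},a_{0n}-a_{00})$, where $$p=(a_{1L}^+-a_{10},\,a_{0R}^--a_{00})\ \text{ if }\delta<0,\qquad p=(a_{1m}-a_{1R}^+,\,a_{0n}-a_{0L}^-)\ \text{ if }\delta>0.$$ The point $p$ lies on the polygon edge (connecting the two extreme points) if and only if $\delta=0$. A symmetric result holds for the lower right corner, obtained by exchanging the roles of the indices $0$ and $1$ (of $A_0$ and $A_1$, and of $x$ and $y$): suppose $e_0^{\max}|_{e_1^{\min}}\neq a_{1m}-a_{10}$ and let $\delta'=(a_{1m}-a_{1R}^-)(a_{0L}^+-a_{00})-(a_{1L}^--a_{10})(a_{0n}-a_{0R}^+)$. Then, under Selection2, $a_{10}$ is selected and $a_{00}$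 is not, or $a_{1m}$ is selected and $a_{0n}$ is not, which also implies $e_1^{\min}|_{e_0^{\max}}\neq 0$; and the lower right corner of $N(\phi)$ consists of a single edge connecting $(e_0^{\max}|_{e_1^{\min}},0)$ and $(a_{1m}-a_{10},e_1^{\min}|_{e_0^{\max}})$, unless $a_{10},a_{1m}$ are selected, $a_{00},a_{0n}$ are non-selected and $\delta'\ne0$, in which case it consists of two edges connecting these two points to $p'$, where $p'=(a_{1R}^--a_{10},\,a_{0L}^+-a_{00})$ if $\delta'<0$ and $p'=(a_{1m}-a_{1L}^-,\,a_{0n}-a_{0R}^+)$ if $\delta'>0$. The point $p'$ lies on the polygon edge if and only if $\delta'=0$.
   Context: Consider $x=P_0(t)/Q_0(t)$, $y=P_1(t)/Q_1(t)$ with $P_i,Q_i\in\mathbb{C}[t]$, $\gcd(P_i,Q_i)=1$, where all polynomials have fixed supports and (independent) generic coefficients (the result holds for all coefficient vectors in some open dense subset), and the parameterization has degree $1$. Let $\phi\in\mathbb{C}[x,y]$ be the implicit equation (generator of the ideal of polynomials vanishing on the parameterization) and $N(\phi)$ its Newton polygon (convex hull of the exponent vectors occurring in $\phi$). Let $f_0=xQ_0(t)-P_0(t)$, $f_1=yQ_1(t)-P_1(t)$, with supports in $t$: $A_0=\{a_{00}<a_{01}<\dots<a_{0n}\}$, $A_1=\{a_{10}<a_{11}<\dots<a_{1m}\}$, $A_i=\mathrm{supp}(P_i)\cup\mathrm{supp}(Q_i)$; by coprimality $a_{00}=a_{10}=0$. Selection2: a point of $A_i$ is selected iff it belongs to $\mathrm{supp}(Q_i)\setminus\mathrm{supp}(P_i)$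 (i.e. its coefficient in $f_i$ is a monomial in $x$, resp. $y$). The other points of $A_i$ are non-selected (they form $\mathrm{supp}(P_i)$). It is assumed that there is at least one selected (and, automatically, at least one non-selected) point in each of $A_0$ and $A_1$ under Selection2. Let $a_{iL}^+,a_{iR}^+$ denote the leftmost and rightmost selected points of $A_i$, and $a_{iL}^-,a_{iR}^-$ the leftmost and rightmost non-selected points of $A_i$ (not necessarily distinct), under Selection2. Let $C=\{(a,0):a\in A_0\}\cup\{(a,1):a\in A_1\}\subset\mathbb{R}^2$. A triangulation of $C$ is a subdivision of its convex hull into triangles with vertices in $C$; each triangle has two vertices on one of the two rows (its base) and one on the other row (its apex), and its normalized volume is the length of its base. For a triangulation, let $e_0$ be the sum of the normalized volumes of the triangles whose apex is a selected point of $A_0$ (base in $A_1$), and $e_1$ the sum of the normalized volumes of the triangles whose apex is a selected point of $A_1$ (base in $A_0$). Write $e_i^{\max}$, $e_i^{\min}$ for the maximum and minimum of $e_i$ over all triangulations, and e.g. $e_1^{\max}|_{e_0^{\min}}$ for the maximum of $e_1$ among the triangulations with $e_0=e_0^{\min}$, and $e_0^{\min}|_{e_1^{\max}}$ for the minimum of $e_0$ among the triangulations with $e_1=e_1^{\max}$; similarly for the other combinations. All are taken under Selection2. The upper left corner of $N(\phi)$ is the part of its boundary between the points $(0,e_1^{\max}|_{e_0^{\min}})$ and $(e_0^{\min}|_{e_1^{\max}},a_{0n}-a_{00})$; the lower right corner is the part between $(e_0^{\max}|_{e_1^{\min}},0)$ and $(a_{1m}-a_{10},e_1^{\min}|_{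e_0^{\max}})$.
   Formalization: Part (2) and its mirror image are asserted only if, whenever the least (greatest) point of A_i is selected, the least (greatest) exponent of Q_j (j≠i) is not in supp(P_j); otherwise they fail, e.g. for supports P_0={1,2}, Q_0={0}, P_1={0}, Q_1={0,1}. *)

theory Defs
  imports "HOL-Analysis.Analysis" "HOL-Computational_Algebra.Polynomial"
begin

text \<open>The index \<open>i\<close> of families such as \<open>A\<close>, \<open>SP\<close>, \<open>SQ\<close>, \<open>p\<close>, \<open>q\<close> is only used with the
  values \<open>0\<close> and \<open>1\<close>, so that \<open>1 - i\<close> is the other index.\<close>


subsection \<open>Triangulations of the two-row configuration\<close>

definition two_rows :: "(nat \<Rightarrow> nat set) \<Rightarrow> (real \<times> real) set" where
  "two_rows A = {(real a, 0) | a. a \<in> A 0} \<union> {(real a, 1) | a. a \<in> A 1}"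

definition triangulations :: "(nat \<Rightarrow> nat set) \<Rightarrow> (real \<times> real) set set set" where
  "triangulations A = {T. triangulation T \<and>
     (\<forall>\<Delta>\<in>T. 2 simplex \<Delta> \<and> {v. v extreme_point_of \<Delta>} \<subseteq> two_rows A) \<and>
     \<Union>T = convex hull (two_rows A)}"

text \<open>A triangle with apex \<open>a\<close> in row \<open>i\<close> and base from \<open>b\<close> to \<open>b'\<close> in the other row has
  normalized volume \<open>b' - b\<close>; the triple \<open>(a, b, b')\<close> with \<open>b < b'\<close> is unique.\<close>

definition e_val :: "(nat \<Rightarrow> nat set) \<Rightarrow> (nat \<Rightarrow> nat set) \<Rightarrow> nat \<Rightarrow> (real \<times> real) set set \<Rightarrow> nat" where
  "e_val A Sel i T =
     (\<Sum>(a, b, b') \<in> {(a, b, b'). a \<in> Sel i \<and> b \<in> A (1 - i) \<and> b' \<in> A (1 - i) \<and> b < b' \<and>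
        convex hull {(real a, real i), (real b, real (1 - i)), (real b', real (1 - i))} \<in> T}.
      b' - b)"

definition e_max :: "(nat \<Rightarrow> nat set) \<Rightarrow> (nat \<Rightarrow> nat set) \<Rightarrow> nat \<Rightarrow> nat" where
  "e_max A Sel i = Max (e_val A Sel i ` triangulations A)"

definition e_min :: "(nat \<Rightarrow> nat set) \<Rightarrow> (nat \<Rightarrow> nat set) \<Rightarrow> nat \<Rightarrow> nat" where
  "e_min A Sel i = Min (e_val A Sel i ` triangulations A)"

text \<open>\<open>e_max_at_min A Sel i\<close> is $e_i^{\max}|_{e_j^{\min}}$ and \<open>e_min_at_max A Sel i\<close> is
  $e_i^{\min}|_{e_j^{\max}}$, where \<open>j = 1 - i\<close>.\<close>

definition e_max_at_min :: "(nat \<Rightarrow> nat set) \<Rightarrow> (nat \<Rightarrow> nat set) \<Rightarrow> nat \<Rightarrow> nat" where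
  "e_max_at_min A Sel i =
     Max (e_val A Sel i ` {T \<in> triangulations A. e_val A Sel (1 - i) T = e_min A Sel (1 - i)})"

definition e_min_at_max :: "(nat \<Rightarrow> nat set) \<Rightarrow> (nat \<Rightarrow> nat set) \<Rightarrow> nat \<Rightarrow> nat" where
  "e_min_at_max A Sel i =
     Min (e_val A Sel i ` {T \<in> triangulations A. e_val A Sel (1 - i) T = e_max A Sel (1 - i)})"

text \<open>With \<open>j = 1 - i\<close>: if the least (greatest) point of \<open>A i\<close> is selected, then the least
  (greatest) exponent of the denominator \<open>Q j\<close> is not an exponent of \<open>P j\<close>. When this fails,
  some coefficient of $f_j$ that involves the variable belonging to $f_j$ is not selected although
  it contributes to the relevant maximal degree, and the value of \<open>e_max_at_min\<close> or \<open>e_min_at_max\<close>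
  does not give a vertex of the Newton polygon. For example, $x = t + t^2$ (written with
  $Q_0 = \{0\}$, $P_0 = \{1,2\}$ as supports), $y = 1 / (1 + t)$ ($Q_1 = \{0,1\}$, $P_1 = \{0\}$) has
  \<open>e_max_at_min A Sel 1 = 1\<close> and \<open>e_min_at_max A Sel 0 = 1\<close>, but for generic coefficients the
  Newton polygon is the convex hull of $(0,0)$, $(0,2)$, $(1,2)$, so that its boundary between $(0,1)$
  and $(1,2)$ passes through $(0,2)$.\<close>

definition denominator_ends_selected ::
    "(nat \<Rightarrow> nat set) \<Rightarrow> (nat \<Rightarrow> nat set) \<Rightarrow> (nat \<Rightarrow> nat set) \<Rightarrow> nat \<Rightarrow> bool" where
  "denominator_ends_selected SQ A Sel i \<longleftrightarrow>
     (Min (A i) \<in> Sel i \<longrightarrow> Min (SQ (1 - i)) \<in> Sel (1 - i)) \<and>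
     (Max (A i) \<in> Sel i \<longrightarrow> Max (SQ (1 - i)) \<in> Sel (1 - i))"


subsection \<open>Bivariate polynomials and Newton polygons\<close>

text \<open>A polynomial in \<open>x\<close> and \<open>y\<close> is a polynomial in \<open>y\<close> whose coefficients are polynomials
  in \<open>x\<close>: the coefficient of \<open>x ^ i * y ^ j\<close> in \<open>\<phi>\<close> is \<open>coeff (coeff \<phi> j) i\<close>.\<close>

definition eval2 :: "complex poly poly \<Rightarrow> complex \<Rightarrow> complex \<Rightarrow> complex" where
  "eval2 \<phi> x y = poly (poly \<phi> [:y:]) x"

lemma eval2_altdef:
  "eval2 \<phi> x y =
     (\<Sum>j\<le>degree \<phi>. \<Sum>i\<le>degree (coeff \<phi> j). coeff (coeff \<phi> j) i * x ^ i * y ^ j)"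
  unfolding eval2_def poly_altdef[of \<phi>]
  by (simp add: poly_sum poly_altdef[of "coeff _ _"] sum_distrib_right)

definition newton_polygon :: "complex poly poly \<Rightarrow> (real \<times> real) set" where
  "newton_polygon \<phi> = convex hull {(real i, real j) | i j. coeff (coeff \<phi> j) i \<noteq> 0}"

text \<open>The part of the boundary of a compact convex set \<open>K\<close> between two of its points \<open>E\<close> and
  \<open>F\<close>. For the upper left corner, \<open>E\<close> is meant to have minimal first and \<open>F\<close> maximal second
  coordinate in \<open>K\<close>; the boundary of \<open>K\<close> traversed clockwise from \<open>E\<close> to \<open>F\<close> then consists of
  the points in the box spanned by \<open>E\<close> and \<open>F\<close> that have no point of \<open>K\<close> strictly to the
  upper left of them. This also covers the case that \<open>K\<close> is a segment. The lower right corner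
  is the same with \<open>E\<close> of minimal second and \<open>F\<close> of maximal first coordinate.\<close>

definition upper_left_corner ::
    "(real \<times> real) set \<Rightarrow> real \<times> real \<Rightarrow> real \<times> real \<Rightarrow> (real \<times> real) set" where
  "upper_left_corner K E F = {z \<in> frontier K.
     fst E \<le> fst z \<and> fst z \<le> fst F \<and> snd E \<le> snd z \<and> snd z \<le> snd F \<and>
     \<not> (\<exists>w\<in>K. fst w < fst z \<and> snd z < snd w)}"

definition lower_right_corner ::
    "(real \<times> real) set \<Rightarrow> real \<times> real \<Rightarrow> real \<times> real \<Rightarrow> (real \<times> real) set" where
  "lower_right_corner K E F = {z \<in> frontier K.
     fst E \<le> fst z \<and> fst z \<le> fst F \<and> snd E \<le> snd z \<and> snd z \<le> snd F \<and>
     \<not> (\<exists>w\<in>K. fst z < fst w \<and> snd w < snd z)}"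

text \<open>The set \<open>B\<close>, a part of the boundary of \<open>K\<close>, consists of one edge \<open>E F\<close> of \<open>K\<close>, resp.\ of
  two edges \<open>E p\<close> and \<open>p F\<close> of \<open>K\<close>.\<close>

definition is_single_edge ::
    "(real \<times> real) set \<Rightarrow> (real \<times> real) set \<Rightarrow> real \<times> real \<Rightarrow> real \<times> real \<Rightarrow> bool" where
  "is_single_edge K B E F \<longleftrightarrow> closed_segment E F edge_of K \<and> B = closed_segment E F"

definition is_two_edges ::
    "(real \<times> real) set \<Rightarrow> (real \<times> real) set \<Rightarrow> real \<times> real \<Rightarrow> real \<times> real \<Rightarrow> real \<times> real \<Rightarrow> bool"
  where
  "is_two_edges K B E p F \<longleftrightarrow>
     closed_segment E p edge_of K \<and> closed_segment p F edge_of K \<and>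
     closed_segment E p \<noteq> closed_segment p F \<and>
     B = closed_segment E p \<union> closed_segment p F"


subsection \<open>Rational parameterizations with given supports and generic coefficients\<close>

text \<open>The parameterization is \<open>x = P 0 / Q 0\<close>, \<open>y = P 1 / Q 1\<close>.\<close>

definition param_domain :: "(nat \<Rightarrow> complex poly) \<Rightarrow> complex set" where
  "param_domain Q = {t. poly (Q 0) t \<noteq> 0 \<and> poly (Q 1) t \<noteq> 0}"

definition param_point ::
    "(nat \<Rightarrow> complex poly) \<Rightarrow> (nat \<Rightarrow> complex poly) \<Rightarrow> complex \<Rightarrow> complex \<times> complex" where
  "param_point P Q t = (poly (P 0) t / poly (Q 0) t, poly (P 1) t / poly (Q 1) t)"

text \<open>The degree of a parameterization is the number of parameter values over a generic point
  of the curve.\<close>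

definition has_param_degree ::
    "(nat \<Rightarrow> complex poly) \<Rightarrow> (nat \<Rightarrow> complex poly) \<Rightarrow> nat \<Rightarrow> bool" where
  "has_param_degree P Q d \<longleftrightarrow>
     finite {t \<in> param_domain Q.
       card {s \<in> param_domain Q. param_point P Q s = param_point P Q t} \<noteq> d}"

definition vanishes_on_param ::
    "(nat \<Rightarrow> complex poly) \<Rightarrow> (nat \<Rightarrow> complex poly) \<Rightarrow> complex poly poly \<Rightarrow> bool" where
  "vanishes_on_param P Q f \<longleftrightarrow>
     (\<forall>t\<in>param_domain Q. eval2 f (fst (param_point P Q t)) (snd (param_point P Q t)) = 0)"

definition is_implicit_equation ::
    "(nat \<Rightarrow> complex poly) \<Rightarrow> (nat \<Rightarrow> complex poly) \<Rightarrow> complex poly poly \<Rightarrow> bool" where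
  "is_implicit_equation P Q \<phi> \<longleftrightarrow> {f. vanishes_on_param P Q f} = {\<phi> * g | g. True}"

definition poly_with_coeffs :: "nat set \<Rightarrow> (nat \<Rightarrow> complex) \<Rightarrow> complex poly" where
  "poly_with_coeffs S c = (\<Sum>k\<in>S. monom (c k) k)"

text \<open>The pair \<open>(p, q)\<close> collects the coefficients \<open>p i k\<close> of \<open>t ^ k\<close> in \<open>P i\<close> and \<open>q i k\<close> of
  \<open>t ^ k\<close> in \<open>Q i\<close>. For finite supports this is a finite-dimensional coordinate subspace, on
  which the product topology of the function type is the Euclidean topology.\<close>

definition coeff_space ::
    "(nat \<Rightarrow> nat set) \<Rightarrow> (nat \<Rightarrow> nat set) \<Rightarrow>
     ((nat \<Rightarrow> nat \<Rightarrow> complex) \<times> (nat \<Rightarrow> nat \<Rightarrow> complex)) set" where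
  "coeff_space SP SQ = {(p, q).
     (\<forall>i k. p i k \<noteq> 0 \<longrightarrow> i < 2 \<and> k \<in> SP i) \<and> (\<forall>i k. q i k \<noteq> 0 \<longrightarrow> i < 2 \<and> k \<in> SQ i)}"

definition generically :: "'a::topological_space set \<Rightarrow> ('a \<Rightarrow> bool) \<Rightarrow> bool" where
  "generically V R \<longleftrightarrow>
     (\<exists>U. openin (top_of_set V) U \<and> V \<subseteq> closure U \<and> (\<forall>c\<in>U. R c))"

text \<open>\<open>R\<close> holds of the implicit equation of every parameterization with supports \<open>SP\<close>, \<open>SQ\<close>
  and generic coefficients that is given by reduced fractions and has degree 1.\<close>

definition for_generic_implicit_equation ::
    "(nat \<Rightarrow> nat set) \<Rightarrow> (nat \<Rightarrow> nat set) \<Rightarrow> (complex poly poly \<Rightarrow> bool) \<Rightarrow> bool" where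
  "for_generic_implicit_equation SP SQ R \<longleftrightarrow>
     generically (coeff_space SP SQ) (\<lambda>(p, q).
       let P = (\<lambda>i. poly_with_coeffs (SP i) (p i)); Q = (\<lambda>i. poly_with_coeffs (SQ i) (q i))
       in coprime (P 0) (Q 0) \<and> coprime (P 1) (Q 1) \<and> has_param_degree P Q 1 \<longrightarrow>
          (\<forall>\<phi>. is_implicit_equation P Q \<phi> \<longrightarrow> R \<phi>))"

end

theory Submission
  imports Defs "HOL-Computational_Algebra.Fundamental_Theorem_Algebra"
begin

text \<open>The statement has a combinatorial and an algebraic half, and both lead to the same few numbers. Write
\<open>d\<close> and \<open>m\<close> for the degrees of the maps \<open>x = P 0 / Q 0\<close> and \<open>y = P 1 / Q 1\<close>, and let \<open>\<alpha>\<close>, \<open>\<alpha>'\<close> be the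
orders of vanishing of \<open>P 0\<close>, and \<open>\<beta>\<close>, \<open>\<beta>'\<close> those of \<open>Q 1\<close>, at \<open>t = 0\<close> and at \<open>t = \<infinity>\<close>; the order at
infinity refers to the formal degrees \<open>d\<close> of \<open>P 0\<close> and \<open>m\<close> of \<open>Q 1\<close>. Under the
assumption \<open>denominator_ends_selected\<close> both halves give the end points
  \<open>E = (0, d - [\<beta> > 0] \<alpha> - [\<beta>' > 0] \<alpha>')\<close> and \<open>F = ([\<alpha> > 0] \<beta> + [\<alpha>' > 0] \<beta>', d)\<close>,
so that \<open>F - E\<close> is the sum of those of the vectors \<open>(\<beta>, \<alpha>)\<close> and \<open>(\<beta>', \<alpha>')\<close> that have two positive
entries. In the two-edge case these vectors are the two edges of the corner and \<open>\<delta>\<close> is their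
determinant.

Combinatorial half. In a triangulation of two rows of points the bases in each row tile that row
(\<open>bases_unique\<close>, \<open>bases_cover\<close>), and triangles with bases in different rows do not cross
(\<open>noncrossing\<close>). If no selected point of one row is an apex, then the triangles with base near an end of that
row where only selected points lie must have the end point of the other row as apex; similarly if only
selected points of one row are apexes. This bounds the
\<open>e\<close>-values (\<open>e_val_le_of_other_zero\<close>, \<open>e_val_ge_of_other_full\<close>), and triangulations with five
triangles at most attain the bounds (\<open>zigzag_triangulation\<close>).

Algebraic half. For almost all \<open>x\<close>, the fiber \<open>{t. P 0 t - x Q 0 t = 0}\<close> consists of \<open>d\<close> points with distinct
values of \<open>y\<close>, because the parameterization has degree 1; hence \<open>\<phi>(x, y)\<close> is the product of the
\<open>y - y(t)\<close> over the fiber, times the coefficient of \<open>y ^ d\<close>. Comparing this factorization with the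
one obtained after exchanging \<open>x\<close> and \<open>y\<close> determines that coefficient up to a constant as an explicit
product over the zeros of \<open>Q 1\<close> (\<open>top_coeff\<close>), and similarly \<open>\<phi>(0, y)\<close> as a product over the zeros of
\<open>P 0\<close> (\<open>bottom_coeff\<close>, for the exchanged coordinates). Reading off an order and a degree gives \<open>F\<close> and \<open>E\<close> as the lowest, respectively
highest, support points in the top row and in the first column.

Between \<open>E\<close> and \<open>F\<close> the boundary of the Newton polygon consists of edges of positive slope. Along the edge with
direction \<open>(q, p)\<close> the edge polynomial has a nonzero root, so by continuity of roots \<open>\<phi>\<close> has zeros with
\<open>x = s ^ p\<close> and \<open>y\<close> of size \<open>s ^ (- q)\<close> as \<open>s \<longlonglongrightarrow> 0\<close> (\<open>edge_points\<close>). These zeros are points of the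
parameterization; their parameters accumulate at a common zero of \<open>P 0\<close> and \<open>Q 1\<close>, which for generic
coefficients is \<open>0\<close>, or at infinity, and comparing orders of magnitude forces \<open>(q, p)\<close> to be
proportional to \<open>(\<beta>, \<alpha>)\<close> or \<open>(\<beta>', \<alpha>')\<close> (\<open>edge_valuation\<close>). Since slopes decrease along the boundary
and \<open>F - E\<close> is known, there is only one way to get from \<open>E\<close> to \<open>F\<close> (\<open>single_slope\<close>, \<open>two_slopes\<close>).

The lower right corner is the upper left corner of the curve with the two coordinates exchanged.\<close>

section \<open>Triangles with vertices in two rows\<close>

text \<open>The triangle with apex in row \<open>i\<close> and base in the other row, written as in the definition of \<open>e_val\<close>.\<close>

definition tri :: "nat \<Rightarrow> nat \<Rightarrow> nat \<Rightarrow> nat \<Rightarrow> (real \<times> real) set" where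
  "tri i a b b' = convex hull {(real a, real i), (real b, real (1 - i)), (real b', real (1 - i))}"

lemma less_two_cases: "i < 2 \<Longrightarrow> (i = 0 \<Longrightarrow> P) \<Longrightarrow> (i = (1::nat) \<Longrightarrow> P) \<Longrightarrow> P"
  by (auto simp: less_2_cases_iff)

lemma tri_not_collinear:
  assumes "i < 2" "b < b'"
  shows "\<not> collinear {(real a, real i), (real b, real (1 - i)), (real b', real (1 - i))}"
proof
  assume "collinear {(real a, real i), (real b, real (1 - i)), (real b', real (1 - i))}"
  then obtain u v :: "real \<times> real" and f where
    f: "\<And>z. z \<in> {(real a, real i), (real b, real (1 - i)), (real b', real (1 - i))} \<Longrightarrow> z = u + f z *\<^sub>R v"
    unfolding collinear_alt by metis
  obtain c1 c2 c3 where c: "(real a, real i) = u + c1 *\<^sub>R v" "(real b, real (1 - i)) = u + c2 *\<^sub>R v"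
     "(real b', real (1 - i)) = u + c3 *\<^sub>R v"
    using f by (metis insertCI)
  have 1: "(c3 - c2) * snd v = 0" "(c3 - c2) * fst v = real b' - real b"
    "(c1 - c2) * snd v = real i - real (1 - i)"
    using c by (auto simp: prod_eq_iff left_diff_distrib)
  then have "snd v = 0" using assms by auto
  then have "real i = real (1 - i)" using 1(3) by simp
  then have "i = 1 - i" by (simp only: of_nat_eq_iff)
  then show False by arith
qed

lemma tri_eq:
  assumes "i < 2" "b < b'"
  shows "tri i a b b' = {(x, y). \<exists>s. 0 \<le> s \<and> s \<le> 1 \<and> y = s * real i + (1 - s) * real (1 - i) \<and>
     s * real a + (1 - s) * real b \<le> x \<and> x \<le> s * real a + (1 - s) * real b'}" (is "_ = ?R")
proof (rule set_eqI)
  fix z :: "real \<times> real"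
  obtain x y where z: "z = (x, y)" by (cases z)
  show "z \<in> tri i a b b' \<longleftrightarrow> z \<in> ?R"
  proof
    assume "z \<in> tri i a b b'"
    then obtain u v w :: real where u: "0 \<le> u" "0 \<le> v" "0 \<le> w" "u + v + w = 1" and
      x: "x = u * a + v * b + w * b'" and y: "y = u * i + v * real (1-i) + w * real (1-i)"
      unfolding tri_def convex_hull_3 z by auto
    have v: "v = 1 - u - w" using u by simp
    have "w * real b \<le> w * real b'" "v * real b \<le> v * real b'" using u assms by (auto intro: mult_left_mono)
    then have "u * real a + (1 - u) * real b \<le> x \<and> x \<le> u * real a + (1 - u) * real b'"
      unfolding x v by (simp add: algebra_simps)
    moreover have "y = u * real i + (1 - u) * real (1 - i)" unfolding y v by (simp add: algebra_simps)
    ultimately show "z \<in> ?R" using u z by auto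
  next
    assume "z \<in> ?R"
    then obtain s where s: "0 \<le> s" "s \<le> 1" and y: "y = s * real i + (1 - s) * real (1 - i)" and
      x: "s * real a + (1 - s) * real b \<le> x" "x \<le> s * real a + (1 - s) * real b'"
      unfolding z by auto
    define w where "w = (x - s * a - (1 - s) * b) / (real b' - real b)"
    have w: "w * (real b' - real b) = x - s * a - (1 - s) * b"
      unfolding w_def using assms by simp
    have "0 \<le> w" using x assms unfolding w_def by simp
    moreover have "x - s * a - (1 - s) * b \<le> (1 - s) * (real b' - real b)" using x(2) by (simp add: algebra_simps)
    then have "w \<le> 1 - s" unfolding w_def using assms(2) by (subst pos_divide_le_eq) auto
    ultimately show "z \<in> tri i a b b'" unfolding tri_def convex_hull_3 z
      using s w unfolding y
      by (intro CollectI exI[of _ s] exI[of _ "1 - s - w"] exI[of _ w]) (auto simp: algebra_simps)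
  qed
qed

lemma in_interior_tri:
  assumes "i < 2" "b < b'" "0 < s" "s < 1" and y: "y = s * real i + (1 - s) * real (1 - i)"
    and x: "s * real a + (1 - s) * real b < x" "x < s * real a + (1 - s) * real b'"
  shows "(x, y) \<in> interior (tri i a b b')"
proof -
  define w where "w = (x - s * a - (1 - s) * b) / (real b' - real b)"
  have w: "w * (real b' - real b) = x - s * a - (1 - s) * b"
    unfolding w_def using assms by simp
  have "0 < w" using x assms unfolding w_def by simp
  moreover have "x - s * a - (1 - s) * b < (1 - s) * (real b' - real b)" using x(2) by (simp add: algebra_simps)
  then have "w < 1 - s" unfolding w_def using assms(2) by (subst pos_divide_less_eq) auto
  moreover have "(x, y) = s *\<^sub>R (real a, real i) + (1 - s - w) *\<^sub>R (real b, real (1 - i)) + w *\<^sub>R (real b', real (1 - i))"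
    using w y by (simp add: algebra_simps)
  ultimately show ?thesis
    unfolding tri_def using assms(3)
    by (subst interior_convex_hull_3_minimal[OF tri_not_collinear[OF assms(1,2)]])
      (simp, intro CollectI exI[of _ s] exI[of _ "1 - s - w"] exI[of _ w], simp)
qed

lemma tri_affine_independent:
  assumes "i < 2" "b < b'"
  shows "\<not> affine_dependent {(real a, real i), (real b, real (1 - i)), (real b', real (1 - i))}"
  using tri_not_collinear[OF assms] by (auto simp: collinear_3_eq_affine_dependent)

lemma extreme_points_tri:
  assumes "i < 2" "b < b'"
  shows "{v. v extreme_point_of tri i a b b'} = {(real a, real i), (real b, real (1 - i)), (real b', real (1 - i))}"
  unfolding tri_def using extreme_point_of_convex_hull_affine_independent[OF tri_affine_independent[OF assms]]
  by auto

lemma tri_inject: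
  assumes "i < 2" "b < b'" "j < 2" "c < c'" "tri i a b b' = tri j e c c'"
  shows "i = j \<and> a = e \<and> b = c \<and> b' = c'"
proof -
  have "{(real a, real i), (real b, real (1 - i)), (real b', real (1 - i))} =
    {(real e, real j), (real c, real (1 - j)), (real c', real (1 - j))}" (is "?L = ?R")
    using extreme_points_tri[OF assms(1,2), of a] extreme_points_tri[OF assms(3,4), of e] assms(5) by simp
  have "i = j"
  proof (rule ccontr)
    assume "i \<noteq> j"
    then have "1 - i = j" "real i \<noteq> real j" using assms(1,3) by (auto simp: less_2_cases_iff)
    moreover have "(real b, real (1 - i)) \<in> ?R" "(real b', real (1 - i)) \<in> ?R"
      unfolding \<open>?L = ?R\<close>[symmetric] by auto
    ultimately have "real b = real e" "real b' = real e" using assms(3) by (auto simp: less_2_cases_iff)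
    then show False using assms(2) by simp
  qed
  moreover have "{z\<in>?L. snd z = real i} = {z\<in>?R. snd z = real i}" "{z\<in>?L. snd z = real (1 - i)} = {z\<in>?R. snd z = real (1 - i)}"
    using \<open>?L = ?R\<close> by auto
  moreover have "{z\<in>?L. snd z = real i} = {(real a, real i)}" "{z\<in>?L. snd z = real (1 - i)} = {(real b, real (1 - i)), (real b', real (1 - i))}"
    using assms(1) by (auto elim: less_two_cases)
  moreover have "{z\<in>?R. snd z = real i} = {(real e, real i)}" "{z\<in>?R. snd z = real (1 - i)} = {(real c, real (1 - i)), (real c', real (1 - i))}"
    using assms(1) \<open>i = j\<close> by (auto elim: less_two_cases)
  ultimately show ?thesis
    using assms(2,4) by (auto simp: doubleton_eq_iff)
qed

lemma two_simplex_tri: "i < 2 \<Longrightarrow> b < b' \<Longrightarrow> 2 simplex tri i a b b'"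
  unfolding tri_def
  by (intro simplex_convex_hull conjI tri_affine_independent) (auto simp: card_insert_if less_2_cases_iff)

lemma two_rowsE:
  assumes "v \<in> two_rows A"
  obtains i a where "i < 2" "a \<in> A i" "v = (real a, real i)"
  using assms that[of 0] that[of 1] unfolding two_rows_def by auto

lemma two_rowsI: "i < 2 \<Longrightarrow> a \<in> A i \<Longrightarrow> (real a, real i) \<in> two_rows A"
  unfolding two_rows_def by (auto simp: less_2_cases_iff)

lemma same_row_collinear: "collinear {(x1, y), (x2, y), (x3::real, y::real)}"
  unfolding collinear_alt
  by (rule exI[of _ "(0, y)"], rule exI[of _ "(1, 0)"]) auto

text \<open>Three points of one row are collinear, so the vertices of a triangle are split as one and two.\<close>

lemma triangulation_triangle:
  assumes "T \<in> triangulations A" "\<Delta> \<in> T"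
  obtains i a b b' where "i < 2" "a \<in> A i" "b \<in> A (1 - i)" "b' \<in> A (1 - i)" "b < b'" "\<Delta> = tri i a b b'"
proof -
  note result = that
  have "2 simplex \<Delta>" and ext: "{v. v extreme_point_of \<Delta>} \<subseteq> two_rows A"
    using assms unfolding triangulations_def by auto
  then obtain C where C: "\<not> affine_dependent C" "card C = 3" "\<Delta> = convex hull C"
    unfolding simplex_def by auto
  have "C \<subseteq> two_rows A" using ext C extreme_point_of_convex_hull_affine_independent[OF C(1)] by auto
  moreover obtain p q r where pqr: "C = {p, q, r}" "p \<noteq> q" "q \<noteq> r" "p \<noteq> r"
    using C(2) by (auto simp: card_3_iff)
  ultimately obtain i a j b k c where
    v: "i < 2" "a \<in> A i" "p = (real a, real i)" "j < 2" "b \<in> A j" "q = (real b, real j)"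
     "k < 2" "c \<in> A k" "r = (real c, real k)"
    by (metis insert_subset two_rowsE)
  have nc: "\<not> (i = j \<and> j = k)"
  proof
    assume "i = j \<and> j = k"
    then have "collinear {p, q, r}" using v same_row_collinear by simp
    then show False using C(1) pqr unfolding collinear_3_eq_affine_dependent by auto
  qed
  have main: thesis if "{p, q, r} = {(real x, real l), (real y, real (1 - l)), (real z, real (1 - l))}"
    "l < 2" "x \<in> A l" "y \<in> A (1 - l)" "z \<in> A (1 - l)" "y \<noteq> z" for l x y z
  proof (cases "y < z")
    case True
    show thesis
      by (rule result[OF that(2-5) True]) (simp only: C(3) pqr(1) that(1) tri_def)
  next
    case False
    then have "z < y" using that(6) by simp
    show thesis
      by (rule result[OF that(2,3,5,4) \<open>z < y\<close>]) (simp only: C(3) pqr(1) that(1) tri_def insert_commute)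
  qed
  consider "j = k" "i = 1 - j" | "i = k" "j = 1 - i" | "i = j" "k = 1 - i"
    using nc v by (auto simp: less_2_cases_iff)
  then show thesis
  proof cases
    case 1
    then have "real b \<noteq> real c" using pqr(3) v by auto
    then show thesis using main[of a i b c] 1 v by (auto simp: less_2_cases_iff)
  next
    case 2
    then have "real a \<noteq> real c" "{p,q,r} = {q, p, r}" using pqr(4) v by auto
    then show thesis using main[of b j a c] 2 v by (auto simp: less_2_cases_iff)
  next
    case 3
    then have "real a \<noteq> real b" "{p,q,r} = {r, p, q}" using pqr(2) v by auto
    then show thesis using main[of c k a b] 3 v by (auto simp: less_2_cases_iff)
  qed
qed

text \<open>The common part of two triangles is a face of both, and a face that meets the interior is the whole triangle.\<close>

lemma triangulation_interior_disjoint: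
  assumes "T \<in> triangulations A" "\<Delta> \<in> T" "\<Delta>' \<in> T" "z \<in> interior \<Delta>" "z \<in> interior \<Delta>'"
  shows "\<Delta> = \<Delta>'"
proof -
  have *: "\<Delta> \<inter> \<Delta>' face_of \<Delta>" if "\<Delta> \<in> T" "\<Delta>' \<in> T" for \<Delta> \<Delta>'
    using assms(1) that unfolding triangulations_def triangulation_def by blast
  have "\<Delta> \<inter> \<Delta>' = \<Delta>" if "\<Delta> \<in> T" "\<Delta>' \<in> T" "z \<in> interior \<Delta>" "z \<in> interior \<Delta>'" for \<Delta> \<Delta>'
    using face_of_disjoint_interior[OF *[OF that(1,2)]] that interior_subset by blast
  from this[of \<Delta> \<Delta>'] this[of \<Delta>' \<Delta>] show ?thesis using assms by blast
qed

section \<open>Bases of the triangles in each row\<close>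

text \<open>The index set of the sum \<open>e_val\<close>, for an arbitrary set \<open>S\<close> of admissible apexes.\<close>

definition bases :: "(nat \<Rightarrow> nat set) \<Rightarrow> nat set \<Rightarrow> nat \<Rightarrow> (real \<times> real) set set \<Rightarrow> (nat \<times> nat \<times> nat) set" where
  "bases A S i T = {(a, b, b'). a \<in> S \<and> b \<in> A (1 - i) \<and> b' \<in> A (1 - i) \<and> b < b' \<and> tri i a b b' \<in> T}"

lemma e_val_bases: "e_val A Sel i T = (\<Sum>(a, b, b')\<in>bases A (Sel i) i T. b' - b)"
  unfolding e_val_def bases_def tri_def ..

context
  fixes A :: "nat \<Rightarrow> nat set" and T
  assumes fin: "\<And>i. i < 2 \<Longrightarrow> finite (A i)" and T: "T \<in> triangulations A"
begin

lemma triangles_meet_imp_equal: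
  assumes "tri i a b b' \<in> T" "tri j c d d' \<in> T" "z \<in> interior (tri i a b b')" "z \<in> interior (tri j c d d')"
    "i < 2" "j < 2" "b < b'" "d < d'"
  shows "i = j \<and> a = c \<and> b = d \<and> b' = d'"
  using triangulation_interior_disjoint[OF T assms(1-4)] tri_inject[OF assms(5,7,6,8)] by blast

text \<open>The open bases in one row are pairwise disjoint: the horizontal slices of two triangles whose bases
share a unit interval overlap if the slices are taken close enough to the row of the bases.\<close>

lemma bases_unique:
  assumes "i < 2" "tri i a b b' \<in> T" "tri i c d d' \<in> T" "b \<le> k" "k < b'" "d \<le> k" "k < d'"
  shows "a = c \<and> b = d \<and> b' = d'"
proof -
  define M where "M = 1 + \<bar>real a - real b\<bar> + \<bar>real a - real b'\<bar> + \<bar>real c - real d\<bar> + \<bar>real c - real d'\<bar> + real k"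
  have M: "M \<ge> 1" unfolding M_def by simp
  define s where "s = 1 / (2 * M)"
  have s0: "0 < s" "s < 1" "s * M = 1/2" using M unfolding s_def by (auto simp: field_simps)
  have small: "\<bar>s * w\<bar> < 1/2" if "\<bar>w\<bar> < M" for w
    using that s0 by (metis abs_mult abs_of_pos mult_strict_left_mono)
  \<comment> \<open>At this small height both slices contain the abscissa \<open>k + 1/2\<close>.\<close>
  have *: "s * real a + (1 - s) * real b < real k + 1/2" "real k + 1/2 < s * real a + (1 - s) * real b'"
     "s * real c + (1 - s) * real d < real k + 1/2" "real k + 1/2 < s * real c + (1 - s) * real d'"
  proof -
    have "\<bar>real a - real b\<bar> < M" "\<bar>real a - real b'\<bar> < M" "\<bar>real c - real d\<bar> < M" "\<bar>real c - real d'\<bar> < M"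
      unfolding M_def by linarith+
    note this[THEN small]
    moreover have "real b \<le> real k" "real k + 1 \<le> real b'" "real d \<le> real k" "real k + 1 \<le> real d'"
      using assms(4-7) by auto
    ultimately show "s * real a + (1 - s) * real b < real k + 1/2" "real k + 1/2 < s * real a + (1 - s) * real b'"
     "s * real c + (1 - s) * real d < real k + 1/2" "real k + 1/2 < s * real c + (1 - s) * real d'"
      unfolding left_diff_distrib right_diff_distrib mult_1 abs_less_iff by linarith+
  qed
  let ?z = "(real k + 1/2, s * real i + (1 - s) * real (1 - i))"
  have "?z \<in> interior (tri i a b b')" "?z \<in> interior (tri i c d d')"
    using in_interior_tri[OF assms(1) _ s0(1,2) refl] * assms by auto
  from triangles_meet_imp_equal[OF assms(2,3) this] assms show ?thesis by simp
qed

text \<open>If the triangle with base in the row of \<open>b\<close> starts to the left of \<open>b\<close> but has its apex to the right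
of \<open>a\<close>, then the left sides of the two triangles cross, and just to the right of the crossing point
the two triangles overlap.\<close>

lemma noncrossing:
  assumes "i < 2" "tri i b a a' \<in> T" "tri (1 - i) e c c' \<in> T" "a < a'" "c < c'" "c < b"
  shows "e \<le> a"
proof (rule ccontr)
  assume "\<not> e \<le> a"
  then have ea: "real e - real a > 0" and bc: "real b - real c > 0" using assms by auto
  define D where "D = (real e - real a) + (real b - real c)"
  define h where "h = (real e - real a) / D"
  have D: "D > 0" unfolding D_def using ea bc by simp
  have h: "0 < h" "h < 1" "h * D = real e - real a" using ea bc D unfolding h_def D_def by auto
  \<comment> \<open>At height \<open>h\<close> the left sides of the two triangles meet, in a point with abscissa \<open>L\<close>.\<close>
  define L where "L = h * real b + (1 - h) * real a"
  have L2: "L = (1 - h) * real e + h * real c" using h(3) unfolding L_def D_def by (simp add: algebra_simps)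
  define \<eta> where "\<eta> = min ((1 - h) * (real a' - real a)) (h * (real c' - real c)) / 2"
  have m: "(1 - h) * (real a' - real a) > 0" "h * (real c' - real c) > 0" using h assms by auto
  have eta: "\<eta> > 0" "\<eta> < (1 - h) * (real a' - real a)" "\<eta> < h * (real c' - real c)"
    using m unfolding \<eta>_def by linarith+
  let ?z = "(L + \<eta>, h * real i + (1 - h) * real (1 - i))"
  have "?z \<in> interior (tri i b a a')"
    using eta h assms unfolding L_def by (intro in_interior_tri) (auto simp: algebra_simps)
  moreover have "?z \<in> interior (tri (1 - i) e c c')"
    using eta h assms(1,5) unfolding L2 by (intro in_interior_tri[where s = "1 - h"]) (auto simp: algebra_simps)
  ultimately have "i = 1 - i"
    using triangles_meet_imp_equal[OF assms(2,3)] assms by auto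
  then show False by arith
qed

text \<open>The mirror image of \<open>noncrossing\<close>, with the right sides of the triangles.\<close>

lemma noncrossing_right:
  assumes "i < 2" "tri i b a a' \<in> T" "tri (1 - i) e c c' \<in> T" "a < a'" "c < c'" "b < c'"
  shows "a' \<le> e"
proof (rule ccontr)
  assume "\<not> a' \<le> e"
  then have ea: "real a' - real e > 0" and bc: "real c' - real b > 0" using assms by auto
  define D where "D = (real a' - real e) + (real c' - real b)"
  define h where "h = (real a' - real e) / D"
  have D: "D > 0" unfolding D_def using ea bc by simp
  have h: "0 < h" "h < 1" "h * D = real a' - real e" using ea bc D unfolding h_def D_def by auto
  \<comment> \<open>At height \<open>h\<close> the right sides of the two triangles meet, in a point with abscissa \<open>L\<close>.\<close>
  define L where "L = h * real b + (1 - h) * real a'"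
  have L2: "L = (1 - h) * real e + h * real c'" using h(3) unfolding L_def D_def by (simp add: algebra_simps)
  define \<eta> where "\<eta> = min ((1 - h) * (real a' - real a)) (h * (real c' - real c)) / 2"
  have m: "(1 - h) * (real a' - real a) > 0" "h * (real c' - real c) > 0" using h assms by auto
  have eta: "\<eta> > 0" "\<eta> < (1 - h) * (real a' - real a)" "\<eta> < h * (real c' - real c)"
    using m unfolding \<eta>_def by linarith+
  let ?z = "(L - \<eta>, h * real i + (1 - h) * real (1 - i))"
  have "?z \<in> interior (tri i b a a')"
    using eta h assms unfolding L_def by (intro in_interior_tri) (auto simp: algebra_simps)
  moreover have "?z \<in> interior (tri (1 - i) e c c')"
    using eta h assms(1,5) unfolding L2 by (intro in_interior_tri[where s = "1 - h"]) (auto simp: algebra_simps)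
  ultimately have "i = 1 - i"
    using triangles_meet_imp_equal[OF assms(2,3)] assms by auto
  then show False by arith
qed

text \<open>The bases in a row cover it: a triangle through the midpoint of a unit interval of the row must
have a side in the row, because the midpoint is not a vertex.\<close>

lemma bases_cover:
  assumes "i < 2" "A (1 - i) \<noteq> {}" "Min (A (1 - i)) \<le> k" "k < Max (A (1 - i))"
  obtains a b b' where "(a, b, b') \<in> bases A (A i) i T" "b \<le> k" "k < b'"
proof -
  have f: "finite (A (1 - i))" using fin assms(1) by auto
  let ?z = "(real k + 1/2, real (1 - i))"
  let ?l = "(real (Min (A (1 - i))), real (1 - i))" and ?r = "(real (Max (A (1 - i))), real (1 - i))"
  have "?l \<in> two_rows A" "?r \<in> two_rows A"
    by (intro two_rowsI Min_in Max_in; use assms f in simp)+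
  then have "closed_segment ?l ?r \<subseteq> convex hull two_rows A"
    by (simp add: closed_segment_subset hull_inc)
  moreover have "?z \<in> closed_segment ?l ?r"
  proof -
    define w where "w = (real k + 1/2 - real (Min (A (1 - i)))) / (real (Max (A (1 - i))) - real (Min (A (1 - i))))"
    have D: "real (Max (A (1 - i))) - real (Min (A (1 - i))) > 0" using assms by simp
    then have w: "w * (real (Max (A (1 - i))) - real (Min (A (1 - i)))) = real k + 1/2 - real (Min (A (1 - i)))"
      unfolding w_def by simp
    have "real k + 1 / 2 - real (Min (A (1 - i))) \<le> 1 * (real (Max (A (1 - i))) - real (Min (A (1 - i))))"
      using assms(3,4) by simp
    then have "0 \<le> w" "w \<le> 1" using assms(3,4) D unfolding w_def by (auto simp: pos_divide_le_eq)
    moreover have "?z = (1 - w) *\<^sub>R ?l + w *\<^sub>R ?r" using w by (auto simp: algebra_simps)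
    ultimately show ?thesis unfolding closed_segment_def by blast
  qed
  ultimately have "?z \<in> \<Union>T" using T unfolding triangulations_def by auto
  then obtain \<Delta> where \<Delta>: "\<Delta> \<in> T" "?z \<in> \<Delta>" by auto
  obtain j a b b' where t: "j < 2" "a \<in> A j" "b \<in> A (1 - j)" "b' \<in> A (1 - j)" "b < b'" "\<Delta> = tri j a b b'"
    using triangulation_triangle[OF T \<Delta>(1)] by metis
  have "?z \<in> tri j a b b'" using \<Delta> t by simp
  then obtain s where s: "0 \<le> s" "s \<le> 1" "real (1 - i) = s * real j + (1 - s) * real (1 - j)"
    "s * real a + (1 - s) * real b \<le> real k + 1/2" "real k + 1/2 \<le> s * real a + (1 - s) * real b'"
    unfolding tri_eq[OF t(1,5)] by auto
  have "j = i"
  proof (rule ccontr)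
    assume "j \<noteq> i"
    then have "s = 1" using s(3) assms(1) t(1) by (auto simp: less_2_cases_iff)
    then have "real a = real k + 1/2" using s by simp
    then have "real (2 * a) = real (2 * k + 1)" by simp
    then have "2 * a = 2 * k + 1" by (simp only: of_nat_eq_iff)
    then show False by arith
  qed
  then have "s = 0" using s(3) assms(1) by (auto simp: less_2_cases_iff)
  then have "b \<le> k" "k < b'" using s(4,5) by auto
  then show ?thesis using that t \<Delta> \<open>j = i\<close> unfolding bases_def by auto
qed

lemma finite_bases: "i < 2 \<Longrightarrow> S \<subseteq> A i \<Longrightarrow> finite (bases A S i T)"
  by (rule finite_subset[of _ "A i \<times> A (1 - i) \<times> A (1 - i)"]) (auto simp: bases_def fin)

text \<open>Disjointness of the bases turns a sum of base lengths into the cardinality of a set of unit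
intervals, so that estimates for \<open>e_val\<close> become inclusions of sets.\<close>

lemma sum_bases:
  assumes "i < 2" "S \<subseteq> A i" "B \<subseteq> bases A S i T"
  shows "(\<Sum>(a, b, b')\<in>B. b' - b) = card (\<Union>(a, b, b')\<in>B. {b..<b'})"
proof -
  have f: "finite B" using finite_bases[OF assms(1,2)] assms(3) finite_subset by blast
  have "card (\<Union>t\<in>B. case t of (a, b, b') \<Rightarrow> {b..<b'}) = (\<Sum>t\<in>B. card (case t of (a, b, b') \<Rightarrow> {b..<b'}))"
  proof (rule card_UN_disjoint[OF f])
    show "\<forall>t\<in>B. \<forall>u\<in>B. t \<noteq> u \<longrightarrow> (case t of (a, b, b') \<Rightarrow> {b..<b'}) \<inter> (case u of (a, b, b') \<Rightarrow> {b..<b'}) = {}"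
    proof (intro ballI impI)
      fix t u assume tu: "t \<in> B" "u \<in> B" "t \<noteq> u"
      obtain a b b' c d d' where e: "t = (a, b, b')" "u = (c, d, d')" by (metis surj_pair)
      have "tri i a b b' \<in> T" "tri i c d d' \<in> T" using tu e assms(3) unfolding bases_def by auto
      then have "\<not> (b \<le> k \<and> k < b' \<and> d \<le> k \<and> k < d')" for k
        using bases_unique[OF assms(1), of a b b' c d d' k] tu(3) e by auto
      then have "{b..<b'} \<inter> {d..<d'} = {}" by (metis atLeastLessThan_iff disjoint_iff)
      then show "(case t of (a, b, b') \<Rightarrow> {b..<b'}) \<inter> (case u of (a, b, b') \<Rightarrow> {b..<b'}) = {}"
        unfolding e by simp
    qed
  qed auto
  also have "\<dots> = (\<Sum>(a, b, b')\<in>B. b' - b)" by (intro sum.cong) auto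
  finally show ?thesis by simp
qed

lemma sum_bases_le:
  assumes "i < 2" "S \<subseteq> A i" "\<And>a b b'. (a, b, b') \<in> bases A S i T \<Longrightarrow> lo \<le> b \<and> b' \<le> hi"
  shows "(\<Sum>(a, b, b')\<in>bases A S i T. b' - b) \<le> hi - lo"
proof -
  have "(\<Sum>(a, b, b')\<in>bases A S i T. b' - b) = card (\<Union>(a, b, b')\<in>bases A S i T. {b..<b'})"
    by (rule sum_bases[OF assms(1,2)]) simp
  also have "\<dots> \<le> card {lo..<hi}"
    using assms(3) by (intro card_mono) fastforce+
  finally show ?thesis by simp
qed

lemma bases_range:
  assumes "i < 2" "(a, b, b') \<in> bases A S i T"
  shows "Min (A (1 - i)) \<le> b \<and> b' \<le> Max (A (1 - i))"
  using assms fin[of "1 - i"] unfolding bases_def by auto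

text \<open>A base whose apex is not in \<open>S\<close> would be missing from the sum.\<close>

lemma full_imp_all_selected:
  assumes "i < 2" "A (1 - i) \<noteq> {}" "S \<subseteq> A i" "(\<Sum>(a, b, b')\<in>bases A S i T. b' - b) = Max (A (1 - i)) - Min (A (1 - i))"
    and "(a, b, b') \<in> bases A (A i) i T"
  shows "a \<in> S"
proof (rule ccontr)
  assume a: "a \<notin> S"
  have b: "tri i a b b' \<in> T" "b < b'" using assms(5) unfolding bases_def by auto
  have r: "Min (A (1 - i)) \<le> b" "b' \<le> Max (A (1 - i))" using bases_range[OF assms(1,5)] by auto
  have "(\<Sum>(a, b, b')\<in>bases A S i T. b' - b) = card (\<Union>(a, b, b')\<in>bases A S i T. {b..<b'})"
    by (rule sum_bases[OF assms(1,3)]) simp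
  also have "\<dots> \<le> card ({Min (A (1 - i))..<Max (A (1 - i))} - {b})"
  proof (rule card_mono)
    show "(\<Union>(a, b, b')\<in>bases A S i T. {b..<b'}) \<subseteq> {Min (A (1 - i))..<Max (A (1 - i))} - {b}"
    proof safe
      fix c d d' k assume k: "(c, d, d') \<in> bases A S i T" "k \<in> {d..<d'}"
      show "k \<in> {Min (A (1 - i))..<Max (A (1 - i))}"
        using bases_range[OF assms(1) k(1)] k(2) by auto
    next
      fix c d d' assume k: "(c, d, d') \<in> bases A S i T" "b \<in> {d..<d'}"
      then show False using bases_unique[OF assms(1) b(1), of c d d' b] a b unfolding bases_def by auto
    qed
  qed simp
  also have "\<dots> < Max (A (1 - i)) - Min (A (1 - i))"
    using r b by (subst card_Diff_singleton) auto
  finally show False using assms(4) by simp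
qed

end

section \<open>Bounds for the e-values\<close>

lemma e_val_le_full:
  assumes fin: "\<And>i. i < 2 \<Longrightarrow> finite (A i)" and T: "T \<in> triangulations A" and i: "i < 2" and S: "Sel i \<subseteq> A i"
  shows "e_val A Sel i T \<le> Max (A (1 - i)) - Min (A (1 - i))"
  unfolding e_val_bases using bases_range[OF fin T i] S by (intro sum_bases_le[OF fin T i S]) (auto simp: bases_def)

text \<open>Suppose that the first point of row \<open>i\<close> is not selected. A triangle with selected apex in row \<open>i\<close> has a
triangle with base in row \<open>i\<close> to the left of its apex. The apex of the latter is a nonselected point of
the other row, since the \<open>e\<close>-value of that row vanishes, and by \<open>noncrossing\<close> it bounds the base of the
former from the left. The right end is treated in the same way.\<close>

lemma e_val_le_of_other_zero:
  assumes fin: "\<And>i. i < 2 \<Longrightarrow> finite (A i)" and T: "T \<in> triangulations A" and i: "i < 2"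
    and Sel: "\<And>i. i < 2 \<Longrightarrow> Sel i \<subseteq> A i" "Sel i \<noteq> {}"
    and z: "e_val A Sel (1 - i) T = 0"
  shows "e_val A Sel i T \<le>
     (if Max (A i) \<in> Sel i then Max (A (1 - i)) else Max (A (1 - i) - Sel (1 - i))) -
     (if Min (A i) \<in> Sel i then Min (A (1 - i)) else Min (A (1 - i) - Sel (1 - i)))"
proof -
  have i': "1 - i < 2" "1 - (1 - i) = i" using i by auto
  have f: "finite (A i)" "finite (A (1 - i))" using fin i i' by auto
  have nosel: "(e, c, c') \<in> bases A (A (1 - i)) (1 - i) T \<Longrightarrow> e \<in> A (1 - i) - Sel (1 - i)" for e c c'
  proof -
    assume *: "(e, c, c') \<in> bases A (A (1 - i)) (1 - i) T"
    have "e \<notin> Sel (1 - i)"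
    proof
      assume "e \<in> Sel (1 - i)"
      then have "(e, c, c') \<in> bases A (Sel (1 - i)) (1 - i) T" "c < c'" using * unfolding bases_def by auto
      then show False using z finite_bases[OF fin T i'(1) Sel(1)[OF i'(1)]] unfolding e_val_bases
        by (auto simp: sum_eq_0_iff)
    qed
    then show ?thesis using * by (auto simp: bases_def)
  qed
  show ?thesis
  unfolding e_val_bases
  proof (rule sum_bases_le[OF fin T i Sel(1)[OF i]])
    fix a b b' assume B: "(a, b, b') \<in> bases A (Sel i) i T"
    then have t: "tri i a b b' \<in> T" "b < b'" "a \<in> Sel i" "a \<in> A i" using Sel(1)[OF i] by (auto simp: bases_def)
    have "(a, b, b') \<in> bases A (A i) i T" using B t by (auto simp: bases_def)
    then have r: "Min (A (1 - i)) \<le> b \<and> b' \<le> Max (A (1 - i))" using bases_range[OF fin T i] by blast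
    have "Min (A (1 - i) - Sel (1 - i)) \<le> b" if "Min (A i) \<notin> Sel i"
    proof -
      have "Min (A i) < a" using t that f by (metis Min_le order_le_less)
      moreover have "a \<le> Max (A i)" using t f by auto
      ultimately have "Min (A i) \<le> a - 1" "a - 1 < Max (A i)" by auto
      \<comment> \<open>The base that covers the unit interval to the left of \<open>a\<close> starts to the left of \<open>a\<close>.\<close>
      then obtain e c c' where e: "(e, c, c') \<in> bases A (A (1 - i)) (1 - i) T" "c \<le> a - 1" "a - 1 < c'"
        using bases_cover[OF fin T i'(1), of "a - 1"] t i' by (metis empty_iff)
      then have "e \<le> b" using noncrossing[OF fin T i t(1), of e c c'] t \<open>Min (A i) < a\<close> i' by (auto simp: bases_def)
      moreover have "Min (A (1 - i) - Sel (1 - i)) \<le> e" using nosel[OF e(1)] f by simp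
      ultimately show ?thesis by simp
    qed
    moreover have "b' \<le> Max (A (1 - i) - Sel (1 - i))" if "Max (A i) \<notin> Sel i"
    proof -
      have "a < Max (A i)" using t that f by (metis Max_ge order_le_less)
      moreover have "Min (A i) \<le> a" using t f by auto
      ultimately obtain e c c' where e: "(e, c, c') \<in> bases A (A (1 - i)) (1 - i) T" "c \<le> a" "a < c'"
        using bases_cover[OF fin T i'(1), of "a"] t i' by (metis empty_iff)
      then have "b' \<le> e" using noncrossing_right[OF fin T i t(1), of e c c'] t i' by (auto simp: bases_def)
      moreover have "e \<le> Max (A (1 - i) - Sel (1 - i))" using nosel[OF e(1)] f by simp
      ultimately show ?thesis by simp
    qed
    ultimately show "(if Min (A i) \<in> Sel i then Min (A (1 - i)) else Min (A (1 - i) - Sel (1 - i))) \<le> b \<and>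
      b' \<le> (if Max (A i) \<in> Sel i then Max (A (1 - i)) else Max (A (1 - i) - Sel (1 - i)))"
      using r by simp
  qed
qed

text \<open>If every base in row \<open>i\<close> has a selected apex, then a triangle whose base starts to the left of all
selected points of its row has the first point of row \<open>i\<close> as apex: otherwise a base in row \<open>i\<close> to the
left of that apex has a selected apex, which by \<open>noncrossing\<close> is to the left of all selected points.
Similarly on the right. If the end points of
row \<open>i\<close> are selected, these triangles contribute to \<open>e_val\<close>.\<close>

lemma e_val_ge_of_other_full:
  assumes fin: "\<And>i. i < 2 \<Longrightarrow> finite (A i)" and T: "T \<in> triangulations A" and i: "i < 2"
    and Sel: "\<And>i. i < 2 \<Longrightarrow> Sel i \<subseteq> A i" "Sel (1 - i) \<noteq> {}" and ne: "Min (A i) < Max (A i)" "A i \<noteq> {}"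
    and full: "e_val A Sel (1 - i) T = Max (A i) - Min (A i)"
  shows "(if Min (A i) \<in> Sel i then Min (Sel (1 - i)) - Min (A (1 - i)) else 0) +
     (if Max (A i) \<in> Sel i then Max (A (1 - i)) - Max (Sel (1 - i)) else 0) \<le> e_val A Sel i T"
proof -
  have i': "1 - i < 2" "1 - (1 - i) = i" using i by auto
  have f: "finite (A i)" "finite (A (1 - i))" "finite (Sel (1 - i))"
    using fin i i' Sel finite_subset by metis+
  have ne': "A (1 - i) \<noteq> {}" using Sel i' by fastforce
  have sel: "e \<in> Sel (1 - i)" if "(e, c, c') \<in> bases A (A (1 - i)) (1 - i) T" for e c c'
    using full_imp_all_selected[OF fin T i'(1) _ Sel(1)[OF i'(1)] _ that] full ne i' by (simp add: e_val_bases)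
  have left: "a = Min (A i)" if "(a, b, b') \<in> bases A (A i) i T" "b < Min (Sel (1 - i))" for a b b'
  proof (rule ccontr)
    assume "a \<noteq> Min (A i)"
    have t: "tri i a b b' \<in> T" "b < b'" "a \<in> A i" using that by (auto simp: bases_def)
    then have "Min (A i) < a" "a \<le> Max (A i)" using f \<open>a \<noteq> Min (A i)\<close> by (metis Min_le order_le_less, simp)
    then have "Min (A i) \<le> a - 1" "a - 1 < Max (A i)" by auto
    then obtain e c c' where e: "(e, c, c') \<in> bases A (A (1 - i)) (1 - i) T" "c \<le> a - 1" "a - 1 < c'"
      using bases_cover[OF fin T i'(1), of "a - 1"] t i' by (metis empty_iff)
    then have "e \<le> b" using noncrossing[OF fin T i t(1), of e c c'] t \<open>Min (A i) < a\<close> i' by (auto simp: bases_def)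
    moreover have "Min (Sel (1 - i)) \<le> e" using sel[OF e(1)] f by simp
    ultimately show False using that by simp
  qed
  have right: "a = Max (A i)" if "(a, b, b') \<in> bases A (A i) i T" "b' > Max (Sel (1 - i))" for a b b'
  proof (rule ccontr)
    assume "a \<noteq> Max (A i)"
    have t: "tri i a b b' \<in> T" "b < b'" "a \<in> A i" using that by (auto simp: bases_def)
    then have "Min (A i) \<le> a" "a < Max (A i)" using f \<open>a \<noteq> Max (A i)\<close> by (simp, metis Max_ge order_le_less)
    then obtain e c c' where e: "(e, c, c') \<in> bases A (A (1 - i)) (1 - i) T" "c \<le> a" "a < c'"
      using bases_cover[OF fin T i'(1), of "a"] t i' by (metis empty_iff)
    then have "b' \<le> e" using noncrossing_right[OF fin T i t(1), of e c c'] t i' by (auto simp: bases_def)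
    moreover have "e \<le> Max (Sel (1 - i))" using sel[OF e(1)] f by simp
    ultimately show False using that by simp
  qed
  \<comment> \<open>The triangles at the two ends are counted separately; their apexes differ because row \<open>i\<close> is nontrivial.\<close>
  define BL where "BL = {(a, b, b') \<in> bases A (Sel i) i T. a = Min (A i)}"
  define BR where "BR = {(a, b, b') \<in> bases A (Sel i) i T. a = Max (A i)}"
  have sub: "BL \<subseteq> bases A (Sel i) i T" "BR \<subseteq> bases A (Sel i) i T" "BL \<inter> BR = {}"
    using ne unfolding BL_def BR_def by auto
  have fb: "finite (bases A (Sel i) i T)" by (rule finite_bases[OF fin T i Sel(1)[OF i]])
  have fu: "finite (\<Union>(a, b, b')\<in>B. {b..<b'})" if "B \<subseteq> bases A (Sel i) i T" for B
    using fb finite_subset[OF that] by auto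
  have L: "(if Min (A i) \<in> Sel i then Min (Sel (1 - i)) - Min (A (1 - i)) else 0) \<le> (\<Sum>(a, b, b')\<in>BL. b' - b)"
  proof (cases "Min (A i) \<in> Sel i")
    case True
    have "{Min (A (1 - i))..<Min (Sel (1 - i))} \<subseteq> (\<Union>(a, b, b')\<in>BL. {b..<b'})"
    proof
      fix k assume k: "k \<in> {Min (A (1 - i))..<Min (Sel (1 - i))}"
      have "Min (Sel (1 - i)) \<le> Max (A (1 - i))" using Sel i' f by (metis Max_ge Min_in subsetD)
      then obtain a b b' where a: "(a, b, b') \<in> bases A (A i) i T" "b \<le> k" "k < b'"
        using bases_cover[OF fin T i ne', of k] k by auto
      then have "a = Min (A i)" using left[OF a(1)] k by auto
      then have "(a, b, b') \<in> BL" using a True unfolding BL_def bases_def by auto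
      then show "k \<in> (\<Union>(a, b, b')\<in>BL. {b..<b'})" using a by force
    qed
    from card_mono[OF fu[OF sub(1)] this] show ?thesis using sum_bases[OF fin T i Sel(1)[OF i] sub(1)] True by simp
  qed simp
  have R: "(if Max (A i) \<in> Sel i then Max (A (1 - i)) - Max (Sel (1 - i)) else 0) \<le> (\<Sum>(a, b, b')\<in>BR. b' - b)"
  proof (cases "Max (A i) \<in> Sel i")
    case True
    have "{Max (Sel (1 - i))..<Max (A (1 - i))} \<subseteq> (\<Union>(a, b, b')\<in>BR. {b..<b'})"
    proof
      fix k assume k: "k \<in> {Max (Sel (1 - i))..<Max (A (1 - i))}"
      have "Min (A (1 - i)) \<le> Max (Sel (1 - i))" using Sel i' f by (metis Min_le Max_in subsetD)
      then obtain a b b' where a: "(a, b, b') \<in> bases A (A i) i T" "b \<le> k" "k < b'"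
        using bases_cover[OF fin T i ne', of k] k by auto
      then have "a = Max (A i)" using right[OF a(1)] k by auto
      then have "(a, b, b') \<in> BR" using a True unfolding BR_def bases_def by auto
      then show "k \<in> (\<Union>(a, b, b')\<in>BR. {b..<b'})" using a by force
    qed
    from card_mono[OF fu[OF sub(2)] this] show ?thesis using sum_bases[OF fin T i Sel(1)[OF i] sub(2)] True by simp
  qed simp
  have "(\<Sum>(a, b, b')\<in>BL. b' - b) + (\<Sum>(a, b, b')\<in>BR. b' - b) = (\<Sum>(a, b, b')\<in>BL \<union> BR. b' - b)"
    using sub fb finite_subset by (intro sum.union_disjoint[symmetric]) auto
  also have "\<dots> \<le> e_val A Sel i T" unfolding e_val_bases using sub fb by (intro sum_mono2) auto
  finally show ?thesis using L R by linarith
qed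

section \<open>Staircase triangulations\<close>

text \<open>The part of the convex hull of the two rows to the left of the segment from \<open>r 0\<close> in the lower
row to \<open>r 1\<close> in the upper row.\<close>

definition zone :: "(nat \<Rightarrow> nat set) \<Rightarrow> (nat \<Rightarrow> nat) \<Rightarrow> (real \<times> real) set" where
  "zone A r = {(x, y). 0 \<le> y \<and> y \<le> 1 \<and>
     (1 - y) * real (Min (A 0)) + y * real (Min (A 1)) \<le> x \<and> x \<le> (1 - y) * real (r 0) + y * real (r 1)}"

text \<open>Triangulations are built from left to right. The state \<open>r\<close> records the points of the two rows that
span the current right side; a step advances in row \<open>j\<close> and adds a triangle with its apex in the
other row.\<close>

inductive staircase :: "(nat \<Rightarrow> nat set) \<Rightarrow> (real \<times> real) set set \<Rightarrow> (nat \<Rightarrow> nat) \<Rightarrow> bool" for A where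
  start: "staircase A {} (\<lambda>i. Min (A i))"
| step: "staircase A T r \<Longrightarrow> j < 2 \<Longrightarrow> r j < c \<Longrightarrow> c \<in> A j \<Longrightarrow>
     staircase A (insert (tri (1 - j) (r (1 - j)) (r j) c) T) (r(j := c))"

lemma tri_1_eq:
  assumes "b < b'"
  shows "tri (Suc 0) a b b' = {(x, y). 0 \<le> y \<and> y \<le> 1 \<and> (1 - y) * real b + y * real a \<le> x \<and> x \<le> (1 - y) * real b' + y * real a}"
  by (subst tri_eq) (auto simp: assms algebra_simps)

lemma tri_0_eq:
  assumes "b < b'"
  shows "tri 0 a b b' = {(x, y). 0 \<le> y \<and> y \<le> 1 \<and> (1 - y) * real a + y * real b \<le> x \<and> x \<le> (1 - y) * real a + y * real b'}"
proof (rule set_eqI, clarify)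
  fix x y :: real
  have "(\<exists>s. 0 \<le> s \<and> s \<le> 1 \<and> y = (1 - s) \<and> s * real a + (1 - s) * real b \<le> x \<and> x \<le> s * real a + (1 - s) * real b') \<longleftrightarrow>
    0 \<le> 1 - y \<and> 1 - y \<le> 1 \<and> (1 - y) * real a + (1 - (1 - y)) * real b \<le> x \<and> x \<le> (1 - y) * real a + (1 - (1 - y)) * real b'"
    (is "?l \<longleftrightarrow> ?r")
  proof
    assume ?l
    then obtain s where "0 \<le> s \<and> s \<le> 1 \<and> y = (1 - s) \<and> s * real a + (1 - s) * real b \<le> x \<and> x \<le> s * real a + (1 - s) * real b'" by auto
    moreover from this have "s = 1 - y" by simp
    ultimately show ?r by simp
  next
    assume ?r then show ?l by (intro exI[of _ "1 - y"]) simp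
  qed
  then show "(x, y) \<in> tri 0 a b b' \<longleftrightarrow> (x, y) \<in> {(x, y). 0 \<le> y \<and> y \<le> 1 \<and> (1 - y) * real a + y * real b \<le> x \<and> x \<le> (1 - y) * real a + y * real b'}"
    by (subst tri_eq) (auto simp: assms)
qed

lemma row_weight_mono:
  fixes y :: real
  assumes "0 \<le> y" "y \<le> 1" "(a::nat) \<le> b"
  shows "(1 - y) * real a \<le> (1 - y) * real b" "y * real a \<le> y * real b"
  using assms by (auto intro: mult_left_mono)

lemma zone_step:
  assumes "j < 2" "r j < c" "Min (A 0) \<le> r 0" "Min (A 1) \<le> r 1"
  shows "zone A (r(j := c)) = zone A r \<union> tri (1 - j) (r (1 - j)) (r j) c"
proof (rule set_eqI, clarify)
  fix x y :: real
  show "(x, y) \<in> zone A (r(j := c)) \<longleftrightarrow> (x, y) \<in> zone A r \<union> tri (1 - j) (r (1 - j)) (r j) c"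
  proof (cases "0 \<le> y \<and> y \<le> 1")
    case True
    then have y: "0 \<le> y" "y \<le> 1" by auto
    note m = row_weight_mono[OF y assms(3)] row_weight_mono[OF y assms(4)] row_weight_mono[OF y less_imp_le[OF assms(2)]]
    from assms(1) show ?thesis
    proof (rule less_two_cases)
      assume "j = 0"
      then show ?thesis using m y assms(2) unfolding zone_def by (simp add: tri_1_eq) linarith
    next
      assume "j = 1"
      then show ?thesis using m y assms(2) unfolding zone_def by (simp add: tri_0_eq) linarith
    qed
  next
    case False
    from assms(1) show ?thesis
      by (rule less_two_cases) (use False assms(2) in \<open>auto simp: zone_def tri_1_eq tri_0_eq\<close>)
  qed
qed

lemma start_zone_subset:
  assumes "j < 2" "Min (A j) < c"
  shows "zone A (\<lambda>i. Min (A i)) \<subseteq> tri (1 - j) (Min (A (1 - j))) (Min (A j)) c"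
proof clarify
  fix x y :: real
  assume z: "(x, y) \<in> zone A (\<lambda>i. Min (A i))"
  then have y: "0 \<le> y" "y \<le> 1" unfolding zone_def by auto
  note m = row_weight_mono[OF y less_imp_le[OF assms(2)]]
  from assms(1) show "(x, y) \<in> tri (1 - j) (Min (A (1 - j))) (Min (A j)) c"
  proof (rule less_two_cases)
    assume "j = 0"
    then show ?thesis using m z assms(2) unfolding zone_def by (simp add: tri_1_eq)
  next
    assume "j = 1"
    then show ?thesis using m z assms(2) unfolding zone_def by (simp add: tri_0_eq)
  qed
qed

lemma staircase_ge:
  assumes "staircase A T r" "\<And>i. i < 2 \<Longrightarrow> finite (A i) \<and> A i \<noteq> {}" "i < 2"
  shows "r i \<in> A i" "Min (A i) \<le> r i"
proof -
  from assms(1) have "\<forall>i<2. r i \<in> A i"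
  proof induction
    case start
    then show ?case using assms(2) by simp
  next
    case (step T r j c)
    then show ?case by simp
  qed
  then show "r i \<in> A i" "Min (A i) \<le> r i" using assms by auto
qed

lemma staircase_triangles:
  assumes "staircase A T r" "\<And>i. i < 2 \<Longrightarrow> finite (A i) \<and> A i \<noteq> {}" "\<Delta> \<in> T"
  obtains i a b b' where "i < 2" "a \<in> A i" "b \<in> A (1 - i)" "b' \<in> A (1 - i)" "b < b'" "\<Delta> = tri i a b b'"
proof -
  from assms(1) have "\<forall>\<Delta>\<in>T. \<exists>i a b b'. i < 2 \<and> a \<in> A i \<and> b \<in> A (1 - i) \<and> b' \<in> A (1 - i) \<and> b < b' \<and> \<Delta> = tri i a b b'"
  proof induction
    case (step T r j c)
    have "r j \<in> A j" "r (1 - j) \<in> A (1 - j)" "1 - (1 - j) = j" "1 - j < 2"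
      using staircase_ge(1)[OF step(1) assms(2)] step(2) by simp_all
    then have "\<exists>i a b b'. i < 2 \<and> a \<in> A i \<and> b \<in> A (1 - i) \<and> b' \<in> A (1 - i) \<and> b < b' \<and>
      tri (1 - j) (r (1 - j)) (r j) c = tri i a b b'"
      using step(3,4) by (intro exI[of _ "1 - j"] exI[of _ "r (1 - j)"] exI[of _ "r j"] exI[of _ c]) simp
    with step.IH show ?case by (simp only: ball_simps(7) simp_thms)
  qed simp
  from bspec[OF this assms(3)] show thesis by (elim exE conjE) (rule that)
qed

lemma staircase_Union:
  assumes "staircase A T r" "\<And>i. i < 2 \<Longrightarrow> finite (A i) \<and> A i \<noteq> {}"
  shows "T = {} \<and> r = (\<lambda>i. Min (A i)) \<or> \<Union>T = zone A r"
  using assms(1)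
proof induction
  case (step T r j c)
  note ge = staircase_ge(2)[OF step(1) assms(2)]
  have Z: "zone A (r(j := c)) = zone A r \<union> tri (1 - j) (r (1 - j)) (r j) c"
    using step ge by (intro zone_step) auto
  show ?case using step.IH
  proof
    assume r: "T = {} \<and> r = (\<lambda>i. Min (A i))"
    then have "zone A r \<subseteq> tri (1 - j) (r (1 - j)) (r j) c"
      using start_zone_subset[OF step(2), of A c] step(3) by simp
    then show ?case using r unfolding Z by auto
  next
    assume "\<Union>T = zone A r"
    then show ?case unfolding Z Union_insert by blast
  qed
qed simp

lemma hyperplane_row_points:
  assumes "S \<subseteq> {v. \<exists>i a. i < 2 \<and> v = (real a, real i)}" "S \<subseteq> {v. (1, p - q) \<bullet> v = p}"
  shows "S \<subseteq> {(p, 0), (q, 1)}"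
proof
  fix v assume v: "v \<in> S"
  then obtain i :: nat and a where i: "i < 2" "v = (real a, real i)" using assms(1) by auto
  have "(1, p - q) \<bullet> v = p" using assms(2) v by auto
  then have "real a + (p - q) * real i = p" using i by simp
  then show "v \<in> {(p, 0), (q, 1)}" using i(1) unfolding i(2) by (elim less_two_cases) auto
qed

lemma subset_doubleton_face_of_segment:
  fixes P Q :: "'a::euclidean_space"
  assumes "S \<subseteq> {P, Q}"
  shows "convex hull S face_of closed_segment P Q"
proof -
  have "S = {} \<or> S = {P} \<or> S = {Q} \<or> S = {P, Q}" using assms by auto
  then show ?thesis
    by (auto simp: face_of_singleton extreme_point_of_segment segment_convex_hull face_of_refl)
      (simp_all add: segment_convex_hull[symmetric] extreme_point_of_segment)
qed

text \<open>The new triangle meets an old one only on the line through the current right side. This line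
supports both, and the only possible vertices on it are the two ends of the right side.\<close>

lemma triangle_next_face:
  assumes r: "\<Delta> \<subseteq> zone A r" and D: "\<Delta> = tri i a b b'" "i < 2" and j: "j < 2" "r j < c"
  shows "\<Delta> \<inter> tri (1 - j) (r (1 - j)) (r j) c face_of \<Delta>"
    "\<Delta> \<inter> tri (1 - j) (r (1 - j)) (r j) c face_of tri (1 - j) (r (1 - j)) (r j) c"
proof -
  let ?N = "tri (1 - j) (r (1 - j)) (r j) c"
  let ?a = "(1, real (r 0) - real (r 1))"
  let ?H = "{v. ?a \<bullet> v = real (r 0)}"
  let ?e = "closed_segment (real (r 0), 0) (real (r 1), 1)"
  have e: "?e = {v. ?a \<bullet> v = real (r 0) \<and> 0 \<le> snd v \<and> snd v \<le> 1}"
  proof (rule set_eqI, clarify)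
    fix x y :: real
    have "(x, y) \<in> ?e \<longleftrightarrow> (\<exists>u. 0 \<le> u \<and> u \<le> 1 \<and> x = (1 - u) * real (r 0) + u * real (r 1) \<and> y = u)"
      unfolding closed_segment_def by auto
    also have "\<dots> \<longleftrightarrow> 0 \<le> y \<and> y \<le> 1 \<and> x = (1 - y) * real (r 0) + y * real (r 1)" by auto
    finally show "(x, y) \<in> ?e \<longleftrightarrow> (x, y) \<in> {v. ?a \<bullet> v = real (r 0) \<and> 0 \<le> snd v \<and> snd v \<le> 1}"
      by (auto simp: algebra_simps)
  qed
  have N: "?N \<subseteq> {v. ?a \<bullet> v \<ge> real (r 0)} \<and> ?N \<inter> ?H = ?e"
  proof (intro conjI subsetI set_eqI)
    fix v assume v: "v \<in> ?N"
    obtain x y where xy: "v = (x, y)" by (cases v)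
    from j(1) show "v \<in> {v. ?a \<bullet> v \<ge> real (r 0)}"
      by (rule less_two_cases) (use v j(2) xy in \<open>auto simp: tri_0_eq tri_1_eq algebra_simps\<close>)
  next
    fix v :: "real \<times> real"
    obtain x y where xy: "v = (x, y)" by (cases v)
    show "v \<in> ?N \<inter> ?H \<longleftrightarrow> v \<in> ?e"
    proof (cases "0 \<le> y \<and> y \<le> 1")
      case True
      then have y: "0 \<le> y" "y \<le> 1" by auto
      note m = row_weight_mono[OF y less_imp_le[OF j(2)]]
      from j(1) show ?thesis unfolding e xy
        by (rule less_two_cases) (use j(2) y m in \<open>auto simp: tri_0_eq tri_1_eq algebra_simps\<close>)
    next
      case False
      from j(1) show ?thesis unfolding e xy
        by (rule less_two_cases) (use j(2) False in \<open>auto simp: tri_0_eq tri_1_eq\<close>)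
    qed
  qed
  then have N: "?N \<subseteq> {v. ?a \<bullet> v \<ge> real (r 0)}" "?N \<inter> ?H = ?e" by blast+
  have Z: "\<Delta> \<subseteq> {v. ?a \<bullet> v \<le> real (r 0)}" "\<Delta> \<inter> ?H \<subseteq> ?e"
    using r unfolding e by (auto simp: zone_def algebra_simps dest!: subsetD)
  have I: "\<Delta> \<inter> ?N = \<Delta> \<inter> ?H" using N Z by force
  have cv: "convex \<Delta>" "convex ?N" unfolding D tri_def by auto
  show f: "\<Delta> \<inter> ?N face_of \<Delta>"
    unfolding I using Z cv by (intro face_of_Int_supporting_hyperplane_le) auto
  have fe: "?e face_of ?N"
    unfolding N(2)[symmetric] using N cv by (intro face_of_Int_supporting_hyperplane_ge) auto
  have "\<Delta> = convex hull {(real a, real i), (real b, real (1 - i)), (real b', real (1 - i))}"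
    using D(1) unfolding tri_def .
  then have "\<Delta> \<inter> ?H face_of convex hull {(real a, real i), (real b, real (1 - i)), (real b', real (1 - i))}"
    using f unfolding I by metis
  then obtain S where S: "S \<subseteq> {(real a, real i), (real b, real (1 - i)), (real b', real (1 - i))}"
    "\<Delta> \<inter> ?H = convex hull S"
    using face_of_convex_hull_subset by (metis finite.emptyI finite.insertI finite_imp_compact)
  have "S \<subseteq> {(real (r 0), 0), (real (r 1), 1)}"
  proof (rule hyperplane_row_points)
    show "S \<subseteq> {v. \<exists>i a. i < 2 \<and> v = (real a, real i)}"
    proof
      fix v assume "v \<in> S"
      moreover have "1 - i < 2" by simp
      ultimately show "v \<in> {v. \<exists>i a. i < 2 \<and> v = (real a, real i)}" using S(1) D(2) by blast
    qed
    show "S \<subseteq> ?H" using S(2) hull_subset[of S convex] by auto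
  qed
  then have "\<Delta> \<inter> ?H face_of ?e" unfolding S(2) by (rule subset_doubleton_face_of_segment)
  then show "\<Delta> \<inter> ?N face_of ?N" unfolding I using fe face_of_trans by blast
qed

lemma staircase_triangulation:
  assumes "staircase A T r" "\<And>i. i < 2 \<Longrightarrow> finite (A i) \<and> A i \<noteq> {}"
  shows "triangulation T"
  using assms(1)
proof induction
  case (step T r j c)
  let ?N = "tri (1 - j) (r (1 - j)) (r j) c"
  have N: "2 simplex ?N" using step by (intro two_simplex_tri) auto
  have *: "\<Delta> \<inter> ?N face_of \<Delta>" "\<Delta> \<inter> ?N face_of ?N" if "\<Delta> \<in> T" for \<Delta>
  proof -
    have "\<Delta> \<subseteq> zone A r" using staircase_Union[OF step(1) assms(2)] that by auto
    then show "\<Delta> \<inter> ?N face_of \<Delta>" "\<Delta> \<inter> ?N face_of ?N"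
      using staircase_triangles[OF step(1) assms(2) that] triangle_next_face step(2,3) by metis+
  qed
  have "convex ?N" unfolding tri_def by simp
  then show ?case using step.IH N *
    unfolding triangulation_def by (auto simp: Int_commute face_of_refl)
qed (simp add: triangulation_def)

lemma convex_zone: "convex (zone A r)"
proof -
  have "zone A r = {v. (0, 1) \<bullet> v \<ge> 0} \<inter> {v. (0, 1) \<bullet> v \<le> 1} \<inter>
    {v. (1, real (Min (A 0)) - real (Min (A 1))) \<bullet> v \<ge> real (Min (A 0))} \<inter>
    {v. (1, real (r 0) - real (r 1)) \<bullet> v \<le> real (r 0)}"
    unfolding zone_def by (auto simp: inner_prod_def algebra_simps)
  then show ?thesis by (auto intro!: convex_Int convex_halfspace_le convex_halfspace_ge)
qed

lemma staircase_in_triangulations: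
  assumes "staircase A T r" and fin: "\<And>i. i < 2 \<Longrightarrow> finite (A i) \<and> A i \<noteq> {}"
    and r: "\<And>i. i < 2 \<Longrightarrow> r i = Max (A i)" and ne: "Min (A 0) \<noteq> Max (A 0)"
  shows "T \<in> triangulations A"
proof -
  have row: "tri i a b b' \<subseteq> convex hull two_rows A" "{v. v extreme_point_of tri i a b b'} \<subseteq> two_rows A"
    "2 simplex tri i a b b'"
    if "i < 2" "a \<in> A i" "b \<in> A (1 - i)" "b' \<in> A (1 - i)" "b < b'" for i a b b'
  proof -
    have *: "{(real a, real i), (real b, real (1 - i)), (real b', real (1 - i))} \<subseteq> two_rows A"
      using that two_rowsI[of i a A] two_rowsI[of "1 - i" _ A] by simp
    show "tri i a b b' \<subseteq> convex hull two_rows A" unfolding tri_def by (rule hull_mono[OF *])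
    show "{v. v extreme_point_of tri i a b b'} \<subseteq> two_rows A"
      unfolding extreme_points_tri[OF that(1,5)] by (rule *)
    show "2 simplex tri i a b b'" by (rule two_simplex_tri[OF that(1,5)])
  qed
  have U: "\<Union>T = zone A r" using staircase_Union[OF assms(1) fin] r[of 0] ne by auto
  have "\<Union>T \<subseteq> convex hull two_rows A"
    using staircase_triangles[OF assms(1) fin] row(1) by (metis Union_least)
  moreover have "convex hull two_rows A \<subseteq> zone A r"
    using r[of 0] r[of 1] fin[of 0] fin[of 1]
    by (intro hull_minimal convex_zone) (auto simp: two_rows_def zone_def)
  moreover have "2 simplex \<Delta> \<and> {v. v extreme_point_of \<Delta>} \<subseteq> two_rows A" if "\<Delta> \<in> T" for \<Delta>
    using staircase_triangles[OF assms(1) fin that] row(2,3) by metis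
  ultimately show ?thesis
    unfolding triangulations_def using staircase_triangulation[OF assms(1) fin] U by auto
qed

section \<open>Extremal e-values\<close>

definition reaches :: "(nat \<Rightarrow> nat set) \<Rightarrow> (nat \<Rightarrow> nat set) \<Rightarrow> (nat \<Rightarrow> nat) \<Rightarrow> (nat \<Rightarrow> nat) \<Rightarrow> bool" where
  "reaches A Sel r v \<longleftrightarrow> (\<exists>T. staircase A T r \<and> (\<forall>i<2. e_val A Sel i T = v i))"

lemma staircase_new_triangle:
  assumes "staircase A T r" "\<And>i. i < 2 \<Longrightarrow> finite (A i) \<and> A i \<noteq> {}" "j < 2" "r j < c"
  shows "tri (1 - j) (r (1 - j)) (r j) c \<notin> T"
proof
  let ?N = "tri (1 - j) (r (1 - j)) (r j) c"
  assume N: "?N \<in> T"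
  then have "?N \<subseteq> zone A r" using staircase_Union[OF assms(1,2)] by auto
  moreover have "(real c, real j) \<in> ?N" unfolding tri_def using assms(3) by (intro hull_inc) auto
  ultimately have "(real c, real j) \<in> zone A r" by blast
  then show False using assms(3,4) unfolding zone_def by (elim less_two_cases) auto
qed

lemma e_val_insert:
  assumes st: "staircase A T r" and fin: "\<And>i. i < 2 \<Longrightarrow> finite (A i) \<and> A i \<noteq> {}" and j: "j < 2" "r j < c" "c \<in> A j"
    and Sel: "\<And>i. i < 2 \<Longrightarrow> Sel i \<subseteq> A i" and i: "i < 2"
  shows "e_val A Sel i (insert (tri (1 - j) (r (1 - j)) (r j) c) T) =
    e_val A Sel i T + (if i = 1 - j \<and> r i \<in> Sel i then c - r j else 0)"
proof -
  let ?N = "tri (1 - j) (r (1 - j)) (r j) c"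
  have r: "r j \<in> A j" "r (1 - j) \<in> A (1 - j)" using staircase_ge(1)[OF st fin] j by auto
  have jj: "1 - (1 - j) = j" "1 - j < 2" using j by auto
  have fb: "finite (bases A (Sel i) i T)"
    by (rule finite_subset[of _ "A i \<times> A (1 - i) \<times> A (1 - i)"])
      (use Sel[OF i] fin i in \<open>auto simp: bases_def\<close>)
  have new: "(r (1 - j), r j, c) \<notin> bases A (Sel (1 - j)) (1 - j) T"
    using staircase_new_triangle[OF st fin j(1,2)] unfolding bases_def by auto
  have B: "bases A (Sel i) i (insert ?N T) =
    bases A (Sel i) i T \<union> (if i = 1 - j \<and> r i \<in> Sel i then {(r (1 - j), r j, c)} else {})"
  proof (rule set_eqI, clarify)
    fix a b b'
    show "(a, b, b') \<in> bases A (Sel i) i (insert ?N T) \<longleftrightarrow>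
      (a, b, b') \<in> bases A (Sel i) i T \<union> (if i = 1 - j \<and> r i \<in> Sel i then {(r (1 - j), r j, c)} else {})"
    proof (cases "i = 1 - j \<and> a = r (1 - j) \<and> b = r j \<and> b' = c")
      case True
      then have "b \<in> A (1 - i)" "b' \<in> A (1 - i)" "b < b'" using r j jj by simp_all
      then show ?thesis using True unfolding bases_def by auto
    next
      case False
      have "b < b' \<Longrightarrow> tri i a b b' \<noteq> ?N"
        using tri_inject[OF i _ jj(2) j(2), of b b' a "r (1 - j)"] False by blast
      then show ?thesis using False unfolding bases_def by auto
    qed
  qed
  show ?thesis unfolding e_val_bases B using new fb by auto
qed

lemma reaches_start: "reaches A Sel (\<lambda>i. Min (A i)) (\<lambda>_. 0)"
proof -
  have "bases A S i {} = {}" for S i unfolding bases_def by auto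
  then show ?thesis unfolding reaches_def by (intro exI[of _ "{}"]) (simp add: staircase.start e_val_bases)
qed

text \<open>Steps of length zero are included so that one path covers all degenerate positions of the points.\<close>

lemma reaches_step:
  assumes "reaches A Sel r v" and fin: "\<And>i. i < 2 \<Longrightarrow> finite (A i) \<and> A i \<noteq> {}" and j: "j < 2" "r j \<le> c" "c \<in> A j"
    and Sel: "\<And>i. i < 2 \<Longrightarrow> Sel i \<subseteq> A i"
  shows "reaches A Sel (r(j := c)) (v(1 - j := v (1 - j) + (if r (1 - j) \<in> Sel (1 - j) then c - r j else 0)))"
proof (cases "r j = c")
  case True
  then have "r(j := c) = r" by auto
  with assms(1) True show ?thesis by simp
next
  case False
  then have lt: "r j < c" using j by simp
  obtain T where T: "staircase A T r" "\<forall>i<2. e_val A Sel i T = v i" using assms(1) unfolding reaches_def by auto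
  show ?thesis unfolding reaches_def
  proof (intro exI conjI allI impI)
    show "staircase A (insert (tri (1 - j) (r (1 - j)) (r j) c) T) (r(j := c))"
      by (rule staircase.step[OF T(1) j(1) lt j(3)])
    fix i :: nat assume "i < 2"
    then show "e_val A Sel i (insert (tri (1 - j) (r (1 - j)) (r j) c) T) =
       (v(1 - j := v (1 - j) + (if r (1 - j) \<in> Sel (1 - j) then c - r j else 0))) i"
      using e_val_insert[where Sel = Sel, OF T(1) fin j(1) lt j(3) Sel \<open>i < 2\<close>] T(2) by auto
  qed
qed

text \<open>The staircase advances in the row \<open>1 - i\<close> to \<open>p\<close>, in row \<open>i\<close> to \<open>m\<close>, in the row \<open>1 - i\<close> to \<open>q\<close>, and
then in row \<open>i\<close> and in the row \<open>1 - i\<close> to the end. All extremal \<open>e\<close>-values are attained by such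
triangulations.\<close>

lemma zigzag_triangulation:
  assumes fin: "\<And>i. i < 2 \<Longrightarrow> finite (A i) \<and> A i \<noteq> {}" and Sel: "\<And>i. i < 2 \<Longrightarrow> Sel i \<subseteq> A i"
    and ne: "Min (A 0) \<noteq> Max (A 0)" and i: "i < 2" and pq: "p \<in> A (1 - i)" "q \<in> A (1 - i)" "p \<le> q" and m: "m \<in> A i"
  obtains T where "T \<in> triangulations A"
    "e_val A Sel i T = (if Min (A i) \<in> Sel i then p - Min (A (1 - i)) else 0) + (if m \<in> Sel i then q - p else 0)
       + (if Max (A i) \<in> Sel i then Max (A (1 - i)) - q else 0)"
    "e_val A Sel (1 - i) T = (if p \<in> Sel (1 - i) then m - Min (A i) else 0) + (if q \<in> Sel (1 - i) then Max (A i) - m else 0)"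
proof -
  define k where "k = 1 - i"
  have k: "k < 2" "1 - k = i" "1 - i = k" "i \<noteq> k" "k \<noteq> i" using i unfolding k_def by (auto elim: less_two_cases)
  have f: "finite (A i)" "finite (A k)" "A i \<noteq> {}" "A k \<noteq> {}" using fin i k by auto
  have st: "reaches A Sel (r(j := c)) (v(1 - j := v (1 - j) + (if r (1 - j) \<in> Sel (1 - j) then c - r j else 0)))"
    if "reaches A Sel r v" "j < 2" "r j \<le> c" "c \<in> A j" for r v j c
    by (rule reaches_step[where A = A and Sel = Sel]) (use that fin Sel in auto)
  note r0 = reaches_start[of A Sel]
  have "Min (A k) \<le> p" using pq f k by auto
  note r1 = st[OF r0 k(1) this pq(1)[unfolded k]]
  have "Min (A i) \<le> m" using m f by auto
  then have "((\<lambda>i. Min (A i))(k := p)) i \<le> m" using k by simp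
  note r2 = st[OF r1 i this m]
  have "((\<lambda>i. Min (A i))(k := p, i := m)) k \<le> q" using k pq by simp
  note r3 = st[OF r2 k(1) this pq(2)[unfolded k]]
  have "((\<lambda>i. Min (A i))(k := p, i := m, k := q)) i \<le> Max (A i)" using k m f by simp
  note r4 = st[OF r3 i this Max_in[OF f(1,3)]]
  have "((\<lambda>i. Min (A i))(k := p, i := m, k := q, i := Max (A i))) k \<le> Max (A k)" using k pq f by simp
  note r5 = st[OF r4 k(1) this Max_in[OF f(2,4)]]
  note r5 = r5[unfolded k(2,3)]
  from r5 obtain T where T: "staircase A T ((\<lambda>i. Min (A i))(k := p, i := m, k := q, i := Max (A i), k := Max (A k)))"
    "e_val A Sel i T = (if Min (A i) \<in> Sel i then p - Min (A k) else 0) + (if m \<in> Sel i then q - p else 0)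
       + (if Max (A i) \<in> Sel i then Max (A k) - q else 0)"
    "e_val A Sel k T = (if p \<in> Sel k then m - Min (A i) else 0) + (if q \<in> Sel k then Max (A i) - m else 0)"
    unfolding reaches_def using i k(1,4,5) by auto
  have "T \<in> triangulations A"
    by (rule staircase_in_triangulations[OF T(1) fin _ ne]) (use i k in \<open>auto simp: less_2_cases_iff\<close>)
  with T show thesis using that unfolding k by blast
qed

lemma finite_triangulations:
  assumes "\<And>i. i < 2 \<Longrightarrow> finite (A i)"
  shows "finite (triangulations A)"
proof -
  have "finite (two_rows A)"
    using assms[of 0] assms[of 1] unfolding two_rows_def by auto
  moreover have "triangulations A \<subseteq> Pow ((\<lambda>V. convex hull V) ` Pow (two_rows A))"
  proof (intro subsetI PowI)
    fix T \<Delta> assume T: "T \<in> triangulations A" "\<Delta> \<in> T"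
    obtain i a b b' where t: "i < 2" "a \<in> A i" "b \<in> A (1 - i)" "b' \<in> A (1 - i)" "b < b'" "\<Delta> = tri i a b b'"
      using triangulation_triangle[OF T] by metis
    then show "\<Delta> \<in> (\<lambda>V. convex hull V) ` Pow (two_rows A)"
      unfolding tri_def using two_rowsI[of i a A] two_rowsI[of "1 - i" _ A] by (intro image_eqI PowI) auto
  qed
  ultimately show ?thesis by (meson finite_Pow_iff finite_imageI finite_subset)
qed

context
  fixes A Sel :: "nat \<Rightarrow> nat set"
  assumes fin: "\<And>i. i < 2 \<Longrightarrow> finite (A i)"
    and Sel: "\<And>i. i < 2 \<Longrightarrow> Sel i \<subseteq> A i" "\<And>i. i < 2 \<Longrightarrow> Sel i \<noteq> {}" "\<And>i. i < 2 \<Longrightarrow> A i - Sel i \<noteq> {}"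
begin

lemma rows_nontrivial:
  assumes "i < 2"
  shows "finite (A i) \<and> A i \<noteq> {}" "Min (A i) < Max (A i)"
proof -
  show *: "finite (A i) \<and> A i \<noteq> {}" using fin Sel assms by fastforce
  obtain x y where "x \<in> A i" "y \<in> A i" "x \<noteq> y" using Sel[OF assms] by blast
  then have "Min (A i) \<noteq> Max (A i)" using * by (metis Max_ge Min_le order_antisym_conv)
  moreover have "Min (A i) \<le> Max (A i)" using * by simp
  ultimately show "Min (A i) < Max (A i)" by simp
qed

lemma Min_Non: "i < 2 \<Longrightarrow> Min (A i) \<notin> Sel i \<Longrightarrow> Min (A i - Sel i) = Min (A i)"
  using rows_nontrivial(1)[of i] by (intro Min_eqI) auto

lemma Max_Non: "i < 2 \<Longrightarrow> Max (A i) \<notin> Sel i \<Longrightarrow> Max (A i - Sel i) = Max (A i)"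
  using rows_nontrivial(1)[of i] by (intro Max_eqI) auto

text \<open>Choosing for \<open>p\<close> and \<open>q\<close> the extreme nonselected points gives the row \<open>1 - i\<close> no selected apex.\<close>

lemma triangulation_zero_other:
  assumes i: "i < 2"
  obtains T where "T \<in> triangulations A" "e_val A Sel (1 - i) T = 0"
    "e_val A Sel i T =
     (if Max (A i) \<in> Sel i then Max (A (1 - i)) else Max (A (1 - i) - Sel (1 - i))) -
     (if Min (A i) \<in> Sel i then Min (A (1 - i)) else Min (A (1 - i) - Sel (1 - i)))"
proof -
  have k: "1 - i < 2" by simp
  let ?N = "A (1 - i) - Sel (1 - i)"
  have N: "finite ?N" "?N \<noteq> {}" using fin[OF k] Sel[OF k] by auto
  obtain s where s: "s \<in> Sel i" using Sel(2)[OF i] by auto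
  have pq: "Min ?N \<in> ?N" "Max ?N \<in> ?N" "Min ?N \<le> Max ?N" using N by (auto simp del: Diff_iff intro: Min_in Max_in)
  then have nS: "Min ?N \<notin> Sel (1 - i)" "Max ?N \<notin> Sel (1 - i)" by blast+
  have mM: "Min (A (1 - i)) \<le> Min ?N" "Max ?N \<le> Max (A (1 - i))" using pq(1,2) fin[OF k] by (meson DiffD1 Min_le Max_ge)+
  have ne: "Min (A 0) \<noteq> Max (A 0)" using rows_nontrivial(2)[of 0] by simp
  obtain T where T: "T \<in> triangulations A"
    "e_val A Sel i T = (if Min (A i) \<in> Sel i then Min ?N - Min (A (1 - i)) else 0) + (if s \<in> Sel i then Max ?N - Min ?N else 0)
       + (if Max (A i) \<in> Sel i then Max (A (1 - i)) - Max ?N else 0)"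
    "e_val A Sel (1 - i) T = (if Min ?N \<in> Sel (1 - i) then s - Min (A i) else 0) + (if Max ?N \<in> Sel (1 - i) then Max (A i) - s else 0)"
    using zigzag_triangulation[where Sel = Sel, OF rows_nontrivial(1) Sel(1) ne i, of "Min ?N" "Max ?N" s] pq s Sel(1)[OF i] by blast
  show thesis
  proof (rule that[OF T(1)])
    show "e_val A Sel (1 - i) T = 0" using T(3) nS by simp
    show "e_val A Sel i T = (if Max (A i) \<in> Sel i then Max (A (1 - i)) else Max ?N) -
     (if Min (A i) \<in> Sel i then Min (A (1 - i)) else Min ?N)"
      unfolding T(2) using pq(3) mM s by simp
  qed
qed

lemma e_min_eq_0: "i < 2 \<Longrightarrow> e_min A Sel i = 0"
proof -
  assume i: "i < 2"
  then have k: "1 - i < 2" "1 - (1 - i) = i" by auto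
  obtain T where "T \<in> triangulations A" "e_val A Sel (1 - (1 - i)) T = 0"
    using triangulation_zero_other[OF k(1)] by metis
  then show ?thesis unfolding e_min_def k using finite_triangulations[of A] fin
    by (intro Min_eqI) (auto intro: rev_image_eqI)
qed

lemma e_max_at_min_eq:
  assumes i: "i < 2"
  shows "e_max_at_min A Sel i =
     (if Max (A i) \<in> Sel i then Max (A (1 - i)) else Max (A (1 - i) - Sel (1 - i))) -
     (if Min (A i) \<in> Sel i then Min (A (1 - i)) else Min (A (1 - i) - Sel (1 - i)))"
proof -
  obtain T where T: "T \<in> triangulations A" "e_val A Sel (1 - i) T = 0"
    "e_val A Sel i T =
     (if Max (A i) \<in> Sel i then Max (A (1 - i)) else Max (A (1 - i) - Sel (1 - i))) -
     (if Min (A i) \<in> Sel i then Min (A (1 - i)) else Min (A (1 - i) - Sel (1 - i)))"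
    using triangulation_zero_other[OF i] by metis
  have e: "e_min A Sel (1 - i) = 0" by (rule e_min_eq_0) simp
  show ?thesis unfolding e_max_at_min_def e
  proof (rule Max_eqI)
    show "finite (e_val A Sel i ` {T \<in> triangulations A. e_val A Sel (1 - i) T = 0})"
      using finite_triangulations[of A] fin by auto
    fix y assume "y \<in> e_val A Sel i ` {T \<in> triangulations A. e_val A Sel (1 - i) T = 0}"
    then obtain T' where "T' \<in> triangulations A" "e_val A Sel (1 - i) T' = 0" "y = e_val A Sel i T'" by auto
    then show "y \<le> (if Max (A i) \<in> Sel i then Max (A (1 - i)) else Max (A (1 - i) - Sel (1 - i))) -
     (if Min (A i) \<in> Sel i then Min (A (1 - i)) else Min (A (1 - i) - Sel (1 - i)))"
      using e_val_le_of_other_zero[where Sel = Sel, OF fin _ i Sel(1,2), of T'] i by simp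
  next
    show "(if Max (A i) \<in> Sel i then Max (A (1 - i)) else Max (A (1 - i) - Sel (1 - i))) -
     (if Min (A i) \<in> Sel i then Min (A (1 - i)) else Min (A (1 - i) - Sel (1 - i)))
      \<in> e_val A Sel i ` {T \<in> triangulations A. e_val A Sel (1 - i) T = 0}"
      unfolding T(3)[symmetric] using T(1,2) by blast
  qed
qed

text \<open>Choosing for \<open>p\<close> and \<open>q\<close> the extreme selected points makes every apex in the row \<open>1 - i\<close> selected; \<open>m\<close> is nonselected, so that the middle triangle does not count.\<close>

lemma triangulation_full_other:
  assumes i: "i < 2"
  obtains T where "T \<in> triangulations A" "e_val A Sel (1 - i) T = Max (A i) - Min (A i)"
    "e_val A Sel i T = (if Min (A i) \<in> Sel i then Min (Sel (1 - i)) - Min (A (1 - i)) else 0) +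
     (if Max (A i) \<in> Sel i then Max (A (1 - i)) - Max (Sel (1 - i)) else 0)"
proof -
  have k: "1 - i < 2" by simp
  let ?N = "Sel (1 - i)"
  have N: "finite ?N" "?N \<noteq> {}" using fin[OF k] Sel[OF k] finite_subset by auto
  obtain s where s: "s \<in> A i" "s \<notin> Sel i" using Sel(3)[OF i] by auto
  have pq: "Min ?N \<in> ?N" "Max ?N \<in> ?N" "Min ?N \<le> Max ?N" using N by (auto intro: Min_in Max_in)
  have sm: "Min (A i) \<le> s" "s \<le> Max (A i)" using s fin[OF i] by auto
  have ne: "Min (A 0) \<noteq> Max (A 0)" using rows_nontrivial(2)[of 0] by simp
  obtain T where T: "T \<in> triangulations A"
    "e_val A Sel i T = (if Min (A i) \<in> Sel i then Min ?N - Min (A (1 - i)) else 0) + (if s \<in> Sel i then Max ?N - Min ?N else 0)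
       + (if Max (A i) \<in> Sel i then Max (A (1 - i)) - Max ?N else 0)"
    "e_val A Sel (1 - i) T = (if Min ?N \<in> Sel (1 - i) then s - Min (A i) else 0) + (if Max ?N \<in> Sel (1 - i) then Max (A i) - s else 0)"
    using zigzag_triangulation[where Sel = Sel, OF rows_nontrivial(1) Sel(1) ne i, of "Min ?N" "Max ?N" s] pq s Sel(1)[OF k] by blast
  show thesis
  proof (rule that[OF T(1)])
    show "e_val A Sel (1 - i) T = Max (A i) - Min (A i)" unfolding T(3) using pq sm by simp
    show "e_val A Sel i T = (if Min (A i) \<in> Sel i then Min (Sel (1 - i)) - Min (A (1 - i)) else 0) +
     (if Max (A i) \<in> Sel i then Max (A (1 - i)) - Max (Sel (1 - i)) else 0)"
      unfolding T(2) using s by simp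
  qed
qed

lemma e_max_eq: "i < 2 \<Longrightarrow> e_max A Sel (1 - i) = Max (A i) - Min (A i)"
proof -
  assume i: "i < 2"
  then obtain T where T: "T \<in> triangulations A" "e_val A Sel (1 - i) T = Max (A i) - Min (A i)"
    using triangulation_full_other[OF i] by metis
  have k: "1 - (1 - i) = i" "1 - i < 2" using i by auto
  have le: "e_val A Sel (1 - i) T' \<le> Max (A i) - Min (A i)" if "T' \<in> triangulations A" for T'
    using e_val_le_full[of A T' "1 - i" Sel] fin that k(2) Sel(1)[OF k(2)] unfolding k(1) by blast
  show ?thesis unfolding e_max_def
  proof (rule Max_eqI)
    show "finite (e_val A Sel (1 - i) ` triangulations A)" using finite_triangulations[of A] fin by simp
    show "y \<le> Max (A i) - Min (A i)" if "y \<in> e_val A Sel (1 - i) ` triangulations A" for y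
      using le that by blast
    show "Max (A i) - Min (A i) \<in> e_val A Sel (1 - i) ` triangulations A"
      unfolding T(2)[symmetric] using T(1) by (rule imageI)
  qed
qed

lemma e_min_at_max_eq:
  assumes i: "i < 2"
  shows "e_min_at_max A Sel i = (if Min (A i) \<in> Sel i then Min (Sel (1 - i)) - Min (A (1 - i)) else 0) +
     (if Max (A i) \<in> Sel i then Max (A (1 - i)) - Max (Sel (1 - i)) else 0)" (is "_ = ?v")
proof -
  obtain T where T: "T \<in> triangulations A" "e_val A Sel (1 - i) T = Max (A i) - Min (A i)" "e_val A Sel i T = ?v"
    using triangulation_full_other[OF i] by metis
  show ?thesis unfolding e_min_at_max_def e_max_eq[OF i]
  proof (rule Min_eqI)
    show "finite (e_val A Sel i ` {T \<in> triangulations A. e_val A Sel (1 - i) T = Max (A i) - Min (A i)})"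
      using finite_triangulations[of A] fin by auto
    fix y assume "y \<in> e_val A Sel i ` {T \<in> triangulations A. e_val A Sel (1 - i) T = Max (A i) - Min (A i)}"
    then obtain T' where "T' \<in> triangulations A" "e_val A Sel (1 - i) T' = Max (A i) - Min (A i)" "y = e_val A Sel i T'" by auto
    then show "?v \<le> y"
      using e_val_ge_of_other_full[of A T' i Sel] fin i Sel(1) Sel(2)[of "1 - i"] rows_nontrivial[OF i] by auto
  next
    show "?v \<in> e_val A Sel i ` {T \<in> triangulations A. e_val A Sel (1 - i) T = Max (A i) - Min (A i)}"
      unfolding T(3)[symmetric] using T(1,2) by blast
  qed
qed

end

section \<open>The upper left boundary of a planar point set\<close>

text \<open>Two points on a supporting line make it carry an edge of the convex hull; an edge of positive slope
with the point set below it faces the upper left.\<close>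

definition has_upper_left_edge :: "(real \<times> real) set \<Rightarrow> real \<Rightarrow> bool" where
  "has_upper_left_edge S \<sigma> \<longleftrightarrow> (\<exists>z\<in>S. \<exists>z'\<in>S. fst z < fst z' \<and> snd z' - snd z = \<sigma> * (fst z' - fst z) \<and>
     (\<forall>w\<in>S. snd w - snd z \<le> \<sigma> * (fst w - fst z)))"

text \<open>The edges of the boundary to the right of \<open>z\<close> have slope less than \<open>\<sigma>\<close>, and no line through \<open>z\<close> of such a
slope has a point of \<open>S\<close> above it on the left. This is the invariant when the boundary is followed from edge to edge.\<close>

definition below_slope :: "(real \<times> real) set \<Rightarrow> real \<times> real \<Rightarrow> real \<Rightarrow> bool" where
  "below_slope S z \<sigma> \<longleftrightarrow>
     (\<forall>w\<in>S. fst w \<le> fst z \<longrightarrow> (\<forall>\<tau>. 0 < \<tau> \<and> \<tau> < \<sigma> \<longrightarrow> snd w - snd z \<le> \<tau> * (fst w - fst z))) \<and>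
     (\<forall>w\<in>S. fst z < fst w \<longrightarrow> snd w - snd z < \<sigma> * (fst w - fst z))"

text \<open>One step along the boundary: from \<open>z\<close> take the steepest segment to a point on its right, and go to
the last point of \<open>S\<close> on it.\<close>

lemma next_edge:
  assumes S: "finite S" "z \<in> S" "F \<in> S" and zF: "fst z < fst F" "snd z < snd F"
    and F: "\<And>w. w \<in> S \<Longrightarrow> snd w \<le> snd F" "\<And>w. w \<in> S \<Longrightarrow> snd w = snd F \<Longrightarrow> fst F \<le> fst w"
    and b: "below_slope S z \<sigma>"
  obtains \<tau> z' where "0 < \<tau>" "\<tau> < \<sigma>" "has_upper_left_edge S \<tau>" "z' \<in> S" "fst z < fst z'"
    "snd z' - snd z = \<tau> * (fst z' - fst z)" "\<And>w. w \<in> S \<Longrightarrow> snd w - snd z \<le> \<tau> * (fst w - fst z)"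
    "below_slope S z' \<tau>" "z' = F \<or> fst z' < fst F \<and> snd z' < snd F"
proof -
  define R where "R = {w \<in> S. fst z < fst w}"
  define sl where "sl w = (snd w - snd z) / (fst w - fst z)" for w
  have R: "finite R" "F \<in> R" using S zF unfolding R_def by auto
  define \<tau> where "\<tau> = Max (sl ` R)"
  have le: "sl w \<le> \<tau>" if "w \<in> R" for w unfolding \<tau>_def using R that by simp
  have line: "snd w - snd z = sl w * (fst w - fst z)" if "w \<in> R" for w
    using that unfolding sl_def R_def by simp
  obtain z0 where z0: "z0 \<in> R" "sl z0 = \<tau>"
    using Max_in[of "sl ` R"] R unfolding \<tau>_def by (metis empty_iff finite_imageI imageE image_is_empty)
  have "sl F > 0" using zF unfolding sl_def by simp
  then have pos: "\<tau> > 0" using le[OF R(2)] by simp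
  have "snd z0 - snd z < \<sigma> * (fst z0 - fst z)" "fst z0 - fst z > 0"
    using b z0 unfolding below_slope_def R_def by auto
  then have lt: "\<tau> < \<sigma>" using line[OF z0(1)] z0(2) by simp
  have under: "snd w - snd z \<le> \<tau> * (fst w - fst z)" if "w \<in> S" for w
  proof (cases "fst z < fst w")
    case True
    then have w: "w \<in> R" using that unfolding R_def by simp
    show ?thesis unfolding line[OF w] using le[OF w] True by (intro mult_right_mono) auto
  next
    case False
    then show ?thesis using b that pos lt unfolding below_slope_def by auto
  qed
  \<comment> \<open>Taking the farthest point on the edge makes all later slopes strictly smaller.\<close>
  define L where "L = {w \<in> R. sl w = \<tau>}"
  have L: "finite L" "z0 \<in> L" using R z0 unfolding L_def by auto
  obtain z' where z': "z' \<in> L" "fst z' = Max (fst ` L)"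
    using Max_in[of "fst ` L"] L by (metis empty_iff finite_imageI imageE image_is_empty)
  have far: "fst w \<le> fst z'" if "w \<in> L" for w
    unfolding z'(2) using L that by simp
  have z'S: "z' \<in> S" "fst z < fst z'" "snd z' - snd z = \<tau> * (fst z' - fst z)"
    using z'(1) line[of z'] unfolding L_def R_def by auto
  have "below_slope S z' \<tau>"
    unfolding below_slope_def
  proof (intro conjI ballI impI allI)
    fix w t assume w: "w \<in> S" "fst w \<le> fst z'" "0 < t \<and> t < \<tau>"
    have "snd w - snd z' \<le> \<tau> * (fst w - fst z')"
      using under[OF w(1)] z'S(3) by (simp add: algebra_simps)
    also have "\<dots> \<le> t * (fst w - fst z')" using w by (intro mult_right_mono_neg) auto
    finally show "snd w - snd z' \<le> t * (fst w - fst z')" .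
  next
    fix w assume w: "w \<in> S" "fst z' < fst w"
    then have wR: "w \<in> R" using z'S unfolding R_def by auto
    have "sl w \<noteq> \<tau>" using far[of w] w wR unfolding L_def by auto
    then have "sl w < \<tau>" using le[OF wR] by simp
    then have "sl w * (fst w - fst z) < \<tau> * (fst w - fst z)" using wR unfolding R_def by (intro mult_strict_right_mono) auto
    then have "snd w - snd z < \<tau> * (fst w - fst z)" using line[OF wR] by simp
    then show "snd w - snd z' < \<tau> * (fst w - fst z')" using z'S(3) by (simp add: algebra_simps)
  qed
  moreover have "z' = F \<or> fst z' < fst F \<and> snd z' < snd F"
  proof (cases "snd z' = snd F")
    case True
    then have "fst F \<le> fst z'" using F(2) z'S by blast
    moreover have "\<tau> * (fst z' - fst z) \<le> \<tau> * (fst F - fst z)" using under[OF S(3)] z'S(3) True by simp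
    then have "fst z' \<le> fst F" using pos by simp
    ultimately show ?thesis using True by (simp add: prod_eq_iff)
  next
    case False
    then have l: "snd z' < snd F" using F(1)[OF z'S(1)] by simp
    then have "\<tau> * (fst z' - fst z) < \<tau> * (fst F - fst z)" using under[OF S(3)] z'S(3) by simp
    then show ?thesis using l pos by simp
  qed
  moreover have "has_upper_left_edge S \<tau>"
    unfolding has_upper_left_edge_def using S(2) z'S under by blast
  ultimately show thesis using that pos lt z'S under by blast
qed

text \<open>The end points of the upper left part of the boundary of the convex hull of \<open>S\<close>, in the situation where
this part does not reduce to a point and contains no horizontal or vertical segment.\<close>

locale upper_left_chain =
  fixes S :: "(real \<times> real) set" and E F :: "real \<times> real"
  assumes fin: "finite S" and ES: "E \<in> S" and FS: "F \<in> S" and EF: "fst E < fst F" "snd E < snd F"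
    and left: "\<And>w. w \<in> S \<Longrightarrow> fst E \<le> fst w" "\<And>w. w \<in> S \<Longrightarrow> fst w = fst E \<Longrightarrow> snd w \<le> snd E"
    and top: "\<And>w. w \<in> S \<Longrightarrow> snd w \<le> snd F" "\<And>w. w \<in> S \<Longrightarrow> snd w = snd F \<Longrightarrow> fst F \<le> fst w"
begin

lemma below_slope_E: "\<exists>\<sigma>. below_slope S E \<sigma>"
proof -
  define \<sigma> where "\<sigma> = Max ((\<lambda>w. (snd w - snd E) / (fst w - fst E)) ` S) + 1"
  have "snd w - snd E < \<sigma> * (fst w - fst E)" if "w \<in> S" "fst E < fst w" for w
  proof -
    have "(snd w - snd E) / (fst w - fst E) \<le> Max ((\<lambda>w. (snd w - snd E) / (fst w - fst E)) ` S)"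
      using fin that by simp
    then have "(snd w - snd E) / (fst w - fst E) < \<sigma>" unfolding \<sigma>_def by linarith
    then show ?thesis using that by (simp add: pos_divide_less_eq)
  qed
  moreover have "snd w - snd E \<le> \<tau> * (fst w - fst E)" if "w \<in> S" "fst w \<le> fst E" for w \<tau>
    using left that by (metis cancel_comm_monoid_add_class.diff_cancel diff_le_0_iff_le mult_zero_right order_antisym)
  ultimately show ?thesis unfolding below_slope_def by blast
qed

text \<open>After the first edge the slope would have to decrease, so the first edge ends in \<open>F\<close>.\<close>

lemma single_slope:
  assumes "\<And>\<tau>. 0 < \<tau> \<Longrightarrow> has_upper_left_edge S \<tau> \<Longrightarrow> \<tau> = s"
  shows "0 < s" "snd F - snd E = s * (fst F - fst E)" "\<And>w. w \<in> S \<Longrightarrow> snd w - snd E \<le> s * (fst w - fst E)"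
proof -
  obtain \<sigma> where "below_slope S E \<sigma>" using below_slope_E by blast
  from next_edge[OF fin ES FS EF top this] obtain \<tau> z where
    t: "0 < \<tau>" "has_upper_left_edge S \<tau>" "z \<in> S" "snd z - snd E = \<tau> * (fst z - fst E)" "\<And>w. w \<in> S \<Longrightarrow> snd w - snd E \<le> \<tau> * (fst w - fst E)"
    "below_slope S z \<tau>" "z = F \<or> fst z < fst F \<and> snd z < snd F"
    by metis
  have "z = F"
  proof (rule ccontr)
    assume "z \<noteq> F"
    then have "fst z < fst F" "snd z < snd F" using t by auto
    from next_edge[OF fin t(3) FS this top t(6)] show False
      using assms t(1,2) by (metis less_irrefl)
  qed
  moreover have "\<tau> = s" using assms t by blast
  ultimately show "0 < s" "snd F - snd E = s * (fst F - fst E)" "\<And>w. w \<in> S \<Longrightarrow> snd w - snd E \<le> s * (fst w - fst E)"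
    using t by auto
qed

text \<open>Since \<open>F - E\<close> is a combination of both directions, neither of them alone leads to \<open>F\<close>; so the boundary
consists of an edge of slope \<open>s\<close> followed by one of slope \<open>s'\<close>, and their lengths are determined by
\<open>F - E\<close>.\<close>

lemma two_slopes:
  assumes "\<And>\<tau>. 0 < \<tau> \<Longrightarrow> has_upper_left_edge S \<tau> \<Longrightarrow> \<tau> = s \<or> \<tau> = s'" and s: "s' < s"
    and x: "fst F - fst E = x + x'" "snd F - snd E = s * x + s' * x'" "0 < x" "0 < x'"
  shows "(fst E + x, snd E + s * x) \<in> S" "\<And>w. w \<in> S \<Longrightarrow> snd w - snd E \<le> s * (fst w - fst E)"
    "\<And>w. w \<in> S \<Longrightarrow> snd w - snd F \<le> s' * (fst w - fst F)"
proof -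
  obtain \<sigma> where "below_slope S E \<sigma>" using below_slope_E by blast
  from next_edge[OF fin ES FS EF top this] obtain \<tau> z where
    t: "0 < \<tau>" "has_upper_left_edge S \<tau>" "z \<in> S" "snd z - snd E = \<tau> * (fst z - fst E)" "\<And>w. w \<in> S \<Longrightarrow> snd w - snd E \<le> \<tau> * (fst w - fst E)"
    "below_slope S z \<tau>" "z = F \<or> fst z < fst F \<and> snd z < snd F"
    by metis
  have m: "s' * x < s * x" "s' * x' < s * x'" using s x by auto
  have "snd F - snd E \<noteq> s * (fst F - fst E)" "snd F - snd E \<noteq> s' * (fst F - fst E)"
    using m x by (auto simp: algebra_simps)
  then have ne: "z \<noteq> F" using t assms(1) by blast
  then have zF: "fst z < fst F" "snd z < snd F" using t by auto
  from next_edge[OF fin t(3) FS zF top t(6)] obtain \<tau>' z' where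
    t': "0 < \<tau>'" "\<tau>' < \<tau>" "has_upper_left_edge S \<tau>'" "z' \<in> S" "snd z' - snd z = \<tau>' * (fst z' - fst z)"
      "\<And>w. w \<in> S \<Longrightarrow> snd w - snd z \<le> \<tau>' * (fst w - fst z)"
    "below_slope S z' \<tau>'" "z' = F \<or> fst z' < fst F \<and> snd z' < snd F"
    by metis
  have \<tau>: "\<tau> = s" "\<tau>' = s'" using assms(1)[OF t(1,2)] assms(1)[OF t'(1,3)] t'(2) s by auto
  have z'F: "z' = F"
  proof (rule ccontr)
    assume "z' \<noteq> F"
    then have "fst z' < fst F" "snd z' < snd F" using t' by auto
    from next_edge[OF fin t'(4) FS this top t'(7)] obtain \<tau>'' where
      "0 < \<tau>''" "\<tau>'' < \<tau>'" "has_upper_left_edge S \<tau>''" by metis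
    then show False using assms(1) \<tau> s by fastforce
  qed
  have a: "snd z - snd E = s * (fst z - fst E)" "snd F - snd z = s' * (fst F - fst z)"
    using t(4) t'(5) unfolding \<tau> z'F by auto
  have "(s - s') * (fst z - fst E) = (s - s') * x"
    using a x by (simp add: algebra_simps)
  then have "fst z - fst E = x" using s by simp
  then have "z = (fst E + x, snd E + s * x)" using a by (simp add: prod_eq_iff)
  then show "(fst E + x, snd E + s * x) \<in> S" using t by simp
  show "snd w - snd E \<le> s * (fst w - fst E)" if "w \<in> S" for w using t(5)[OF that] unfolding \<tau> .
  show "snd w - snd F \<le> s' * (fst w - fst F)" if "w \<in> S" for w
    using t'(6)[OF that] a(2) unfolding \<tau> by (simp add: algebra_simps)
qed

end

lemma in_closed_segment_iff_on_line:
  fixes E F z :: "real \<times> real"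
  assumes "fst E < fst F" "snd F - snd E = s * (fst F - fst E)"
  shows "z \<in> closed_segment E F \<longleftrightarrow> fst E \<le> fst z \<and> fst z \<le> fst F \<and> snd z - snd E = s * (fst z - fst E)"
proof
  assume "z \<in> closed_segment E F"
  then obtain u where u: "0 \<le> u" "u \<le> 1" "z = (1 - u) *\<^sub>R E + u *\<^sub>R F" unfolding closed_segment_def by auto
  have f: "fst z = fst E + u * (fst F - fst E)" and g: "snd z = snd E + u * (snd F - snd E)"
    unfolding u(3) by (auto simp: algebra_simps)
  have "0 \<le> u * (fst F - fst E)" "u * (fst F - fst E) \<le> 1 * (fst F - fst E)"
    using u assms by (auto intro: mult_right_mono)
  then show "fst E \<le> fst z \<and> fst z \<le> fst F \<and> snd z - snd E = s * (fst z - fst E)"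
    unfolding f g assms(2) by auto
next
  assume z: "fst E \<le> fst z \<and> fst z \<le> fst F \<and> snd z - snd E = s * (fst z - fst E)"
  define u where "u = (fst z - fst E) / (fst F - fst E)"
  have u: "u * (fst F - fst E) = fst z - fst E" using assms unfolding u_def by simp
  have "0 \<le> u" "u \<le> 1" using z assms unfolding u_def by (auto simp: pos_divide_le_eq)
  moreover have "z = (1 - u) *\<^sub>R E + u *\<^sub>R F"
  proof (rule prod_eqI)
    show "fst z = fst ((1 - u) *\<^sub>R E + u *\<^sub>R F)" using u by (simp add: algebra_simps)
    have "snd z = snd E + u * (snd F - snd E)"
    proof -
      have "u * (snd F - snd E) = s * (u * (fst F - fst E))" unfolding assms(2) by simp
      then show ?thesis using z u by simp
    qed
    then show "snd z = snd ((1 - u) *\<^sub>R E + u *\<^sub>R F)" by (simp add: algebra_simps)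
  qed
  ultimately show "z \<in> closed_segment E F" unfolding closed_segment_def by blast
qed

lemma supported_segment_edge:
  fixes E F :: "real \<times> real"
  assumes "convex K" "E \<in> K" "F \<in> K" and EF: "fst E < fst F" "snd F - snd E = s * (fst F - fst E)"
    and K: "\<And>w. w \<in> K \<Longrightarrow> snd w - snd E \<le> s * (fst w - fst E)"
      "\<And>w. w \<in> K \<Longrightarrow> snd w - snd E = s * (fst w - fst E) \<Longrightarrow> fst E \<le> fst w \<and> fst w \<le> fst F"
  shows "closed_segment E F edge_of K" "closed_segment E F \<subseteq> frontier K"
proof -
  let ?a = "(- s, 1)" and ?b = "snd E - s * fst E"
  have le: "K \<subseteq> {w. ?a \<bullet> w \<le> ?b}" using K(1) by (force simp: inner_prod_def algebra_simps)
  have seg: "K \<inter> {w. ?a \<bullet> w = ?b} = closed_segment E F"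
  proof -
    have "closed_segment E F \<subseteq> K" using assms by (simp add: closed_segment_subset)
    moreover have "w \<in> closed_segment E F" if "w \<in> K" "?a \<bullet> w = ?b" for w
    proof -
      have "snd w - snd E = s * (fst w - fst E)" using that(2) by (simp add: inner_prod_def algebra_simps)
      then show ?thesis using K(2)[OF that(1)] in_closed_segment_iff_on_line[OF EF] by blast
    qed
    moreover have "?a \<bullet> w = ?b" if "w \<in> closed_segment E F" for w
      using that in_closed_segment_iff_on_line[OF EF] by (simp add: inner_prod_def algebra_simps)
    ultimately show ?thesis by blast
  qed
  have "closed_segment E F face_of K"
    unfolding seg[symmetric] using le assms(1) by (intro face_of_Int_supporting_hyperplane_le) auto
  moreover have "aff_dim (closed_segment E F) = 1"
    using EF(1) aff_dim_simplex[OF one_simplex_segment[of E F]] by auto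
  ultimately show "closed_segment E F edge_of K" unfolding edge_of_def by simp
  have "interior K \<subseteq> {w. ?a \<bullet> w < ?b}"
    using interior_mono[OF le] interior_halfspace_le[of ?a ?b] by (simp add: zero_prod_def)
  then have disj: "w \<notin> interior K" if "w \<in> closed_segment E F" for w
  proof -
    have "?a \<bullet> w = ?b" using that seg by blast
    then show ?thesis using \<open>interior K \<subseteq> _\<close> by force
  qed
  have "closed_segment E F \<subseteq> closure K" using seg closure_subset by blast
  then show "closed_segment E F \<subseteq> frontier K" unfolding frontier_def using disj by blast
qed

lemma upper_left_of_point_below_segment:
  fixes E F z :: "real \<times> real"
  assumes EF: "fst E < fst F" "snd F - snd E = s * (fst F - fst E)" "0 < s"
    and z: "fst z \<le> fst F" "snd E \<le> snd z" "snd z - snd E < s * (fst z - fst E)"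
  obtains w where "w \<in> closed_segment E F" "fst w < fst z" "snd z < snd w"
proof -
  define q where "q = (snd z - snd E) / s"
  define d where "d = (q + (fst z - fst E)) / 2"
  have "(snd z - snd E) / s < fst z - fst E" using z(3) EF(3) by (simp add: pos_divide_less_eq mult.commute)
  then have d: "d < fst z - fst E" "(snd z - snd E) / s < d" unfolding d_def q_def[symmetric] by (auto simp: field_simps)
  have d0: "0 \<le> d" using d(2) z(2) EF(3) by (smt (verit) divide_nonneg_pos)
  have "s * ((snd z - snd E) / s) < s * d" using d(2) EF(3) by (intro mult_strict_left_mono)
  then have sd: "snd z - snd E < s * d" using EF(3) by simp
  have "(fst E + d, snd E + s * d) \<in> closed_segment E F"
    unfolding in_closed_segment_iff_on_line[OF EF(1,2)] using d d0 z by auto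
  then show thesis using that d sd by force
qed

lemma convex_hull_below_line:
  fixes S :: "(real \<times> real) set"
  assumes "\<And>w. w \<in> S \<Longrightarrow> snd w - y \<le> s * (fst w - x)" "w \<in> convex hull S"
  shows "snd w - y \<le> s * (fst w - (x::real))"
proof -
  have "convex hull S \<subseteq> {w. (- s, 1) \<bullet> w \<le> y - s * x}"
    using assms(1) by (intro hull_minimal convex_halfspace_le) (force simp: inner_prod_def algebra_simps)
  then show ?thesis using assms(2) by (force simp: inner_prod_def algebra_simps)
qed

lemma convex_hull_fst_ge:
  fixes S :: "(real \<times> real) set"
  assumes "\<And>w. w \<in> S \<Longrightarrow> (x::real) \<le> fst w" "w \<in> convex hull S"
  shows "x \<le> fst w"
proof -
  have "convex hull S \<subseteq> {w. (1, 0) \<bullet> w \<ge> x}"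
    using assms(1) by (intro hull_minimal convex_halfspace_ge) (force simp: inner_prod_def)
  then show ?thesis using assms(2) by (force simp: inner_prod_def)
qed

lemma convex_hull_snd_le:
  fixes S :: "(real \<times> real) set"
  assumes "\<And>w. w \<in> S \<Longrightarrow> snd w \<le> (y::real)" "w \<in> convex hull S"
  shows "snd w \<le> y"
proof -
  have "convex hull S \<subseteq> {w. (0, 1) \<bullet> w \<le> y}"
    using assms(1) by (intro hull_minimal convex_halfspace_le) (force simp: inner_prod_def)
  then show ?thesis using assms(2) by (force simp: inner_prod_def)
qed

context upper_left_chain
begin

lemma frontier_hull: "z \<in> frontier (convex hull S) \<Longrightarrow> z \<in> convex hull S"
proof -
  have "closed (convex hull S)" using fin by (simp add: compact_imp_closed finite_imp_compact compact_convex_hull)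
  then show "z \<in> frontier (convex hull S) \<Longrightarrow> z \<in> convex hull S" using frontier_subset_closed by blast
qed

lemma upper_left_cornerI:
  assumes "z \<in> frontier K" "fst E \<le> fst z" "fst z \<le> fst F" "snd E \<le> snd z" "snd z \<le> snd F"
    "\<And>w. w \<in> K \<Longrightarrow> \<not> (fst w < fst z \<and> snd z < snd w)"
  shows "z \<in> upper_left_corner K E F"
  using assms unfolding upper_left_corner_def by blast

lemma upper_left_cornerD:
  assumes "z \<in> upper_left_corner K E F"
  shows "z \<in> frontier K" "fst E \<le> fst z" "fst z \<le> fst F" "snd E \<le> snd z" "snd z \<le> snd F"
    "\<not> (\<exists>w\<in>K. fst w < fst z \<and> snd z < snd w)"
  using assms unfolding upper_left_corner_def by blast+

lemma corner_single_edge: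
  assumes slope: "\<And>\<tau>. 0 < \<tau> \<Longrightarrow> has_upper_left_edge S \<tau> \<Longrightarrow> \<tau> = s"
  shows "is_single_edge (convex hull S) (upper_left_corner (convex hull S) E F) E F"
proof -
  let ?K = "convex hull S"
  have s: "0 < s" "snd F - snd E = s * (fst F - fst E)" "\<And>w. w \<in> S \<Longrightarrow> snd w - snd E \<le> s * (fst w - fst E)"
    using single_slope[of s] slope by blast+
  have under: "snd w - snd E \<le> s * (fst w - fst E)" if "w \<in> ?K" for w
    using convex_hull_below_line[OF s(3) that] .
  have ge: "fst E \<le> fst w" "snd w \<le> snd F" if "w \<in> ?K" for w
    using convex_hull_fst_ge[OF left(1) that] convex_hull_snd_le[OF top(1) that] by auto
  have EFK: "E \<in> ?K" "F \<in> ?K" using ES FS by (auto simp: hull_inc)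
  have on: "fst E \<le> fst w \<and> fst w \<le> fst F" if "w \<in> ?K" "snd w - snd E = s * (fst w - fst E)" for w
  proof -
    have "s * (fst w - fst E) \<le> s * (fst F - fst E)" using ge(2)[OF that(1)] that(2) s(2) by simp
    then show ?thesis using ge(1)[OF that(1)] s(1) by simp
  qed
  have edge: "closed_segment E F edge_of ?K" "closed_segment E F \<subseteq> frontier ?K"
    by (rule supported_segment_edge[OF convex_convex_hull EFK EF(1) s(2)], erule under, erule (1) on)+
  have "upper_left_corner ?K E F = closed_segment E F"
  proof (intro subset_antisym subsetI)
    fix z assume z: "z \<in> upper_left_corner ?K E F"
    then have zK: "z \<in> ?K" and box: "fst E \<le> fst z" "fst z \<le> fst F" "snd E \<le> snd z" "snd z \<le> snd F"
      and no: "\<not> (\<exists>w\<in>?K. fst w < fst z \<and> snd z < snd w)"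
      using upper_left_cornerD[OF z] frontier_hull by blast+
    have "snd z - snd E = s * (fst z - fst E)"
    proof (rule ccontr)
      assume "snd z - snd E \<noteq> s * (fst z - fst E)"
      then have "snd z - snd E < s * (fst z - fst E)" using under[OF zK] by simp
      then obtain w where "w \<in> closed_segment E F" "fst w < fst z" "snd z < snd w"
        using upper_left_of_point_below_segment[OF EF(1) s(2,1) box(2,3)] by metis
      moreover have "closed_segment E F \<subseteq> ?K" using EFK by (simp add: closed_segment_subset)
      ultimately show False using no by blast
    qed
    then show "z \<in> closed_segment E F" using in_closed_segment_iff_on_line[OF EF(1) s(2)] box by simp
  next
    fix z assume z: "z \<in> closed_segment E F"
    then have l: "fst E \<le> fst z" "fst z \<le> fst F" "snd z - snd E = s * (fst z - fst E)"
      using in_closed_segment_iff_on_line[OF EF(1) s(2)] by auto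
    have "0 \<le> s * (fst z - fst E)" "s * (fst z - fst E) \<le> s * (fst F - fst E)" using s(1) l(1,2) by simp_all
    then have y: "snd E \<le> snd z" "snd z \<le> snd F" using l(3) s(2) by linarith+
    have no: "\<not> (fst w < fst z \<and> snd z < snd w)" if "w \<in> ?K" for w
    proof
      assume w: "fst w < fst z \<and> snd z < snd w"
      then have "s * (fst w - fst E) < s * (fst z - fst E)" using s(1) by simp
      then show False using under[OF that] w l(3) by linarith
    qed
    show "z \<in> upper_left_corner ?K E F"
      by (rule upper_left_cornerI[OF subsetD[OF edge(2) z] l(1,2) y no])
  qed
  then show ?thesis unfolding is_single_edge_def using edge(1) by simp
qed

lemma corner_two_edges:
  assumes slope: "\<And>\<tau>. 0 < \<tau> \<Longrightarrow> has_upper_left_edge S \<tau> \<Longrightarrow> \<tau> = s \<or> \<tau> = s'" and s: "0 < s'" "s' < s"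
    and x: "fst F - fst E = x + x'" "snd F - snd E = s * x + s' * x'" "0 < x" "0 < x'"
  shows "is_two_edges (convex hull S) (upper_left_corner (convex hull S) E F) E (fst E + x, snd E + s * x) F"
proof -
  let ?K = "convex hull S"
  define p where "p = (fst E + x, snd E + s * x)"
  have d: "(fst E + x, snd E + s * x) \<in> S" "\<And>w. w \<in> S \<Longrightarrow> snd w - snd E \<le> s * (fst w - fst E)"
    "\<And>w. w \<in> S \<Longrightarrow> snd w - snd F \<le> s' * (fst w - fst F)"
    using two_slopes[of s s' x x'] slope s(2) x by blast+
  have pS: "p \<in> S" using d(1) unfolding p_def .
  have K: "E \<in> ?K" "F \<in> ?K" "p \<in> ?K" using ES FS pS by (auto simp: hull_inc)
  have Ep: "fst E < fst p" "snd p - snd E = s * (fst p - fst E)" using x unfolding p_def by auto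
  have pF: "fst p < fst F" "snd F - snd p = s' * (fst F - fst p)" using x unfolding p_def by (auto simp: algebra_simps)
  have un1: "snd w - snd E \<le> s * (fst w - fst E)" if "w \<in> ?K" for w
    using convex_hull_below_line[OF d(2) that] .
  have un2: "snd w - snd p \<le> s' * (fst w - fst p)" if "w \<in> ?K" for w
    using convex_hull_below_line[OF d(3) that] pF(2) by (simp add: algebra_simps)
  have un1': "snd w - snd p \<le> s * (fst w - fst p)" if "w \<in> ?K" for w
    using un1[OF that] Ep(2) by (simp add: algebra_simps)
  have ge: "fst E \<le> fst w" "snd w \<le> snd F" if "w \<in> ?K" for w
    using convex_hull_fst_ge[OF left(1) that] convex_hull_snd_le[OF top(1) that] by auto
  have on1: "fst E \<le> fst w \<and> fst w \<le> fst p" if "w \<in> ?K" "snd w - snd E = s * (fst w - fst E)" for w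
  proof -
    have "snd w - snd p = s * (fst w - fst p)" using that(2) Ep(2) by (simp add: algebra_simps)
    then have "(s - s') * (fst w - fst p) \<le> 0" using un2[OF that(1)] by (simp add: algebra_simps)
    then show ?thesis using ge(1)[OF that(1)] s(2) by (simp add: mult_le_0_iff)
  qed
  have on2: "fst p \<le> fst w \<and> fst w \<le> fst F" if "w \<in> ?K" "snd w - snd p = s' * (fst w - fst p)" for w
  proof -
    have "0 \<le> (s - s') * (fst w - fst p)" using un1'[OF that(1)] that(2) by (simp add: algebra_simps)
    then have "fst p \<le> fst w" using s(2) by (simp add: zero_le_mult_iff)
    moreover have "s' * (fst w - fst p) \<le> s' * (fst F - fst p)" using ge(2)[OF that(1)] that(2) pF(2) by simp
    ultimately show ?thesis using s(1) by simp
  qed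
  have edge1: "closed_segment E p edge_of ?K" "closed_segment E p \<subseteq> frontier ?K"
    by (rule supported_segment_edge[OF convex_convex_hull K(1,3) Ep], erule un1, erule (1) on1)+
  have edge2: "closed_segment p F edge_of ?K" "closed_segment p F \<subseteq> frontier ?K"
    by (rule supported_segment_edge[OF convex_convex_hull K(3,2) pF], erule un2, erule (1) on2)+
  have sub: "closed_segment E p \<subseteq> ?K" "closed_segment p F \<subseteq> ?K" using K by (simp_all add: closed_segment_subset)
  have "upper_left_corner ?K E F = closed_segment E p \<union> closed_segment p F"
  proof (intro subset_antisym subsetI)
    fix z assume z: "z \<in> upper_left_corner ?K E F"
    then have zK: "z \<in> ?K" and box: "fst E \<le> fst z" "fst z \<le> fst F" "snd E \<le> snd z" "snd z \<le> snd F"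
      and no: "\<not> (\<exists>w\<in>?K. fst w < fst z \<and> snd z < snd w)"
      using upper_left_cornerD[OF z] frontier_hull by blast+
    have cases: "fst z \<le> fst p \<and> snd z \<le> snd p \<or> fst p \<le> fst z \<and> snd p \<le> snd z"
    proof -
      have "\<not> (fst p < fst z \<and> snd z < snd p)" using no K(3) by blast
      moreover have "\<not> (fst z < fst p \<and> snd p < snd z)"
      proof
        assume c: "fst z < fst p \<and> snd p < snd z"
        then have "s * (fst z - fst p) < 0" using s by (simp add: mult_pos_neg)
        then show False using un1'[OF zK] c by linarith
      qed
      moreover have "snd z \<le> snd p" if "fst z = fst p" using un1'[OF zK] that by simp
      moreover have "fst p \<le> fst z" if "snd z = snd p"
      proof -
        have "0 \<le> s * (fst z - fst p)" using un1'[OF zK] that by simp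
        then show ?thesis using s by (simp add: zero_le_mult_iff)
      qed
      ultimately show ?thesis by argo
    qed
    then show "z \<in> closed_segment E p \<union> closed_segment p F"
    proof
      assume c: "fst z \<le> fst p \<and> snd z \<le> snd p"
      have "snd z - snd E = s * (fst z - fst E)"
      proof (rule ccontr)
        assume "snd z - snd E \<noteq> s * (fst z - fst E)"
        then have "snd z - snd E < s * (fst z - fst E)" using un1[OF zK] by simp
        then obtain w where "w \<in> closed_segment E p" "fst w < fst z" "snd z < snd w"
          using upper_left_of_point_below_segment[OF Ep _ conjunct1[OF c] box(3)] s by (metis order_less_trans)
        then show False using no sub by blast
      qed
      then show ?thesis using in_closed_segment_iff_on_line[OF Ep] c box by simp
    next
      assume c: "fst p \<le> fst z \<and> snd p \<le> snd z"
      have "snd z - snd p = s' * (fst z - fst p)"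
      proof (rule ccontr)
        assume "snd z - snd p \<noteq> s' * (fst z - fst p)"
        then have "snd z - snd p < s' * (fst z - fst p)" using un2[OF zK] by simp
        then obtain w where "w \<in> closed_segment p F" "fst w < fst z" "snd z < snd w"
          using upper_left_of_point_below_segment[OF pF s(1) box(2) conjunct2[OF c]] by metis
        then show False using no sub by blast
      qed
      then show ?thesis using in_closed_segment_iff_on_line[OF pF] c box by simp
    qed
  next
    fix z assume z: "z \<in> closed_segment E p \<union> closed_segment p F"
    then show "z \<in> upper_left_corner ?K E F"
    proof
      assume z: "z \<in> closed_segment E p"
      then have l: "fst E \<le> fst z" "fst z \<le> fst p" "snd z - snd E = s * (fst z - fst E)"
        using in_closed_segment_iff_on_line[OF Ep] by auto
      have "0 \<le> s * (fst z - fst E)" using s l(1) by simp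
      moreover have "z \<in> ?K" using sub z by blast
      ultimately have y: "snd E \<le> snd z" "snd z \<le> snd F" using l(3) ge(2)[of z] by linarith+
      have no: "\<not> (fst w < fst z \<and> snd z < snd w)" if "w \<in> ?K" for w
      proof
        assume w: "fst w < fst z \<and> snd z < snd w"
        then have "s * (fst w - fst E) < s * (fst z - fst E)" using s by simp
        then show False using un1[OF that] w l(3) by linarith
      qed
      show ?thesis
        by (rule upper_left_cornerI[OF subsetD[OF edge1(2) z] l(1) _ y no]) (use l(2) pF(1) in linarith)
    next
      assume z: "z \<in> closed_segment p F"
      then have l: "fst p \<le> fst z" "fst z \<le> fst F" "snd z - snd p = s' * (fst z - fst p)"
        using in_closed_segment_iff_on_line[OF pF] by auto
      have "0 \<le> s' * (fst z - fst p)" using s l(1) by simp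
      moreover have "z \<in> ?K" using sub z by blast
      moreover have "0 \<le> s * (fst p - fst E)" using Ep(1) s by simp
      moreover note Ep(2)
      ultimately have y: "snd E \<le> snd z" "snd z \<le> snd F" using l(3) ge(2)[of z] by linarith+
      have no: "\<not> (fst w < fst z \<and> snd z < snd w)" if "w \<in> ?K" for w
      proof
        assume w: "fst w < fst z \<and> snd z < snd w"
        then have "s' * (fst w - fst p) < s' * (fst z - fst p)" using s by simp
        then show False using un2[OF that] w l(3) by linarith
      qed
      show ?thesis
        by (rule upper_left_cornerI[OF subsetD[OF edge2(2) z] _ l(2) y no]) (use l(1) Ep(1) in linarith)
    qed
  qed
  moreover have "closed_segment E p \<noteq> closed_segment p F"
  proof
    assume "closed_segment E p = closed_segment p F"
    then have "F \<in> closed_segment E p" by (metis ends_in_segment(2))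
    then show False using in_closed_segment_iff_on_line[OF Ep] pF by auto
  qed
  ultimately show ?thesis unfolding is_two_edges_def p_def[symmetric] using edge1(1) edge2(1) by simp
qed

end

section \<open>Bivariate polynomials and products over roots\<close>

lemma eval2_add: "eval2 (f + g) x y = eval2 f x y + eval2 g x y"
  and eval2_diff: "eval2 (f - g) x y = eval2 f x y - eval2 g x y"
  and eval2_mult: "eval2 (f * g) x y = eval2 f x y * eval2 g x y"
  and eval2_0: "eval2 0 x y = 0"
  unfolding eval2_def by simp_all

lemma eval2_sum: "eval2 (sum f A) x y = (\<Sum>a\<in>A. eval2 (f a) x y)"
  by (induction A rule: infinite_finite_induct) (auto simp: eval2_add eval2_0)

lemma eval2_monom: "eval2 (monom (monom c i) j) x y = c * x ^ i * y ^ j"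
  unfolding eval2_def by (simp add: poly_monom poly_const_pow)

definition specialize :: "complex \<Rightarrow> complex poly poly \<Rightarrow> complex poly" where
  "specialize x \<phi> = map_poly (\<lambda>c. poly c x) \<phi>"

lemma coeff_specialize: "coeff (specialize x \<phi>) j = poly (coeff \<phi> j) x"
  unfolding specialize_def by (simp add: coeff_map_poly)

lemma degree_specialize: "degree (specialize x \<phi>) \<le> degree \<phi>"
  by (rule degree_le) (auto simp: coeff_specialize coeff_eq_0)

lemma poly_specialize: "poly (specialize x \<phi>) y = eval2 \<phi> x y"
proof -
  have "poly (specialize x \<phi>) y = (\<Sum>j\<le>degree \<phi>. coeff (specialize x \<phi>) j * y ^ j)"
    unfolding poly_altdef
    by (rule sum.mono_neutral_left) (use degree_specialize[of x \<phi>] in \<open>auto simp: coeff_eq_0\<close>)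
  also have "\<dots> = eval2 \<phi> x y"
    unfolding eval2_def poly_altdef[of \<phi>] by (simp add: poly_sum coeff_specialize poly_const_pow mult.commute)
  finally show ?thesis .
qed

lemma eval2_zero_imp_zero:
  assumes "infinite X" "\<And>x. x \<in> X \<Longrightarrow> infinite {y. eval2 f x y = 0}"
  shows "f = 0"
proof -
  have "specialize x f = 0" if "x \<in> X" for x
    using poly_roots_finite[of "specialize x f"] assms(2)[OF that] unfolding poly_specialize by blast
  then have "poly (coeff f j) x = 0" if "x \<in> X" for x j
    using coeff_specialize[of x f j] that by simp
  then have "X \<subseteq> {x. poly (coeff f j) x = 0}" for j by blast
  then have "coeff f j = 0" for j
    using poly_roots_finite[of "coeff f j"] assms(1) finite_subset by blast
  then show ?thesis by (simp add: poly_eq_iff)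
qed

lemma eval2_eqI: "(\<And>x y. eval2 f x y = eval2 g x y) \<Longrightarrow> f = g"
  using eval2_zero_imp_zero[of UNIV "f - g"] by (simp add: eval2_diff infinite_UNIV_char_0)

definition swap_vars :: "complex poly poly \<Rightarrow> complex poly poly" where
  "swap_vars \<phi> = (\<Sum>j\<le>degree \<phi>. \<Sum>i\<le>degree (coeff \<phi> j). monom (monom (coeff (coeff \<phi> j) i) j) i)"

lemma eval2_swap_vars: "eval2 (swap_vars \<phi>) x y = eval2 \<phi> y x"
  unfolding swap_vars_def eval2_altdef[of \<phi>] by (simp add: eval2_sum eval2_monom mult_ac)

lemma coeff_swap_vars: "coeff (coeff (swap_vars \<phi>) i) j = coeff (coeff \<phi> j) i"
proof -
  have "coeff (coeff (swap_vars \<phi>) i) j =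
    (\<Sum>j'\<le>degree \<phi>. \<Sum>i'\<le>degree (coeff \<phi> j'). if i' = i then if j' = j then coeff (coeff \<phi> j') i' else 0 else 0)"
    unfolding swap_vars_def by (simp add: coeff_sum coeff_monom if_distrib[of "\<lambda>p. coeff p j"] if_distribR cong: if_cong)
  also have "\<dots> = (\<Sum>j'\<le>degree \<phi>. if j' = j then coeff (coeff \<phi> j) i else 0)"
  proof (intro sum.cong refl)
    fix j'
    have "(\<Sum>i'\<le>degree (coeff \<phi> j'). if i' = i then if j' = j then coeff (coeff \<phi> j') i' else 0 else 0) =
      (if i \<le> degree (coeff \<phi> j') then if j' = j then coeff (coeff \<phi> j') i else 0 else 0)"
      by (subst sum.delta) auto
    then show "(\<Sum>i'\<le>degree (coeff \<phi> j'). if i' = i then if j' = j then coeff (coeff \<phi> j') i' else 0 else 0) =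
      (if j' = j then coeff (coeff \<phi> j) i else 0)" by (auto simp: coeff_eq_0)
  qed
  also have "\<dots> = coeff (coeff \<phi> j) i" by (subst sum.delta) (auto simp: coeff_eq_0)
  finally show ?thesis .
qed

lemma swap_vars_swap_vars: "swap_vars (swap_vars \<phi>) = \<phi>"
  by (rule eval2_eqI) (simp add: eval2_swap_vars)

lemma swap_vars_mult: "swap_vars (f * g) = swap_vars f * swap_vars g"
  by (rule eval2_eqI) (simp add: eval2_swap_vars eval2_mult)

lemma poly_eq_prod_roots:
  fixes p :: "complex poly"
  assumes "degree p \<le> n" "finite R" "card R = n" "\<And>r. r \<in> R \<Longrightarrow> poly p r = 0"
  shows "p = smult (coeff p n) (\<Prod>r\<in>R. [:- r, 1:])"
proof (rule ccontr)
  let ?q = "\<Prod>r\<in>R. [:- r, 1:]"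
  define h where "h = p - smult (coeff p n) ?q"
  assume "p \<noteq> smult (coeff p n) ?q"
  then have h0: "h \<noteq> 0" unfolding h_def by simp
  have dq: "degree ?q = n" using assms by (subst degree_prod_eq_sum_degree) auto
  have "lead_coeff ?q = 1" by (simp add: lead_coeff_prod)
  then have cq: "coeff ?q n = 1" using dq by simp
  have "degree h \<le> n" unfolding h_def using assms(1) dq by (intro degree_diff_le) (auto intro: order_trans[OF degree_smult_le])
  moreover have "coeff h n = 0" unfolding h_def using cq by simp
  ultimately have dh: "degree h < n \<or> n = 0 \<and> h = 0"
    using h0 by (metis leading_coeff_0_iff le_neq_implies_less)
  have "R \<subseteq> {x. poly h x = 0}"
    unfolding h_def using assms by (auto simp: poly_prod)
  then have "n \<le> card {x. poly h x = 0}" using assms poly_roots_finite[OF h0] card_mono by blast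
  also have "\<dots> \<le> degree h" using card_poly_roots_bound[OF h0] .
  finally show False using dh h0 by auto
qed

lemma poly_factor_proots:
  fixes p :: "complex poly"
  shows "poly p x = lead_coeff p * (\<Prod>r\<in>#proots p. x - r)"
proof -
  have "poly (smult (lead_coeff p) (\<Prod>r\<in>#proots p. [:-r, 1:])) x = lead_coeff p * (\<Prod>r\<in>#proots p. x - r)"
    by (simp add: poly_prod_mset image_mset.compositionality o_def)
  then show ?thesis unfolding complex_poly_decompose_multiset .
qed

text \<open>Both sides are the resultant of \<open>f\<close> and \<open>G\<close>, written as a product over the roots of one or the
other polynomial. The roots of \<open>f\<close> are simple, those of \<open>G\<close> are counted with multiplicity.\<close>

lemma prod_over_roots_swap:
  fixes f G :: "complex poly"
  assumes "degree f = n" "finite T" "card T = n" "\<And>t. t \<in> T \<Longrightarrow> poly f t = 0"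
  shows "lead_coeff f ^ degree G * (\<Prod>t\<in>T. poly G t) =
    lead_coeff G ^ n * (-1) ^ (n * degree G) * (\<Prod>\<rho>\<in>#proots G. poly f \<rho>)"
proof -
  have f: "poly f x = lead_coeff f * (\<Prod>t\<in>T. x - t)" for x
  proof -
    have "f = smult (lead_coeff f) (\<Prod>r\<in>T. [:- r, 1:])"
      using poly_eq_prod_roots[of f n T] assms by simp
    then have "poly f x = poly (smult (lead_coeff f) (\<Prod>r\<in>T. [:- r, 1:])) x" by simp
    then show ?thesis by (simp add: poly_prod)
  qed
  have sw: "(\<Prod>t\<in>T. t - \<rho>) = (-1) ^ n * (\<Prod>t\<in>T. \<rho> - t)" for \<rho>
  proof -
    have "(\<Prod>t\<in>T. t - \<rho>) = (\<Prod>t\<in>T. (-1) * (\<rho> - t))" by (intro prod.cong) auto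
    also have "\<dots> = (-1) ^ n * (\<Prod>t\<in>T. \<rho> - t)" by (simp only: prod.distrib prod_constant assms(3))
    finally show ?thesis .
  qed
  have "(\<Prod>t\<in>T. poly G t) = lead_coeff G ^ n * (\<Prod>t\<in>T. \<Prod>\<rho>\<in>#proots G. t - \<rho>)"
    by (subst poly_factor_proots) (simp add: prod.distrib assms(3))
  also have "(\<Prod>t\<in>T. \<Prod>\<rho>\<in>#M. t - \<rho>) = (\<Prod>\<rho>\<in>#M. \<Prod>t\<in>T. t - \<rho>)" for M :: "complex multiset"
    by (induction M) (auto simp: prod.distrib)
  also have "(\<Prod>\<rho>\<in>#proots G. \<Prod>t\<in>T. t - \<rho>) = (\<Prod>\<rho>\<in>#proots G. (-1) ^ n * (\<Prod>t\<in>T. \<rho> - t))"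
    by (simp only: sw)
  finally have 1: "(\<Prod>t\<in>T. poly G t) = lead_coeff G ^ n * (\<Prod>\<rho>\<in>#proots G. (-1) ^ n * (\<Prod>t\<in>T. \<rho> - t))" .
  have 2: "lead_coeff f ^ size M * (\<Prod>\<rho>\<in>#M. (-1) ^ n * (\<Prod>t\<in>T. \<rho> - t)) = (-1) ^ (n * size M) * (\<Prod>\<rho>\<in>#M. poly f \<rho>)" for M
    by (induction M) (auto simp: f power_add mult_ac)
  show ?thesis unfolding 1 using 2[of "proots G"] by (simp add: size_proots_complex mult_ac)
qed

text \<open>Gaussian elimination: one equation is used to eliminate one unknown.\<close>

lemma homogeneous_system_solution:
  fixes a :: "'i \<Rightarrow> 'j \<Rightarrow> 'a::field"
  assumes "finite J" "finite I" "card J < card I"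
  shows "\<exists>c. (\<exists>i\<in>I. c i \<noteq> 0) \<and> (\<forall>j\<in>J. (\<Sum>i\<in>I. c i * a i j) = 0)"
  using assms
proof (induction J arbitrary: I a rule: finite_induct)
  case empty
  then obtain i where "i \<in> I" by fastforce
  then show ?case by (intro exI[of _ "\<lambda>_. 1"]) auto
next
  case (insert j J)
  show ?case
  proof (cases "\<forall>i\<in>I. a i j = 0")
    case True
    then show ?thesis using insert.IH[of I a] insert.prems insert.hyps by auto
  next
    case False
    then obtain k where k: "k \<in> I" "a k j \<noteq> 0" by auto
    define b where "b i l = a i l - a i j / a k j * a k l" for i l
    have "card J < card (I - {k})" using insert k by (simp add: card_Diff_singleton)
    then obtain c where c: "\<exists>i\<in>I - {k}. c i \<noteq> 0" "\<forall>l\<in>J. (\<Sum>i\<in>I - {k}. c i * b i l) = 0"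
      using insert.IH[of "I - {k}" b] insert.prems by auto
    define s where "s = (\<Sum>i\<in>I - {k}. c i * a i j)"
    define c' where "c' = c(k := - s / a k j)"
    have split: "(\<Sum>i\<in>I. c' i * a i l) = - s / a k j * a k l + (\<Sum>i\<in>I - {k}. c i * a i l)" for l
      using insert.prems(1) k(1) by (subst sum.remove[of _ k]) (auto simp: c'_def intro!: sum.cong)
    have "(\<Sum>i\<in>I. c' i * a i l) = (\<Sum>i\<in>I - {k}. c i * b i l)" for l
      unfolding split b_def s_def
      by (simp add: algebra_simps sum_subtractf sum_distrib_left sum_distrib_right sum_divide_distrib)
    moreover have "b i j = 0" for i using k(2) unfolding b_def by simp
    ultimately have "\<forall>l\<in>insert j J. (\<Sum>i\<in>I. c' i * a i l) = 0" using c(2) by simp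
    moreover have "\<exists>i\<in>I. c' i \<noteq> 0" using c(1) unfolding c'_def by auto
    ultimately show ?thesis by blast
  qed
qed

section \<open>Fibers of a coordinate function\<close>

text \<open>For coprime \<open>A\<close> and \<open>B\<close> its roots are the parameters that are mapped to \<open>x\<close>.\<close>

definition fiber_poly :: "complex poly \<Rightarrow> complex poly \<Rightarrow> complex \<Rightarrow> complex poly" where
  "fiber_poly A B x = smult x B - A"

lemma poly_fiber_poly: "poly (fiber_poly A B x) t = x * poly B t - poly A t"
  and coeff_fiber_poly: "coeff (fiber_poly A B x) n = x * coeff B n - coeff A n"
  unfolding fiber_poly_def by simp_all

definition ratio :: "complex poly \<Rightarrow> complex poly \<Rightarrow> complex \<Rightarrow> complex" where
  "ratio A B t = poly A t / poly B t"

text \<open>As a function of \<open>x\<close>, this is up to a constant factor the resultant of \<open>fiber_poly A B x\<close>, taken as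
a polynomial of formal degree \<open>n\<close>, with \<open>G\<close>, taken as a polynomial of formal degree \<open>k\<close>. The second factor
accounts for the roots of \<open>G\<close> at infinity.\<close>

definition endpoly :: "complex poly \<Rightarrow> complex poly \<Rightarrow> nat \<Rightarrow> complex poly \<Rightarrow> nat \<Rightarrow> complex poly" where
  "endpoly A B n G k = (\<Prod>\<rho>\<in>#proots G. [:- poly A \<rho>, poly B \<rho>:]) * [:- coeff A n, coeff B n:] ^ (k - degree G)"

lemma poly_endpoly:
  "poly (endpoly A B n G k) x = (\<Prod>\<rho>\<in>#proots G. poly (fiber_poly A B x) \<rho>) * coeff (fiber_poly A B x) n ^ (k - degree G)"
  unfolding endpoly_def
  by (simp add: poly_prod_mset image_mset.compositionality o_def poly_fiber_poly coeff_fiber_poly mult.commute add.commute)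

lemma proots_eq_mset_set:
  fixes p :: "complex poly"
  assumes "p \<noteq> 0" "card {x. poly p x = 0} = degree p"
  shows "proots p = mset_set {x. poly p x = 0}"
proof -
  have f: "finite {x. poly p x = 0}" using poly_roots_finite assms(1) by blast
  have "mset_set {x. poly p x = 0} \<subseteq># proots p"
  proof (rule mset_subset_eqI)
    fix a show "count (mset_set {x. poly p x = 0}) a \<le> count (proots p) a"
      using f assms(1) order_root[of p a] by (cases "poly p a = 0") (auto simp: count_mset_set)
  qed
  moreover have "size (proots p) \<le> size (mset_set {x. poly p x = 0})"
    using assms f by (simp add: size_proots_complex)
  ultimately show ?thesis by (metis mset_subset_size nless_le not_le subset_mset.nless_le)
qed

lemma card_roots_squarefree:
  fixes p :: "complex poly"
  assumes "p \<noteq> 0" "\<And>x. poly p x = 0 \<Longrightarrow> poly (pderiv p) x \<noteq> 0"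
  shows "card {x. poly p x = 0} = degree p"
proof -
  have "rsquarefree p" unfolding rsquarefree_roots using assms(2) by blast
  then have o: "order a p = 1" if "poly p a = 0" for a
    using that assms(1) order_root[of p a] unfolding rsquarefree_def by (metis One_nat_def)
  have "degree p = size (proots p)" by (simp add: size_proots_complex)
  also have "\<dots> = (\<Sum>a\<in>set_mset (proots p). count (proots p) a)" by (simp add: size_multiset_overloaded_eq)
  also have "\<dots> = (\<Sum>a | poly p a = 0. 1)" using assms(1) o by (intro sum.cong) auto
  finally show ?thesis by simp
qed

locale rational_curve =
  fixes P Q :: "nat \<Rightarrow> complex poly" and \<phi> :: "complex poly poly"
  assumes cop: "\<And>i. i < 2 \<Longrightarrow> coprime (P i) (Q i)" and nz: "\<And>i. i < 2 \<Longrightarrow> P i \<noteq> 0" "\<And>i. i < 2 \<Longrightarrow> Q i \<noteq> 0"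
    and nonconst: "\<And>i. i < 2 \<Longrightarrow> 0 < max (degree (P i)) (degree (Q i))"
    and deg1: "has_param_degree P Q 1" and impl: "is_implicit_equation P Q \<phi>"
begin

definition coord_degree :: "nat \<Rightarrow> nat" where "coord_degree i = max (degree (P i)) (degree (Q i))"

lemma coord_degree_pos: "0 < coord_degree 0" "0 < coord_degree 1"
  using nonconst[of 0] nonconst[of 1] unfolding coord_degree_def by simp_all

lemma param_point_ratio: "param_point P Q t = (ratio (P 0) (Q 0) t, ratio (P 1) (Q 1) t)"
  unfolding param_point_def ratio_def ..

text \<open>Polynomials of degree at most \<open>M\<close> in \<open>x\<close> and at most \<open>d\<close> in \<open>y\<close> have \<open>(M + 1) (d + 1)\<close> coefficients,
and vanishing on the curve imposes \<open>M d + d m + 1\<close> linear conditions on them.\<close>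

lemma exists_vanishing: "\<exists>f. f \<noteq> 0 \<and> vanishes_on_param P Q f \<and> degree f \<le> coord_degree 0"
proof -
  define d m where "d = coord_degree 0" "m = coord_degree 1"
  \<comment> \<open>With this \<open>M\<close> there are \<open>d > 0\<close> more coefficients than conditions.\<close>
  define M where "M = d * m"
  define G where "G = (\<lambda>(i, j). P 0 ^ i * Q 0 ^ (M - i) * (P 1 ^ j * Q 1 ^ (d - j)))"
  let ?I = "{..M} \<times> {..d}" and ?J = "{..M * d + d * m}"
  have dle: "degree (P 0) \<le> d" "degree (Q 0) \<le> d" "degree (P 1) \<le> m" "degree (Q 1) \<le> m"
    unfolding d_m_def coord_degree_def by auto
  have pw: "degree (p ^ k) \<le> n * k" if "degree p \<le> n" for p :: "complex poly" and k n
    using degree_power_le[of p k] that by (meson le_trans mult_le_mono1)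
  have dG: "degree (G z) \<le> M * d + d * m" if z: "z \<in> ?I" for z
  proof -
    obtain i j where ij: "z = (i, j)" "i \<le> M" "j \<le> d" using z by auto
    have "degree (P 0 ^ i * Q 0 ^ (M - i)) \<le> d * i + d * (M - i)"
      using pw dle by (meson add_mono degree_mult_le le_trans)
    also have "\<dots> = M * d" using ij by (simp only: distrib_left[symmetric]) simp
    finally have 1: "degree (P 0 ^ i * Q 0 ^ (M - i)) \<le> M * d" .
    have "degree (P 1 ^ j * Q 1 ^ (d - j)) \<le> m * j + m * (d - j)"
      using pw dle by (meson add_mono degree_mult_le le_trans)
    also have "\<dots> = d * m" using ij by (simp only: distrib_left[symmetric]) simp
    finally have 2: "degree (P 1 ^ j * Q 1 ^ (d - j)) \<le> d * m" .
    show ?thesis unfolding ij G_def prod.case by (rule order_trans[OF degree_mult_le add_mono[OF 1 2]])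
  qed
  have "card ?J < card ?I" using coord_degree_pos unfolding M_def d_m_def by (simp add: algebra_simps)
  then obtain c where c: "\<exists>z\<in>?I. c z \<noteq> 0" "\<forall>k\<in>?J. (\<Sum>z\<in>?I. c z * coeff (G z) k) = 0"
    using homogeneous_system_solution[of ?J ?I "\<lambda>z k. coeff (G z) k"] by auto
  have z0: "(\<Sum>z\<in>?I. smult (c z) (G z)) = 0"
  proof (rule poly_eqI)
    fix k
    show "coeff (\<Sum>z\<in>?I. smult (c z) (G z)) k = coeff 0 k"
    proof (cases "k \<in> ?J")
      case True then show ?thesis using c(2) by (simp add: coeff_sum)
    next
      case False
      have "coeff (G z) k = 0" if "z \<in> ?I" for z using dG[OF that] False by (intro coeff_eq_0) auto
      then show ?thesis by (simp add: coeff_sum)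
    qed
  qed
  define f where "f = (\<Sum>z\<in>?I. monom (monom (c z) (fst z)) (snd z))"
  have cf: "coeff (coeff f j) i = (if (i, j) \<in> ?I then c (i, j) else 0)" for i j
  proof -
    have "coeff (coeff f j) i = (\<Sum>z\<in>?I. if z = (i, j) then c z else 0)"
      unfolding f_def coeff_sum coeff_monom if_distrib[of "\<lambda>p. coeff p i"] coeff_0
      by (intro sum.cong) (auto simp: prod_eq_iff)
    also have "\<dots> = (if (i, j) \<in> ?I then c (i, j) else 0)" by (subst sum.delta) auto
    finally show ?thesis .
  qed
  have "f \<noteq> 0"
  proof
    assume "f = 0"
    then have "c (i, j) = 0" if "(i, j) \<in> ?I" for i j using cf[of j i] that by simp
    then show False using c(1) by auto
  qed
  moreover have "degree f \<le> d"
    by (rule degree_le) (auto simp: cf poly_eq_iff)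
  moreover have "vanishes_on_param P Q f"
    unfolding vanishes_on_param_def param_point_ratio fst_conv snd_conv
  proof
    fix t assume "t \<in> param_domain Q"
    then have q: "poly (Q 0) t \<noteq> 0" "poly (Q 1) t \<noteq> 0" unfolding param_domain_def by auto
    let ?x = "ratio (P 0) (Q 0) t" and ?y = "ratio (P 1) (Q 1) t"
    have "eval2 f ?x ?y * (poly (Q 0) t ^ M * poly (Q 1) t ^ d) = (\<Sum>z\<in>?I. c z * poly (G z) t)"
      unfolding f_def eval2_sum eval2_monom sum_distrib_right
    proof (intro sum.cong refl)
      fix z assume "z \<in> ?I"
      then obtain i j where ij: "z = (i, j)" "i \<le> M" "j \<le> d" by auto
      have "poly (Q 0) t ^ M = poly (Q 0) t ^ i * poly (Q 0) t ^ (M - i)" "poly (Q 1) t ^ d = poly (Q 1) t ^ j * poly (Q 1) t ^ (d - j)"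
        using ij by (simp_all add: power_add[symmetric])
      then show "c z * ?x ^ fst z * ?y ^ snd z * (poly (Q 0) t ^ M * poly (Q 1) t ^ d) = c z * poly (G z) t"
        unfolding ij(1) G_def ratio_def using q by (simp add: power_divide field_simps)
    qed
    also have "\<dots> = poly (\<Sum>z\<in>?I. smult (c z) (G z)) t" by (simp add: poly_sum)
    finally show "eval2 f ?x ?y = 0" using q unfolding z0 by simp
  qed
  ultimately show ?thesis unfolding d_m_def by blast
qed

lemma implicit_equation_props: "\<phi> \<noteq> 0" "degree \<phi> \<le> coord_degree 0" "vanishes_on_param P Q \<phi>"
proof -
  obtain f where f: "f \<noteq> 0" "vanishes_on_param P Q f" "degree f \<le> coord_degree 0" using exists_vanishing by blast
  then obtain g where g: "f = \<phi> * g" using impl unfolding is_implicit_equation_def by blast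
  then show "\<phi> \<noteq> 0" using f by auto
  show "degree \<phi> \<le> coord_degree 0" using f g by (metis degree_mult_right_le le_trans mult_zero_right)
  have "\<phi> \<in> {\<phi> * g |g. True}" by (metis (mono_tags, lifting) mem_Collect_eq mult.right_neutral)
  then show "vanishes_on_param P Q \<phi>" using impl unfolding is_implicit_equation_def by blast
qed

lemma eval2_phi_zero: "t \<in> param_domain Q \<Longrightarrow> eval2 \<phi> (ratio (P 0) (Q 0) t) (ratio (P 1) (Q 1) t) = 0"
  using implicit_equation_props(3) unfolding vanishes_on_param_def param_point_ratio by simp

definition roots :: "complex \<Rightarrow> complex set" where "roots x = {t. poly (fiber_poly (P 0) (Q 0) x) t = 0}"

text \<open>Over such a value the fiber consists of simple roots and is mapped injectively to the curve, so that
it accounts for all zeros of \<open>\<phi>(x, y)\<close> as a polynomial in \<open>y\<close>.\<close>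

definition generic_value :: "complex \<Rightarrow> bool" where
  "generic_value x \<longleftrightarrow> degree (fiber_poly (P 0) (Q 0) x) = coord_degree 0 \<and> card (roots x) = coord_degree 0 \<and> roots x \<subseteq> param_domain Q \<and>
     inj_on (ratio (P 1) (Q 1)) (roots x)"

lemma ratio_of_root: "t \<in> roots x \<Longrightarrow> poly (Q 0) t \<noteq> 0 \<and> ratio (P 0) (Q 0) t = x"
proof -
  assume t: "t \<in> roots x"
  then have e: "poly (P 0) t = x * poly (Q 0) t" unfolding roots_def poly_fiber_poly by simp
  then have "poly (Q 0) t \<noteq> 0" using coprime_poly_0[OF cop[of 0], of t] by auto
  then show ?thesis unfolding ratio_def e by simp
qed

text \<open>Otherwise the two products agree. But a zero of \<open>Q 0\<close> has a smaller order in \<open>P 0 * pderiv (Q 0)\<close> than in \<open>pderiv (P 0) * Q 0\<close>; and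
without such zeros, \<open>Q 0\<close> and then also \<open>P 0\<close> would be constant.\<close>

lemma wronskian_nonzero: "pderiv (P 0) * Q 0 - P 0 * pderiv (Q 0) \<noteq> 0"
proof
  assume "pderiv (P 0) * Q 0 - P 0 * pderiv (Q 0) = 0"
  then have w: "pderiv (P 0) * Q 0 = P 0 * pderiv (Q 0)" by simp
  have noroot: "poly (Q 0) t \<noteq> 0" for t
  proof
    assume t: "poly (Q 0) t = 0"
    have Q': "pderiv (Q 0) \<noteq> 0"
    proof
      assume "pderiv (Q 0) = 0"
      then obtain c where "Q 0 = [:c:]" using pderiv_iszero by blast
      then show False using t nz(2)[of 0] by simp
    qed
    have o: "order t (Q 0) = Suc (order t (pderiv (Q 0)))"
      using order_pderiv[of "Q 0" t] t nz(2)[of 0] by (simp add: order_root)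
    have n: "P 0 * pderiv (Q 0) \<noteq> 0" using Q' nz(1)[of 0] by simp
    have "order t (P 0) = 0" using coprime_poly_0[OF cop[of 0], of t] t by (simp add: order_0I)
    then have "order t (P 0 * pderiv (Q 0)) = order t (pderiv (Q 0))" using order_mult[OF n] by simp
    moreover have "order t (pderiv (P 0) * Q 0) \<ge> order t (Q 0)" using order_mult[of "pderiv (P 0)" "Q 0"] n w by simp
    ultimately show False using o w by simp
  qed
  then have "degree (Q 0) = 0" using alg_closed_imp_poly_has_root[of "Q 0"] by blast
  moreover from this have "pderiv (Q 0) = 0" by (simp add: pderiv_eq_0_iff)
  ultimately have "degree (Q 0) = 0" "pderiv (P 0) = 0" using w nz(2)[of 0] by auto
  then have "degree (Q 0) = 0" "degree (P 0) = 0" by (auto simp: pderiv_eq_0_iff)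
  then show False using nonconst[of 0] by simp
qed

text \<open>A value is generic unless it is attained at a zero of \<open>Q 1\<close>, at a critical point of the map \<open>x\<close>
(a zero of the Wronskian) or at a parameter where the parameterization is not injective, or the
leading coefficient of the fiber polynomial vanishes.\<close>

lemma finite_nongeneric_values: "finite {x. \<not> generic_value x}"
proof -
  let ?W = "pderiv (P 0) * Q 0 - P 0 * pderiv (Q 0)"
  \<comment> \<open>The parameters that must not occur in the fiber over a generic value.\<close>
  define B where "B = {t. poly (Q 1) t = 0} \<union> {t. poly ?W t = 0} \<union>
    {t \<in> param_domain Q. card {s \<in> param_domain Q. param_point P Q s = param_point P Q t} \<noteq> 1}"
  have fB: "finite B"
    unfolding B_def using deg1 poly_roots_finite[OF nz(2)[of 1]] poly_roots_finite[OF wronskian_nonzero]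
    unfolding has_param_degree_def by auto
  have lc: "[:- coeff (P 0) (coord_degree 0), coeff (Q 0) (coord_degree 0):] \<noteq> 0"
    using nz(1)[of 0] nz(2)[of 0] unfolding coord_degree_def by (auto simp: max_def)
  have "x \<in> ratio (P 0) (Q 0) ` B \<union> {x. poly [:- coeff (P 0) (coord_degree 0), coeff (Q 0) (coord_degree 0):] x = 0}" if "\<not> generic_value x" for x
  proof (rule ccontr)
    assume n: "x \<notin> ratio (P 0) (Q 0) ` B \<union> {x. poly [:- coeff (P 0) (coord_degree 0), coeff (Q 0) (coord_degree 0):] x = 0}"
    let ?f = "fiber_poly (P 0) (Q 0) x"
    have "coeff ?f (coord_degree 0) \<noteq> 0" using n by (simp add: coeff_fiber_poly)
    moreover have "degree ?f \<le> coord_degree 0" unfolding fiber_poly_def coord_degree_def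
      by (intro degree_diff_le) (auto intro: order_trans[OF degree_smult_le])
    ultimately have d: "degree ?f = coord_degree 0" by (meson le_antisym le_degree)
    then have f0: "?f \<noteq> 0" using coord_degree_pos by auto
    have nB: "t \<notin> B" if "t \<in> roots x" for t using n ratio_of_root[OF that] by auto
    have "poly (pderiv ?f) t \<noteq> 0" if "poly ?f t = 0" for t
    proof
      assume "poly (pderiv ?f) t = 0"
      then have "poly (pderiv (P 0)) t = x * poly (pderiv (Q 0)) t" "poly (P 0) t = x * poly (Q 0) t"
        using that by (simp_all add: fiber_poly_def pderiv_diff pderiv_smult)
      then have "poly ?W t = 0" by simp
      then show False using nB[of t] that unfolding B_def roots_def by auto
    qed
    then have c: "card (roots x) = coord_degree 0" unfolding roots_def using card_roots_squarefree[OF f0] d by simp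
    have dom: "roots x \<subseteq> param_domain Q"
      using nB ratio_of_root unfolding param_domain_def B_def by auto
    have "inj_on (ratio (P 1) (Q 1)) (roots x)"
    proof (rule inj_onI)
      fix s t assume st: "s \<in> roots x" "t \<in> roots x" "ratio (P 1) (Q 1) s = ratio (P 1) (Q 1) t"
      let ?S = "{s \<in> param_domain Q. param_point P Q s = param_point P Q t}"
      have "card ?S = 1" using nB[OF st(2)] dom st(2) unfolding B_def by auto
      then obtain z where "?S = {z}" by (auto simp: card_1_singleton_iff)
      moreover have "s \<in> ?S" "t \<in> ?S" using st dom ratio_of_root unfolding param_point_ratio by auto
      ultimately show "s = t" by (metis singletonD)
    qed
    then show False using that d c dom unfolding generic_value_def by simp
  qed
  then have "{x. \<not> generic_value x} \<subseteq> ratio (P 0) (Q 0) ` B \<union> {x. poly [:- coeff (P 0) (coord_degree 0), coeff (Q 0) (coord_degree 0):] x = 0}" by blast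
  then show ?thesis using fB poly_roots_finite[OF lc] by (meson finite_UnI finite_imageI finite_subset)
qed

lemma finite_roots: "generic_value x \<Longrightarrow> finite (roots x)"
  unfolding generic_value_def using coord_degree_pos(1) by (metis card.infinite less_irrefl)

text \<open>As a polynomial in \<open>y\<close>, \<open>\<phi>(x, y)\<close> has degree at most \<open>coord_degree 0\<close> and this many known zeros.\<close>

lemma eval2_fiber:
  assumes "generic_value x"
  shows "eval2 \<phi> x y = poly (coeff \<phi> (coord_degree 0)) x * (\<Prod>t\<in>roots x. y - ratio (P 1) (Q 1) t)"
proof -
  let ?R = "ratio (P 1) (Q 1) ` roots x"
  have i: "inj_on (ratio (P 1) (Q 1)) (roots x)" using assms unfolding generic_value_def by simp
  have "specialize x \<phi> = smult (coeff (specialize x \<phi>) (coord_degree 0)) (\<Prod>r\<in>?R. [:- r, 1:])"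
  proof (rule poly_eq_prod_roots)
    show "degree (specialize x \<phi>) \<le> coord_degree 0" using degree_specialize implicit_equation_props(2) le_trans by blast
    show "finite ?R" using finite_roots[OF assms] by simp
    show "card ?R = coord_degree 0" using card_image[OF i] assms unfolding generic_value_def by simp
    fix r assume "r \<in> ?R"
    then obtain t where t: "t \<in> roots x" "r = ratio (P 1) (Q 1) t" by auto
    then have "t \<in> param_domain Q" using assms unfolding generic_value_def by auto
    from eval2_phi_zero[OF this] show "poly (specialize x \<phi>) r = 0"
      unfolding poly_specialize using ratio_of_root[OF t(1)] t(2) by simp
  qed
  then have "poly (specialize x \<phi>) y = poly (smult (coeff (specialize x \<phi>) (coord_degree 0)) (\<Prod>r\<in>?R. [:- r, 1:])) y" by simp
  then show ?thesis
    unfolding poly_specialize coeff_specialize using prod.reindex[OF i, of "\<lambda>r. y - r"] by (simp add: poly_prod o_def)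
qed

lemma top_coeff_nonzero: "coeff \<phi> (coord_degree 0) \<noteq> 0"
proof
  assume "coeff \<phi> (coord_degree 0) = 0"
  then have "eval2 \<phi> x y = 0" if "generic_value x" for x y using eval2_fiber[OF that] by simp
  moreover have "infinite {x. generic_value x}" using finite_nongeneric_values by (metis Collect_neg_eq finite_compl infinite_UNIV_char_0)
  ultimately have "\<phi> = 0" using eval2_zero_imp_zero[of "{x. generic_value x}" \<phi>] by (simp add: infinite_UNIV_char_0)
  then show False using implicit_equation_props(1) by simp
qed

lemma prod_over_fiber:
  assumes "generic_value x" "degree G \<le> k"
  shows "coeff (fiber_poly (P 0) (Q 0) x) (coord_degree 0) ^ k * (\<Prod>t\<in>roots x. poly G t) =
    lead_coeff G ^ coord_degree 0 * (-1) ^ (coord_degree 0 * degree G) * poly (endpoly (P 0) (Q 0) (coord_degree 0) G k) x"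
proof -
  let ?f = "fiber_poly (P 0) (Q 0) x"
  have d: "degree ?f = coord_degree 0" "card (roots x) = coord_degree 0" using assms unfolding generic_value_def by auto
  have "coeff ?f (coord_degree 0) ^ k = lead_coeff ?f ^ degree G * coeff ?f (coord_degree 0) ^ (k - degree G)"
    using assms(2) d by (simp add: power_add[symmetric])
  then show ?thesis
    using prod_over_roots_swap[OF d(1) finite_roots[OF assms(1)] d(2), of G] unfolding poly_endpoly
    by (simp add: roots_def mult_ac)
qed

lemma endpoly_nonzero:
  assumes "generic_value x" "\<And>t. poly G t = 0 \<Longrightarrow> t \<notin> roots x" "G \<noteq> 0"
  shows "poly (endpoly (P 0) (Q 0) (coord_degree 0) G k) x \<noteq> 0"
proof -
  have "coeff (fiber_poly (P 0) (Q 0) x) (coord_degree 0) \<noteq> 0"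
    using assms(1) coord_degree_pos(1) unfolding generic_value_def by (metis leading_coeff_0_iff degree_0 less_irrefl)
  moreover have "(\<Prod>\<rho>\<in>#proots G. poly (fiber_poly (P 0) (Q 0) x) \<rho>) \<noteq> 0"
    using assms(2,3) unfolding roots_def by auto
  ultimately show ?thesis unfolding poly_endpoly by simp
qed

end

section \<open>Exchanging the coordinates; extreme coefficients\<close>

text \<open>Exchanging the two coordinates amounts to flipping all indices.\<close>

definition flip :: "(nat \<Rightarrow> 'a) \<Rightarrow> nat \<Rightarrow> 'a" where "flip f i = f (1 - i)"

lemma flip_simps [simp]: "flip f 0 = f 1" "flip f (Suc 0) = f 0"
  unfolding flip_def by simp_all

lemma vanishes_on_param_swap:
  "vanishes_on_param (flip P) (flip Q) f \<longleftrightarrow> vanishes_on_param P Q (swap_vars f)"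
  unfolding vanishes_on_param_def param_domain_def param_point_def by (auto simp: eval2_swap_vars)

lemma is_implicit_equation_swap:
  assumes "is_implicit_equation P Q \<phi>"
  shows "is_implicit_equation (flip P) (flip Q) (swap_vars \<phi>)"
proof -
  have "vanishes_on_param P Q (swap_vars f) \<longleftrightarrow> (\<exists>g. f = swap_vars \<phi> * g)" for f
  proof -
    have "vanishes_on_param P Q (swap_vars f) \<longleftrightarrow> (\<exists>g. swap_vars f = \<phi> * g)"
      using assms unfolding is_implicit_equation_def by (simp add: set_eq_iff)
    also have "\<dots> \<longleftrightarrow> (\<exists>g. f = swap_vars \<phi> * g)"
      by (metis swap_vars_mult swap_vars_swap_vars)
    finally show ?thesis .
  qed
  then show ?thesis unfolding is_implicit_equation_def vanishes_on_param_swap by auto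
qed

lemma has_param_degree_swap:
  assumes "has_param_degree P Q d"
  shows "has_param_degree (flip P) (flip Q) d"
proof -
  have "param_domain (flip Q) = param_domain Q" unfolding param_domain_def by auto
  moreover have "param_point (flip P) (flip Q) s = param_point (flip P) (flip Q) t \<longleftrightarrow>
    param_point P Q s = param_point P Q t" for s t
    unfolding param_point_def by auto
  ultimately show ?thesis using assms unfolding has_param_degree_def by simp
qed

context rational_curve
begin

lemma swap: "rational_curve (flip P) (flip Q) (swap_vars \<phi>)"
proof
  fix i :: nat assume "i < 2"
  then have "1 - i < 2" by simp
  then show "coprime (flip P i) (flip Q i)" "flip P i \<noteq> 0" "flip Q i \<noteq> 0" "0 < max (degree (flip P i)) (degree (flip Q i))"
    unfolding flip_def using cop nz nonconst by blast+
next
  show "has_param_degree (flip P) (flip Q) 1" by (rule has_param_degree_swap[OF deg1])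
  show "is_implicit_equation (flip P) (flip Q) (swap_vars \<phi>)" by (rule is_implicit_equation_swap[OF impl])
qed

abbreviation "sw_roots \<equiv> rational_curve.roots (flip P) (flip Q)"
abbreviation "sw_generic_value \<equiv> rational_curve.generic_value (flip P) (flip Q)"

lemma sw_coord_degree: "rational_curve.coord_degree (flip P) (flip Q) 0 = coord_degree 1"
  "rational_curve.coord_degree (flip P) (flip Q) 1 = coord_degree 0"
proof -
  interpret sw: rational_curve "flip P" "flip Q" "swap_vars \<phi>" by (rule swap)
  show "sw.coord_degree 0 = coord_degree 1" "sw.coord_degree 1 = coord_degree 0" unfolding sw.coord_degree_def coord_degree_def by simp_all
qed

lemma endpoly_denominator_nonzero:
  assumes "generic_value x"
  shows "poly (endpoly (P 0) (Q 0) (coord_degree 0) (Q 1) k) x \<noteq> 0"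
proof (rule endpoly_nonzero[OF assms])
  show "t \<notin> roots x" if "poly (Q 1) t = 0" for t
    using assms that unfolding generic_value_def param_domain_def by auto
qed (use nz(2)[of 1] in simp)

text \<open>The resultant of the fiber polynomials over \<open>x\<close> and over \<open>y\<close>; for generic \<open>x\<close> and \<open>y\<close> it vanishes iff \<open>(x, y)\<close> is a
point of the parameterization.\<close>

definition pairing :: "complex \<Rightarrow> complex \<Rightarrow> complex" where
  "pairing x y = coeff (fiber_poly (P 0) (Q 0) x) (coord_degree 0) ^ coord_degree 1 * (\<Prod>t\<in>roots x. poly (fiber_poly (P 1) (Q 1) y) t)"

end

abbreviation (in rational_curve) "sw_pairing \<equiv> rational_curve.pairing (flip P) (flip Q)"

context rational_curve
begin

lemma eval2_pairing:
  assumes "generic_value x"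
  shows "eval2 \<phi> x y * (lead_coeff (Q 1) ^ coord_degree 0 * (-1) ^ (coord_degree 0 * degree (Q 1)) *
      poly (endpoly (P 0) (Q 0) (coord_degree 0) (Q 1) (coord_degree 1)) x) =
    poly (coeff \<phi> (coord_degree 0)) x * pairing x y"
proof -
  have dQ: "degree (Q 1) \<le> coord_degree 1" unfolding coord_degree_def by simp
  have ne: "poly (Q 1) t \<noteq> 0" if "t \<in> roots x" for t
    using assms that unfolding generic_value_def param_domain_def by auto
  have "(\<Prod>t\<in>roots x. y - ratio (P 1) (Q 1) t) * (\<Prod>t\<in>roots x. poly (Q 1) t) = (\<Prod>t\<in>roots x. poly (fiber_poly (P 1) (Q 1) y) t)"
    unfolding prod.distrib[symmetric] poly_fiber_poly ratio_def using ne
    by (intro prod.cong) (auto simp: field_simps)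
  then show ?thesis
    unfolding eval2_fiber[OF assms] prod_over_fiber[OF assms dQ, symmetric] pairing_def
    by (simp add: algebra_simps)
qed

lemma pairing_symmetric:
  assumes "generic_value x" "sw_generic_value y"
  shows "pairing x y = (-1) ^ (coord_degree 0 * coord_degree 1) * sw_pairing y x"
proof -
  interpret sw: rational_curve "flip P" "flip Q" "swap_vars \<phi>" by (rule swap)
  let ?f = "fiber_poly (P 0) (Q 0) x" and ?g = "fiber_poly (P 1) (Q 1) y"
  have g: "degree ?g = coord_degree 1" "card (sw.roots y) = coord_degree 1"
    using assms(2) unfolding sw.generic_value_def sw_coord_degree by simp_all
  have sr: "sw.roots y = {t. poly ?g t = 0}" unfolding sw.roots_def by simp
  have g0: "?g \<noteq> 0" using g(1) coord_degree_pos(2) by auto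
  have f: "degree ?f = coord_degree 0" "card (roots x) = coord_degree 0" using assms(1) unfolding generic_value_def by auto
  have pr: "proots ?g = mset_set (sw.roots y)"
    unfolding sr by (rule proots_eq_mset_set[OF g0]) (use g sr in simp)
  have "pairing x y = lead_coeff ?g ^ coord_degree 0 * (-1) ^ (coord_degree 0 * coord_degree 1) * (\<Prod>s\<in>sw.roots y. poly ?f s)"
    unfolding pairing_def
    using prod_over_roots_swap[OF f(1) finite_roots[OF assms(1)] f(2), of ?g] f(1) g(1) pr
    by (simp add: roots_def prod_unfold_prod_mset)
  then show ?thesis unfolding sw.pairing_def sw_coord_degree using g(1) by (simp add: mult_ac)
qed

lemma pairing_eq_0:
  assumes "generic_value x" "pairing x y = 0"
  shows "\<exists>t\<in>sw_roots y. x = ratio (P 0) (Q 0) t"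
proof -
  interpret sw: rational_curve "flip P" "flip Q" "swap_vars \<phi>" by (rule swap)
  have "coeff (fiber_poly (P 0) (Q 0) x) (coord_degree 0) \<noteq> 0"
    using assms(1) coord_degree_pos(1) unfolding generic_value_def by (metis leading_coeff_0_iff degree_0 less_irrefl)
  then obtain t where t: "t \<in> roots x" "poly (fiber_poly (P 1) (Q 1) y) t = 0"
    using assms finite_roots[OF assms(1)] unfolding pairing_def by auto
  then show ?thesis using ratio_of_root[OF t(1)] unfolding sw.roots_def by auto
qed

lemma cofinite_eq_poly:
  fixes p q :: "complex poly"
  assumes "finite {x. poly p x \<noteq> poly q x}"
  shows "p = q"
proof -
  have "{x. poly (p - q) x \<noteq> 0} = {x. poly p x \<noteq> poly q x}" by auto
  then have f: "finite {x. poly (p - q) x \<noteq> 0}" using assms by simp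
  show ?thesis
  proof (rule ccontr)
    assume "p \<noteq> q"
    then have "finite {x. poly (p - q) x = 0}" using poly_roots_finite[of "p - q"] by simp
    then have "finite ({x. poly (p - q) x = 0} \<union> {x. poly (p - q) x \<noteq> 0})" using f by blast
    moreover have "{x. poly (p - q) x = 0} \<union> {x. poly (p - q) x \<noteq> 0} = UNIV" by blast
    ultimately show False using infinite_UNIV_char_0 by metis
  qed
qed

text \<open>By \<open>eval2_pairing\<close>, \<open>\<phi>(x, y)\<close> is the resultant \<open>pairing x y\<close> times the quotient of the coefficient of \<open>y ^ d\<close> by
\<open>endpoly\<close>, which depends on \<open>x\<close> only. After exchanging the coordinates, the same factor depends on \<open>y\<close> only. So it is constant.\<close>

theorem top_coeff:
  obtains \<kappa> where "\<kappa> \<noteq> 0" "coeff \<phi> (coord_degree 0) = smult \<kappa> (endpoly (P 0) (Q 0) (coord_degree 0) (Q 1) (coord_degree 1))"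
proof -
  interpret sw: rational_curve "flip P" "flip Q" "swap_vars \<phi>" by (rule swap)
  have "infinite {y. sw.generic_value y}"
    using sw.finite_nongeneric_values by (metis Collect_neg_eq finite_compl infinite_UNIV_char_0)
  then obtain y where y: "sw.generic_value y" using not_finite_existsD by blast
  let ?C = "endpoly (P 0) (Q 0) (coord_degree 0) (Q 1) (coord_degree 1)" and ?B = "endpoly (P 1) (Q 1) (coord_degree 1) (Q 0) (coord_degree 0)"
  define n1 n0 where "n1 = lead_coeff (Q 1) ^ coord_degree 0 * (-1) ^ (coord_degree 0 * degree (Q 1))"
    "n0 = lead_coeff (Q 0) ^ coord_degree 1 * (-1) ^ (coord_degree 1 * degree (Q 0))"
  define b where "b = poly (coeff (swap_vars \<phi>) (coord_degree 1)) y"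
  have B0: "poly ?B y \<noteq> 0" using sw.endpoly_denominator_nonzero[OF y, of "coord_degree 0"] by (simp add: sw_coord_degree)
  have n: "n0 \<noteq> 0" using nz(2)[of 0] unfolding n1_n0_def by simp
  \<comment> \<open>For a fixed generic \<open>y\<close>, the factor is constant in \<open>x\<close> away from the finitely many values \<open>x\<close> over \<open>y\<close>.\<close>
  define \<kappa> where "\<kappa> = n1 * (-1) ^ (coord_degree 0 * coord_degree 1) * b / (n0 * poly ?B y)"
  have eq: "poly (coeff \<phi> (coord_degree 0)) x = poly (smult \<kappa> ?C) x"
    if x: "generic_value x" "x \<notin> ratio (P 0) (Q 0) ` sw.roots y" for x
  proof -
    have D: "pairing x y \<noteq> 0" using pairing_eq_0[OF x(1), of y] x(2) by blast
    have 1: "eval2 \<phi> x y * (n1 * poly ?C x) = poly (coeff \<phi> (coord_degree 0)) x * pairing x y"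
      using eval2_pairing[OF x(1)] unfolding n1_n0_def .
    have 2: "eval2 \<phi> x y * (n0 * poly ?B y) = b * sw.pairing y x"
      using sw.eval2_pairing[OF y, of x] unfolding n1_n0_def b_def by (simp add: sw_coord_degree sw_coord_degree(2)[unfolded One_nat_def] eval2_swap_vars)
    have 3: "pairing x y = (-1) ^ (coord_degree 0 * coord_degree 1) * sw.pairing y x" by (rule pairing_symmetric[OF x(1) y])
    have 4: "sw.pairing y x = (-1) ^ (coord_degree 0 * coord_degree 1) * pairing x y"
      unfolding 3 by (simp add: mult.assoc[symmetric] power_add[symmetric] mult_2[symmetric])
    have "poly (coeff \<phi> (coord_degree 0)) x * pairing x y * (n0 * poly ?B y) = (eval2 \<phi> x y * (n0 * poly ?B y)) * (n1 * poly ?C x)"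
      unfolding 1[symmetric] by (simp add: mult_ac)
    also have "\<dots> = b * (-1) ^ (coord_degree 0 * coord_degree 1) * pairing x y * (n1 * poly ?C x)"
      unfolding 2 4 by (simp add: mult_ac)
    finally have "poly (coeff \<phi> (coord_degree 0)) x * (n0 * poly ?B y) = b * (-1) ^ (coord_degree 0 * coord_degree 1) * (n1 * poly ?C x)"
      using D by (simp add: mult_ac)
    then show ?thesis unfolding \<kappa>_def using n B0 by (simp add: field_simps)
  qed
  have "{x. poly (coeff \<phi> (coord_degree 0)) x \<noteq> poly (smult \<kappa> ?C) x} \<subseteq> {x. \<not> generic_value x} \<union> ratio (P 0) (Q 0) ` sw.roots y"
    using eq by blast
  then have "coeff \<phi> (coord_degree 0) = smult \<kappa> ?C"
    using finite_nongeneric_values sw.finite_roots[OF y] by (intro cofinite_eq_poly) (meson finite_UnI finite_imageI finite_subset)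
  moreover from this have "\<kappa> \<noteq> 0" using top_coeff_nonzero by auto
  ultimately show thesis using that by blast
qed

text \<open>Evaluate the factorization \<open>eval2_fiber\<close> at \<open>y = 0\<close> and write the products of \<open>P 1\<close> and \<open>Q 1\<close> over
the fiber as products over the zeros of \<open>P 1\<close> and \<open>Q 1\<close>.\<close>

theorem bottom_coeff:
  obtains \<kappa> where "\<kappa> \<noteq> 0" "coeff \<phi> 0 = smult \<kappa> (endpoly (P 0) (Q 0) (coord_degree 0) (P 1) (coord_degree 1))"
proof -
  obtain \<kappa>' where k': "\<kappa>' \<noteq> 0" "coeff \<phi> (coord_degree 0) = smult \<kappa>' (endpoly (P 0) (Q 0) (coord_degree 0) (Q 1) (coord_degree 1))"
    using top_coeff by blast
  let ?C = "endpoly (P 0) (Q 0) (coord_degree 0) (Q 1) (coord_degree 1)" and ?D = "endpoly (P 0) (Q 0) (coord_degree 0) (P 1) (coord_degree 1)"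
  define nq np where "nq = lead_coeff (Q 1) ^ coord_degree 0 * (-1) ^ (coord_degree 0 * degree (Q 1))"
    "np = lead_coeff (P 1) ^ coord_degree 0 * (-1) ^ (coord_degree 0 * degree (P 1))"
  have n: "nq \<noteq> 0" "np \<noteq> 0" using nz(1)[of 1] nz(2)[of 1] unfolding nq_np_def by simp_all
  define \<kappa> where "\<kappa> = \<kappa>' * (-1) ^ coord_degree 0 * np / nq"
  have eq: "poly (coeff \<phi> 0) x = poly (smult \<kappa> ?D) x" if x: "generic_value x" for x
  proof -
    have ne: "poly (Q 1) t \<noteq> 0" if "t \<in> roots x" for t
      using x that unfolding generic_value_def param_domain_def by auto
    let ?l = "coeff (fiber_poly (P 0) (Q 0) x) (coord_degree 0)"
    have l: "?l ^ coord_degree 1 * (\<Prod>t\<in>roots x. poly (Q 1) t) = nq * poly ?C x" "?l ^ coord_degree 1 * (\<Prod>t\<in>roots x. poly (P 1) t) = np * poly ?D x"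
      unfolding nq_np_def by (rule prod_over_fiber[OF x]; simp add: coord_degree_def)+
    have C0: "poly ?C x \<noteq> 0" by (rule endpoly_denominator_nonzero[OF x])
    have "poly (coeff \<phi> 0) x = eval2 \<phi> x 0"
      unfolding poly_specialize[symmetric] coeff_specialize[symmetric] by (simp add: poly_0_coeff_0)
    also have "\<dots> = \<kappa>' * poly ?C x * (\<Prod>t\<in>roots x. 0 - ratio (P 1) (Q 1) t)"
      unfolding eval2_fiber[OF x] k'(2) by simp
    also have "(\<Prod>t\<in>roots x. 0 - ratio (P 1) (Q 1) t) = (\<Prod>t\<in>roots x. (-1) * (poly (P 1) t / poly (Q 1) t))"
      unfolding ratio_def by simp
    also have "\<dots> = (-1) ^ coord_degree 0 * ((\<Prod>t\<in>roots x. poly (P 1) t) / (\<Prod>t\<in>roots x. poly (Q 1) t))"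
      unfolding prod.distrib prod_constant prod_dividef using x unfolding generic_value_def by simp
    finally have e: "poly (coeff \<phi> 0) x * (\<Prod>t\<in>roots x. poly (Q 1) t) = \<kappa>' * poly ?C x * (-1) ^ coord_degree 0 * (\<Prod>t\<in>roots x. poly (P 1) t)"
      using ne finite_roots[OF x] by (simp add: field_simps)
    have "poly (coeff \<phi> 0) x * (nq * poly ?C x) = ?l ^ coord_degree 1 * (poly (coeff \<phi> 0) x * (\<Prod>t\<in>roots x. poly (Q 1) t))"
      unfolding l(1)[symmetric] by (simp add: mult_ac)
    also have "\<dots> = \<kappa>' * poly ?C x * (-1) ^ coord_degree 0 * (np * poly ?D x)"
      unfolding e l(2)[symmetric] by (simp add: mult_ac)
    finally have "poly (coeff \<phi> 0) x * nq = \<kappa>' * (-1) ^ coord_degree 0 * (np * poly ?D x)" using C0 by (simp add: mult_ac)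
    then show ?thesis unfolding \<kappa>_def using n by (simp add: field_simps)
  qed
  have "coeff \<phi> 0 = smult \<kappa> ?D"
    by (rule cofinite_eq_poly, rule finite_subset[OF _ finite_nongeneric_values]) (use eq in blast)
  moreover have "\<kappa> \<noteq> 0" unfolding \<kappa>_def using k' n by simp
  ultimately show thesis using that by blast
qed

lemma zero_over_generic_value_is_param:
  assumes "generic_value x" "eval2 \<phi> x y = 0"
  shows "\<exists>t\<in>param_domain Q. ratio (P 0) (Q 0) t = x \<and> ratio (P 1) (Q 1) t = y"
proof -
  obtain \<kappa> where k: "\<kappa> \<noteq> 0" "coeff \<phi> (coord_degree 0) = smult \<kappa> (endpoly (P 0) (Q 0) (coord_degree 0) (Q 1) (coord_degree 1))"
    using top_coeff by blast
  have "poly (coeff \<phi> (coord_degree 0)) x \<noteq> 0" unfolding k(2) using k(1) endpoly_denominator_nonzero[OF assms(1)] by simp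
  then obtain t where "t \<in> roots x" "y = ratio (P 1) (Q 1) t"
    using assms(2) finite_roots[OF assms(1)] unfolding eval2_fiber[OF assms(1)] by auto
  then show ?thesis using ratio_of_root assms(1) unfolding generic_value_def by blast
qed

end

section \<open>Continuity of roots and orders of magnitude\<close>

lemma prod_mset_norm_nonneg: "0 \<le> (\<Prod>r\<in>#M. norm (f r :: complex))"
  by (induction M) auto

lemma norm_prod_mset: "norm (\<Prod>r\<in>#M. f r :: complex) = (\<Prod>r\<in>#M. norm (f r))"
  by (induction M) (auto simp: norm_mult)

text \<open>If all roots of \<open>F n\<close> have distance at least \<open>\<epsilon>\<close> from \<open>\<beta>0\<close>, then \<open>F n\<close> grows at most by a fixed factor
from \<open>\<beta>0\<close> to any other point \<open>\<beta>\<close>. As \<open>F n \<beta>0\<close> tends to 0, this would make the limit vanish everywhere.\<close>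

lemma roots_near_limit_root:
  fixes F :: "nat \<Rightarrow> complex poly" and H :: "complex poly"
  assumes deg: "\<And>n. degree (F n) \<le> D" and lim: "\<And>\<beta>. (\<lambda>n. poly (F n) \<beta>) \<longlonglongrightarrow> poly H \<beta>"
    and H: "H \<noteq> 0" "poly H \<beta>0 = 0" and e: "0 < \<epsilon>"
  shows "\<forall>\<^sub>F n in sequentially. \<exists>\<beta>\<in>ball \<beta>0 \<epsilon>. poly (F n) \<beta> = 0"
proof -
  \<comment> \<open>A point where the limit does not vanish, to be compared with \<open>\<beta>0\<close>.\<close>
  obtain \<beta> where b: "poly H \<beta> \<noteq> 0" using H(1) by (metis poly_all_0_iff_0)
  define c where "c = (1 + norm (\<beta> - \<beta>0) / \<epsilon>) ^ D"
  have c1: "1 + norm (\<beta> - \<beta>0) / \<epsilon> \<ge> 1" using e by simp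
  have bound: "norm (poly (F n) \<beta>) \<le> norm (poly (F n) \<beta>0) * c" if no: "\<not> (\<exists>\<beta>\<in>ball \<beta>0 \<epsilon>. poly (F n) \<beta> = 0)" for n
  proof -
    have "\<beta>0 \<in> ball \<beta>0 \<epsilon>" using e by simp
    then have F0: "F n \<noteq> 0" using no by fastforce
    have "norm (\<beta> - r) \<le> norm (\<beta>0 - r) * (1 + norm (\<beta> - \<beta>0) / \<epsilon>)" if "r \<in># proots (F n)" for r
    proof -
      have "poly (F n) r = 0" using that F0 by simp
      then have "\<epsilon> \<le> norm (\<beta>0 - r)" using no by (metis dist_norm linorder_not_le mem_ball)
      then have "norm (\<beta> - \<beta>0) \<le> norm (\<beta>0 - r) * (norm (\<beta> - \<beta>0) / \<epsilon>)"
        using e by (simp add: field_simps mult_right_mono)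
      moreover have "norm (\<beta> - r) \<le> norm (\<beta> - \<beta>0) + norm (\<beta>0 - r)"
        using norm_triangle_ineq[of "\<beta> - \<beta>0" "\<beta>0 - r"] by simp
      ultimately show ?thesis by (simp add: algebra_simps)
    qed
    then have "(\<Prod>r\<in>#M. norm (\<beta> - r)) \<le> (\<Prod>r\<in>#M. norm (\<beta>0 - r)) * (1 + norm (\<beta> - \<beta>0) / \<epsilon>) ^ size M" if "M \<subseteq># proots (F n)" for M
      using that
    proof (induction M)
      case (add r M)
      have r: "r \<in># proots (F n)" "M \<subseteq># proots (F n)" using add.prems mset_subset_eq_insertD by (metis, meson mset_subset_eq_insertD subset_mset.less_imp_le)
      have "norm (\<beta> - r) * (\<Prod>r\<in>#M. norm (\<beta> - r)) \<le> (norm (\<beta>0 - r) * (1 + norm (\<beta> - \<beta>0) / \<epsilon>)) * ((\<Prod>r\<in>#M. norm (\<beta>0 - r)) * (1 + norm (\<beta> - \<beta>0) / \<epsilon>) ^ size M)"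
        using add.IH add.prems r c1 by (intro mult_mono) (auto intro!: mult_nonneg_nonneg prod_mset_norm_nonneg)
      then show ?case by (simp add: mult_ac)
    qed simp
    from this[of "proots (F n)"] have "norm (poly (F n) \<beta>) \<le> norm (poly (F n) \<beta>0) * (1 + norm (\<beta> - \<beta>0) / \<epsilon>) ^ degree (F n)"
      unfolding poly_factor_proots[of "F n"]
      by (simp add: norm_mult size_proots_complex mult.assoc mult_left_mono norm_prod_mset)
    also have "\<dots> \<le> norm (poly (F n) \<beta>0) * c"
      unfolding c_def using c1 deg by (intro mult_left_mono power_increasing) auto
    finally show ?thesis .
  qed
  have "(\<lambda>n. norm (poly (F n) \<beta>0) * c) \<longlonglongrightarrow> norm (poly H \<beta>0) * c" by (intro tendsto_intros lim)
  then have "(\<lambda>n. norm (poly (F n) \<beta>0) * c) \<longlonglongrightarrow> 0" using H(2) by simp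
  moreover have "(\<lambda>n. norm (poly (F n) \<beta>)) \<longlonglongrightarrow> norm (poly H \<beta>)" by (intro tendsto_intros lim)
  ultimately have "(\<lambda>n. norm (poly (F n) \<beta>) - norm (poly (F n) \<beta>0) * c) \<longlonglongrightarrow> norm (poly H \<beta>) - 0" by (intro tendsto_diff)
  then have "\<forall>\<^sub>F n in sequentially. norm (poly (F n) \<beta>) - norm (poly (F n) \<beta>0) * c > 0"
    using b by (intro order_tendstoD(1)) auto
  then show ?thesis by eventually_elim (use bound in force)
qed

text \<open>For the absolute values \<open>r\<close> of a local parameter, \<open>r powi a * u\<close> is the size of \<open>x\<close> and \<open>r powi (- b) * v\<close> that of
\<open>y\<close>. If \<open>x\<close> is of size \<open>\<epsilon> ^ p\<close> and \<open>y\<close> of size \<open>\<epsilon> ^ (- q)\<close>, then \<open>x ^ q * y ^ p\<close> is of size 1, and its exponent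
\<open>a q - b p\<close> with respect to \<open>r\<close> must be 0.\<close>

lemma exponent_balance:
  fixes r u v \<epsilon> :: "nat \<Rightarrow> real" and a b :: int and p q :: nat
  assumes r: "\<forall>\<^sub>F n in sequentially. 0 < r n" "r \<longlonglongrightarrow> 0" and uv: "u \<longlonglongrightarrow> u0" "0 < u0" "v \<longlonglongrightarrow> v0" "0 < v0"
    and e: "\<epsilon> \<longlonglongrightarrow> 0" "\<forall>\<^sub>F n in sequentially. \<epsilon> n ^ p = r n powi a * u n"
    and z: "\<forall>\<^sub>F n in sequentially. lo \<le> r n powi (- b) * v n * \<epsilon> n ^ q \<and> r n powi (- b) * v n * \<epsilon> n ^ q \<le> hi"
    and lo: "0 < lo" and p: "0 < p"
  shows "a * int q = b * int p" "0 < a"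
proof -
  have rpow: "(\<lambda>n. r n powi k) \<longlonglongrightarrow> 0" if "0 < k" for k
  proof -
    have z: "(0::real) ^ nat k = 0" using that by simp
    from tendsto_power[OF r(2), of "nat k"] have "(\<lambda>n. r n ^ nat k) \<longlonglongrightarrow> 0" unfolding z .
    then show ?thesis using that by (simp add: power_int_def)
  qed
  show "0 < a"
  proof (rule ccontr)
    assume "\<not> 0 < a"
    then have a: "a = 0 \<or> 0 < - a" by auto
    have z0: "(0::real) ^ p = 0" using p by simp
    from tendsto_power[OF e(1), of p] have ep: "(\<lambda>n. \<epsilon> n ^ p) \<longlonglongrightarrow> 0" unfolding z0 .
    have L: "\<exists>L. (\<lambda>n. r n powi (- a)) \<longlonglongrightarrow> L"
    proof (cases "a = 0")
      case True
      then show ?thesis by (intro exI[of _ 1]) simp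
    next
      case False
      then show ?thesis using a rpow[of "- a"] by blast
    qed
    then obtain L where "(\<lambda>n. r n powi (- a)) \<longlonglongrightarrow> L" by blast
    from tendsto_mult[OF this ep] have "(\<lambda>n. r n powi (- a) * \<epsilon> n ^ p) \<longlonglongrightarrow> 0" by simp
    moreover have "\<forall>\<^sub>F n in sequentially. r n powi (- a) * \<epsilon> n ^ p = u n"
      using r(1) e(2) by eventually_elim (simp add: power_int_minus)
    ultimately have "u \<longlonglongrightarrow> 0" using tendsto_cong by fastforce
    then show False using uv LIMSEQ_unique by fastforce
  qed
  define k where "k = a * int q - b * int p"
  define w where "w n = r n powi (- b) * v n * \<epsilon> n ^ q" for n
  have uvlim: "(\<lambda>n. v n ^ p * u n ^ q) \<longlonglongrightarrow> v0 ^ p * u0 ^ q" by (intro tendsto_intros uv)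
  have uv0: "v0 ^ p * u0 ^ q > 0" using uv by simp
  have wk: "\<forall>\<^sub>F n in sequentially. w n ^ p = r n powi k * (v n ^ p * u n ^ q)"
    using r(1) e(2)
  proof eventually_elim
    case (elim n)
    have "w n ^ p = (r n powi (- b)) ^ p * v n ^ p * (\<epsilon> n ^ p) ^ q"
      unfolding w_def by (simp add: power_mult_distrib power_mult[symmetric] mult.commute)
    also have "\<dots> = r n powi (- b * int p) * v n ^ p * (r n powi (a * int q) * u n ^ q)"
    proof -
      have pw: "x powi (m * int l) = (x powi m) ^ l" for x :: real and m l by (simp add: power_int_mult)
      show ?thesis unfolding elim(2) power_mult_distrib pw by simp
    qed
    also have "\<dots> = r n powi k * (v n ^ p * u n ^ q)"
      unfolding k_def using elim(1) power_int_add[of "r n" "- b * int p" "a * int q"] by (simp add: add.commute)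
    finally show ?case .
  qed
  have wb: "\<forall>\<^sub>F n in sequentially. lo ^ p \<le> w n ^ p \<and> w n ^ p \<le> hi ^ p"
  proof -
    have "\<forall>\<^sub>F n in sequentially. lo \<le> w n \<and> w n \<le> hi" using z unfolding w_def .
    then show ?thesis by eventually_elim (use lo in \<open>auto intro!: power_mono\<close>)
  qed
  have "k = 0"
  proof (rule ccontr)
    assume "k \<noteq> 0"
    then consider "0 < k" | "0 < - k" by linarith
    then show False
    proof cases
      case 1
      from tendsto_mult[OF rpow[OF this] uvlim] have "(\<lambda>n. r n powi k * (v n ^ p * u n ^ q)) \<longlonglongrightarrow> 0" by simp
      then have "(\<lambda>n. w n ^ p) \<longlonglongrightarrow> 0" using wk tendsto_cong by fastforce
      moreover have "\<forall>\<^sub>F n in sequentially. lo ^ p \<le> w n ^ p" using wb by eventually_elim auto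
      ultimately have "lo ^ p \<le> 0" using tendsto_lowerbound by fastforce
      then show False using zero_less_power[OF lo, of p] by linarith
    next
      case 2
      have "(\<lambda>n. hi ^ p * r n powi (- k)) \<longlonglongrightarrow> hi ^ p * 0" by (intro tendsto_intros rpow[OF 2])
      moreover have "\<forall>\<^sub>F n in sequentially. v n ^ p * u n ^ q \<le> hi ^ p * r n powi (- k)"
        using wk wb r(1)
      proof eventually_elim
        case (elim n)
        have "v n ^ p * u n ^ q = w n ^ p * r n powi (- k)"
          using elim(1,3) by (simp add: power_int_minus)
        also have "\<dots> \<le> hi ^ p * r n powi (- k)" using elim(2,3) by (intro mult_right_mono) auto
        finally show ?case .
      qed
      ultimately have "v0 ^ p * u0 ^ q \<le> hi ^ p * 0" using tendsto_le[OF trivial_limit_sequentially _ uvlim] by blast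
      then show False using uv0 by simp
    qed
  qed
  then show "a * int q = b * int p" unfolding k_def by simp
qed

lemma ratio_at_0:
  assumes "A \<noteq> 0" "B \<noteq> 0"
  obtains A' B' where "poly A' 0 \<noteq> 0" "poly B' 0 \<noteq> 0"
    "\<And>t. t \<noteq> 0 \<Longrightarrow> norm (ratio A B t) = norm t powi (int (order 0 A) - int (order 0 B)) * norm (ratio A' B' t)"
proof -
  obtain A' where A': "A = [:-0, 1:] ^ order 0 A * A'" "\<not> [:-0, 1:] dvd A'" using order_decomp[OF assms(1)] by blast
  obtain B' where B': "B = [:-0, 1:] ^ order 0 B * B'" "\<not> [:-0, 1:] dvd B'" using order_decomp[OF assms(2)] by blast
  show thesis
  proof (rule that)
    show "poly A' 0 \<noteq> 0" using A'(2) by (simp add: poly_eq_0_iff_dvd)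
    show "poly B' 0 \<noteq> 0" using B'(2) by (simp add: poly_eq_0_iff_dvd)
    fix t :: complex assume t: "t \<noteq> 0"
    have a: "poly A t = t ^ order 0 A * poly A' t"
      using arg_cong[OF A'(1), of "\<lambda>p. poly p t"] by simp
    have b: "poly B t = t ^ order 0 B * poly B' t"
      using arg_cong[OF B'(1), of "\<lambda>p. poly p t"] by simp
    have "norm t powi (int (order 0 A) - int (order 0 B)) = norm t ^ order 0 A / norm t ^ order 0 B"
      using t by (simp add: power_int_diff)
    then show "norm (ratio A B t) = norm t powi (int (order 0 A) - int (order 0 B)) * norm (ratio A' B' t)"
      unfolding ratio_def a b by (simp add: norm_mult norm_divide norm_power)
  qed
qed

lemma ratio_at_infinity:
  assumes "A \<noteq> 0" "B \<noteq> 0"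
  obtains A' B' where "poly A' 0 \<noteq> 0" "poly B' 0 \<noteq> 0"
    "\<And>t. t \<noteq> 0 \<Longrightarrow> norm (ratio A B t) = norm (inverse t) powi (int (degree B) - int (degree A)) * norm (ratio A' B' (inverse t))"
proof (rule that)
  show "poly (reflect_poly A) 0 \<noteq> 0" "poly (reflect_poly B) 0 \<noteq> 0" using assms by simp_all
  fix t :: complex assume t: "t \<noteq> 0"
  have *: "poly (reflect_poly p) (inverse t) = inverse t ^ degree p * poly p t" for p
    using poly_reflect_poly_nz[of "inverse t" p] t by simp
  have "norm (inverse t) powi (int (degree B) - int (degree A)) = norm (inverse t) ^ degree B / norm (inverse t) ^ degree A"
    using t by (subst power_int_diff) auto
  then show "norm (ratio A B t) = norm (inverse t) powi (int (degree B) - int (degree A)) * norm (ratio (reflect_poly A) (reflect_poly B) (inverse t))"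
    unfolding ratio_def * using t by (simp add: norm_mult norm_divide norm_power norm_inverse field_simps)
qed

lemma tendsto_norm_ratio:
  assumes "poly B 0 \<noteq> 0" "z \<longlonglongrightarrow> 0"
  shows "(\<lambda>n. norm (ratio A B (z n))) \<longlonglongrightarrow> norm (ratio A B 0)"
  unfolding ratio_def using assms by (intro tendsto_intros) auto

section \<open>Edges of the support and branches of the curve\<close>

definition supp :: "complex poly poly \<Rightarrow> (nat \<times> nat) set" where
  "supp \<phi> = {(i, j). coeff (coeff \<phi> j) i \<noteq> 0}"

lemma supp_le:
  assumes "(i, j) \<in> supp \<phi>"
  shows "j \<le> degree \<phi>" "i \<le> degree (coeff \<phi> j)"
proof -
  have "coeff (coeff \<phi> j) i \<noteq> 0" using assms unfolding supp_def by simp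
  then show "i \<le> degree (coeff \<phi> j)" by (rule le_degree)
  have "coeff \<phi> j \<noteq> 0" using \<open>coeff (coeff \<phi> j) i \<noteq> 0\<close> by auto
  then show "j \<le> degree \<phi>" by (rule le_degree)
qed

lemma finite_supp: "finite (supp \<phi>)"
proof (rule finite_subset)
  show "supp \<phi> \<subseteq> (\<lambda>(j, i). (i, j)) ` (SIGMA j:{..degree \<phi>}. {..degree (coeff \<phi> j)})"
    using supp_le by (force simp: image_iff)
qed auto

lemma snd_supp_le: "z \<in> supp \<phi> \<Longrightarrow> snd z \<le> degree \<phi>"
  using supp_le(1)[of "fst z" "snd z"] by simp

lemma eval2_supp: "eval2 \<phi> x y = (\<Sum>z\<in>supp \<phi>. coeff (coeff \<phi> (snd z)) (fst z) * x ^ fst z * y ^ snd z)"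
proof -
  let ?f = "\<Sum>z\<in>supp \<phi>. monom (monom (coeff (coeff \<phi> (snd z)) (fst z)) (fst z)) (snd z)"
  have "coeff (coeff ?f j) i = coeff (coeff \<phi> j) i" for i j
  proof -
    have "coeff (coeff ?f j) i = (\<Sum>z\<in>supp \<phi>. if z = (i, j) then coeff (coeff \<phi> j) i else 0)"
      unfolding coeff_sum coeff_monom if_distrib[of "\<lambda>p. coeff p i"] coeff_0
      by (intro sum.cong) (auto simp: prod_eq_iff)
    also have "\<dots> = coeff (coeff \<phi> j) i" using finite_supp by (subst sum.delta) (auto simp: supp_def)
    finally show ?thesis .
  qed
  then have "\<phi> = ?f" by (simp add: poly_eq_iff)
  then have "eval2 \<phi> x y = eval2 ?f x y" by simp
  then show ?thesis by (simp add: eval2_sum eval2_monom)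
qed

lemma has_nonzero_root:
  fixes H :: "complex poly"
  assumes "coeff H j1 \<noteq> 0" "coeff H j2 \<noteq> 0" "j1 < j2"
  obtains \<beta> where "\<beta> \<noteq> 0" "poly H \<beta> = 0"
proof -
  have H: "H \<noteq> 0" using assms(1) by auto
  have "\<exists>\<beta>. \<beta> \<noteq> 0 \<and> poly H \<beta> = 0"
  proof (rule ccontr)
    assume "\<nexists>\<beta>. \<beta> \<noteq> 0 \<and> poly H \<beta> = 0"
    then have "set_mset (proots H) \<subseteq> {0}" using H by auto
    then have "proots H = replicate_mset (order 0 H) 0"
      using H by (intro multiset_eqI) (auto intro!: order_0I)
    then have "degree H = order 0 H" using size_proots_complex[of H] by simp
    moreover have "[:-0, 1:] ^ order 0 H dvd H" by (rule order_1)
    then have "monom 1 (order 0 H) dvd H" by (simp add: monom_altdef)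
    then have "order 0 H \<le> j1" using assms(1) by (metis linorder_not_le monom_1_dvd_iff' )
    moreover have "j2 \<le> degree H" using assms(2) by (rule le_degree)
    ultimately show False using assms(3) by simp
  qed
  then show thesis using that by blast
qed

lemma LIMSEQ_inverse_Suc: "(\<lambda>n. 1 / real (Suc n)) \<longlonglongrightarrow> 0"
  using LIMSEQ_inverse_real_of_nat by (simp add: inverse_eq_divide)

lemma eventually_avoids_finite:
  fixes B :: "complex set"
  assumes "finite B" "f \<longlonglongrightarrow> 0" "\<And>n. f n \<noteq> 0"
  shows "\<forall>\<^sub>F n in sequentially. f n \<notin> B"
proof -
  have "\<forall>\<^sub>F n in sequentially. f n \<noteq> b" for b
  proof (cases "b = 0")
    case False
    then have "\<forall>\<^sub>F n in sequentially. dist (f n) 0 < norm b" using tendstoD[OF assms(2)] by simp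
    then show ?thesis by eventually_elim auto
  qed (use assms(3) in simp)
  then have "\<forall>\<^sub>F n in sequentially. \<forall>b\<in>B. f n \<noteq> b" using assms(1) by (simp add: eventually_ball_finite)
  then show ?thesis by eventually_elim auto
qed

context rational_curve
begin

text \<open>Put \<open>x = s ^ p\<close> and \<open>y = \<beta> / s ^ q\<close>. Divided by the lowest power of \<open>s\<close>, which is attained exactly by the
support points on the edge, \<open>\<phi>\<close> becomes a polynomial \<open>F s\<close> in \<open>\<beta>\<close> that tends to the edge polynomial \<open>F 0\<close>
as \<open>s\<close> tends to 0. The latter has a nonzero root because the edge has two support points.\<close>

lemma edge_points:
  assumes z: "(i1, j1) \<in> supp \<phi>" "(i2, j2) \<in> supp \<phi>" "i1 < i2" "j1 < j2"
    and edge: "\<And>i j. (i, j) \<in> supp \<phi> \<Longrightarrow> int (i2 - i1) * (int j - int j1) \<le> int (j2 - j1) * (int i - int i1)"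
  obtains lo hi where "0 < lo"
    "\<forall>\<^sub>F n in sequentially. \<exists>t\<in>param_domain Q. ratio (P 0) (Q 0) t = complex_of_real (1 / real (Suc n)) ^ (j2 - j1) \<and>
      lo \<le> norm (ratio (P 1) (Q 1) t) * (1 / real (Suc n)) ^ (i2 - i1) \<and>
      norm (ratio (P 1) (Q 1) t) * (1 / real (Suc n)) ^ (i2 - i1) \<le> hi"
proof -
  define p q where "p = j2 - j1" "q = i2 - i1"
  have pq: "0 < p" "0 < q" "j2 = j1 + p" "i2 = i1 + q" using z unfolding p_q_def by auto
  define d where "d = degree \<phi>"
  \<comment> \<open>The lowest exponent of \<open>s\<close> after multiplication by \<open>s ^ (q * d)\<close>, which avoids negative powers.\<close>
  define M where "M = p * i1 + q * (d - j1)"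
  define e where "e w = p * fst w + q * (d - snd w) - M" for w :: "nat \<times> nat"
  define c where "c w = coeff (coeff \<phi> (snd w)) (fst w)" for w :: "nat \<times> nat"
  define F where "F s = (\<Sum>w\<in>supp \<phi>. monom (c w * s ^ e w) (snd w))" for s
  have jd: "j1 \<le> d" "j2 \<le> d" using snd_supp_le[OF z(1)] snd_supp_le[OF z(2)] unfolding d_def by auto
  have sd: "snd w \<le> d" if "w \<in> supp \<phi>" for w using snd_supp_le[OF that] unfolding d_def .
  have Mle: "M \<le> p * fst w + q * (d - snd w)" if "w \<in> supp \<phi>" for w
  proof -
    have "int q * (int (snd w) - int j1) \<le> int p * (int (fst w) - int i1)"
      using edge[of "fst w" "snd w"] that unfolding p_q_def by simp
    then have "int M \<le> int (p * fst w + q * (d - snd w))"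
      unfolding M_def of_nat_add of_nat_mult of_nat_diff[OF sd[OF that]] of_nat_diff[OF jd(1)] by (simp add: algebra_simps)
    then show ?thesis by (simp only: of_nat_le_iff)
  qed
  have e: "M + e w = p * fst w + q * (d - snd w)" if "w \<in> supp \<phi>" for w
    using Mle[OF that] unfolding e_def by simp
  have eval: "eval2 \<phi> (s ^ p) (\<beta> / s ^ q) * s ^ (q * d) = s ^ M * poly (F s) \<beta>" if "s \<noteq> 0" for s \<beta>
  proof -
    have "c w * (s ^ p) ^ fst w * (\<beta> / s ^ q) ^ snd w * s ^ (q * d) = s ^ M * (c w * s ^ e w * \<beta> ^ snd w)" if w: "w \<in> supp \<phi>" for w
    proof -
      have "q * d = q * snd w + q * (d - snd w)" using sd[OF w] by (simp add: distrib_left[symmetric])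
      then have "(\<beta> / s ^ q) ^ snd w * s ^ (q * d) = \<beta> ^ snd w * s ^ (q * (d - snd w))"
        using \<open>s \<noteq> 0\<close> by (simp add: power_divide power_add power_mult[symmetric])
      then have "c w * (s ^ p) ^ fst w * (\<beta> / s ^ q) ^ snd w * s ^ (q * d) = c w * \<beta> ^ snd w * s ^ (p * fst w + q * (d - snd w))"
        by (simp add: power_add power_mult mult_ac)
      then show ?thesis unfolding e[OF w, symmetric] by (simp add: power_add mult_ac)
    qed
    then show ?thesis unfolding eval2_supp F_def poly_sum poly_monom sum_distrib_right sum_distrib_left c_def[symmetric]
      by (intro sum.cong refl) blast
  qed
  have coeffF: "coeff (F 0) (snd w0) = c w0" if w0: "w0 \<in> supp \<phi>" "e w0 = 0" for w0
  proof -
    have "coeff (F 0) (snd w0) = (\<Sum>w\<in>supp \<phi>. if w = w0 then c w else 0)"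
      unfolding F_def coeff_sum coeff_monom
    proof (intro sum.cong refl)
      fix w assume w: "w \<in> supp \<phi>"
      have "w = w0" if "snd w = snd w0" "e w = 0"
      proof -
        have "p * fst w = p * fst w0" using e[OF w] e[OF w0(1)] that w0(2) by simp
        then show ?thesis using pq(1) that by (simp add: prod_eq_iff)
      qed
      then show "(if snd w = snd w0 then c w * 0 ^ e w else 0) = (if w = w0 then c w else 0)"
        using w0(2) by (auto simp: power_0_left)
    qed
    also have "\<dots> = c w0" using w0(1) finite_supp by (subst sum.delta) auto
    finally show ?thesis .
  qed
  have "e (i1, j1) = 0" "e (i2, j2) = 0"
  proof -
    show "e (i1, j1) = 0" unfolding e_def M_def by simp
    have "d - j1 = (d - j2) + p" using pq jd by simp
    then show "e (i2, j2) = 0" unfolding e_def M_def pq(4) by (simp add: algebra_simps)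
  qed
  then have "coeff (F 0) j1 \<noteq> 0" "coeff (F 0) j2 \<noteq> 0"
    using coeffF[OF z(1)] coeffF[OF z(2)] z(1,2) unfolding c_def supp_def by auto
  then obtain \<beta>0 where b0: "\<beta>0 \<noteq> 0" "poly (F 0) \<beta>0 = 0" using has_nonzero_root z(4) by blast
  have F0: "F 0 \<noteq> 0" using \<open>coeff (F 0) j1 \<noteq> 0\<close> by auto
  define s where "s n = complex_of_real (1 / real (Suc n))" for n
  have s: "s n \<noteq> 0" for n unfolding s_def by (simp del: of_nat_Suc)
  have slim: "s \<longlonglongrightarrow> 0"
    using tendsto_of_real[OF LIMSEQ_inverse_Suc, where ?'a = complex] unfolding s_def[abs_def] of_real_0 .
  have ev: "\<forall>\<^sub>F n in sequentially. \<exists>\<beta>\<in>ball \<beta>0 (norm \<beta>0 / 2). poly (F (s n)) \<beta> = 0"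
  proof (rule roots_near_limit_root[OF _ _ F0 b0(2)])
    show "degree (F (s n)) \<le> d" for n
      unfolding F_def by (intro degree_sum_le finite_supp) (meson degree_monom_le le_trans sd)
    show "(\<lambda>n. poly (F (s n)) \<beta>) \<longlonglongrightarrow> poly (F 0) \<beta>" for \<beta>
      unfolding F_def poly_sum poly_monom by (intro tendsto_intros slim)
    show "0 < norm \<beta>0 / 2" using b0 by simp
  qed
  have "(\<lambda>n. s n ^ p) \<longlonglongrightarrow> 0" using tendsto_power[OF slim, of p] zero_power[OF pq(1)] by metis
  then have ev2: "\<forall>\<^sub>F n in sequentially. s n ^ p \<notin> {x. \<not> generic_value x}"
    using s by (intro eventually_avoids_finite finite_nongeneric_values) auto
  show thesis
  proof (rule that)
    show "0 < norm \<beta>0 / 2" using b0 by simp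
    show "\<forall>\<^sub>F n in sequentially. \<exists>t\<in>param_domain Q. ratio (P 0) (Q 0) t = complex_of_real (1 / real (Suc n)) ^ (j2 - j1) \<and>
      norm \<beta>0 / 2 \<le> norm (ratio (P 1) (Q 1) t) * (1 / real (Suc n)) ^ (i2 - i1) \<and>
      norm (ratio (P 1) (Q 1) t) * (1 / real (Suc n)) ^ (i2 - i1) \<le> 3 / 2 * norm \<beta>0"
      using ev ev2
    proof eventually_elim
      case (elim n)
      then obtain \<beta> where b: "\<beta> \<in> ball \<beta>0 (norm \<beta>0 / 2)" "poly (F (s n)) \<beta> = 0" by blast
      have "eval2 \<phi> (s n ^ p) (\<beta> / s n ^ q) = 0" using eval[OF s, of n \<beta>] b(2) s by simp
      then obtain t where t: "t \<in> param_domain Q" "ratio (P 0) (Q 0) t = s n ^ p" "ratio (P 1) (Q 1) t = \<beta> / s n ^ q"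
        using zero_over_generic_value_is_param elim(2) by blast
      have "norm (s n) = 1 / real (Suc n)" unfolding s_def norm_of_real by simp
      then have "norm (ratio (P 1) (Q 1) t) * (1 / real (Suc n)) ^ q = norm \<beta>"
        unfolding t(3) norm_divide norm_power by (simp del: of_nat_Suc)
      moreover have "norm \<beta>0 / 2 \<le> norm \<beta>" "norm \<beta> \<le> 3 / 2 * norm \<beta>0"
        using b(1) norm_triangle_ineq2[of \<beta>0 \<beta>] norm_triangle_ineq2[of \<beta> \<beta>0] by (auto simp: dist_norm norm_minus_commute)
      ultimately show ?case using t(1,2) unfolding s_def p_q_def by metis
    qed
  qed
qed

text \<open>A branch of the curve with \<open>x\<close> of order \<open>a > 0\<close> and \<open>y\<close> of order \<open>- b\<close> corresponds to edges of
direction \<open>(q, p)\<close> proportional to \<open>(b, a)\<close>.\<close>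

definition edge_order :: "int \<Rightarrow> int \<Rightarrow> nat \<Rightarrow> nat \<Rightarrow> bool" where
  "edge_order a b p q \<longleftrightarrow> 0 < a \<and> a * int q = b * int p"

text \<open>The parameters of the points from \<open>edge_points\<close> have a finite accumulation point, which is a common zero of \<open>P 0\<close> and
\<open>Q 1\<close> and hence 0, or they are unbounded. In each case \<open>exponent_balance\<close> applies to the local
parameter \<open>t\<close>, respectively \<open>1 / t\<close>.\<close>

lemma edge_valuation:
  assumes common: "\<And>t. poly (P 0) t = 0 \<Longrightarrow> poly (Q 1) t = 0 \<Longrightarrow> t = 0"
    and z: "(i1, j1) \<in> supp \<phi>" "(i2, j2) \<in> supp \<phi>" "i1 < i2" "j1 < j2"
    and edge: "\<And>i j. (i, j) \<in> supp \<phi> \<Longrightarrow> int (i2 - i1) * (int j - int j1) \<le> int (j2 - j1) * (int i - int i1)"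
  shows "edge_order (int (order 0 (P 0)) - int (order 0 (Q 0))) (int (order 0 (Q 1)) - int (order 0 (P 1))) (j2 - j1) (i2 - i1) \<or>
    edge_order (int (degree (Q 0)) - int (degree (P 0))) (int (degree (P 1)) - int (degree (Q 1))) (j2 - j1) (i2 - i1)"
proof -
  define p q where "p = j2 - j1" "q = i2 - i1"
  have pq: "0 < p" "0 < q" using z unfolding p_q_def by auto
  define \<epsilon> where "\<epsilon> n = 1 / real (Suc n)" for n
  have epos: "0 < \<epsilon> n" for n unfolding \<epsilon>_def by simp
  have elim: "\<epsilon> \<longlonglongrightarrow> 0" unfolding \<epsilon>_def using LIMSEQ_inverse_Suc .
  obtain lo hi where lo: "0 < lo" and ev: "\<forall>\<^sub>F n in sequentially. \<exists>t\<in>param_domain Q. ratio (P 0) (Q 0) t = complex_of_real (\<epsilon> n) ^ p \<and>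
      lo \<le> norm (ratio (P 1) (Q 1) t) * \<epsilon> n ^ q \<and> norm (ratio (P 1) (Q 1) t) * \<epsilon> n ^ q \<le> hi"
    using edge_points[OF z edge] unfolding p_q_def \<epsilon>_def by blast
  then obtain N where "\<forall>n\<ge>N. \<exists>t\<in>param_domain Q. ratio (P 0) (Q 0) t = complex_of_real (\<epsilon> n) ^ p \<and>
      lo \<le> norm (ratio (P 1) (Q 1) t) * \<epsilon> n ^ q \<and> norm (ratio (P 1) (Q 1) t) * \<epsilon> n ^ q \<le> hi"
    unfolding eventually_sequentially by blast
  then obtain T where T: "\<And>n. n \<ge> N \<Longrightarrow> T n \<in> param_domain Q \<and> ratio (P 0) (Q 0) (T n) = complex_of_real (\<epsilon> n) ^ p \<and>
      lo \<le> norm (ratio (P 1) (Q 1) (T n)) * \<epsilon> n ^ q \<and> norm (ratio (P 1) (Q 1) (T n)) * \<epsilon> n ^ q \<le> hi"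
    by metis
  \<comment> \<open>\<open>Z\<close> is the local parameter at the limit point, \<open>t\<close> or \<open>1 / t\<close>.\<close>
  have local: "edge_order a b p q"
    if h: "strict_mono h" and Z: "(\<lambda>n. Z (T (h n))) \<longlonglongrightarrow> 0" "\<And>t. t \<noteq> 0 \<Longrightarrow> Z t \<noteq> 0" and T0: "\<forall>\<^sub>F n in sequentially. T (h n) \<noteq> 0"
      and A: "poly A 0 \<noteq> 0" "poly B 0 \<noteq> 0" "\<And>t. t \<noteq> 0 \<Longrightarrow> norm (ratio (P 0) (Q 0) t) = norm (Z t) powi a * norm (ratio A B (Z t))"
      and C: "poly C 0 \<noteq> 0" "poly D 0 \<noteq> 0" "\<And>t. t \<noteq> 0 \<Longrightarrow> norm (ratio (P 1) (Q 1) t) = norm (Z t) powi (- b) * norm (ratio C D (Z t))"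
    for h :: "nat \<Rightarrow> nat" and Z :: "complex \<Rightarrow> complex" and A B C D a b
  proof -
    have hN: "\<forall>\<^sub>F n in sequentially. h n \<ge> N"
      using seq_suble[OF h] by (intro eventually_sequentiallyI[of N]) (meson le_trans)
    have 1: "\<forall>\<^sub>F n in sequentially. 0 < norm (Z (T (h n)))" using T0 by eventually_elim (use Z(2) in simp)
    have 2: "(\<lambda>n. norm (Z (T (h n)))) \<longlonglongrightarrow> 0" using tendsto_norm[OF Z(1)] by simp
    have 3: "(\<lambda>n. \<epsilon> (h n)) \<longlonglongrightarrow> 0" using LIMSEQ_subseq_LIMSEQ[OF elim h] by (simp add: o_def)
    have 4: "\<forall>\<^sub>F n in sequentially. \<epsilon> (h n) ^ p = norm (Z (T (h n))) powi a * norm (ratio A B (Z (T (h n))))"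
      using hN T0
    proof eventually_elim
      case (elim n)
      have "\<epsilon> (h n) ^ p = norm (ratio (P 0) (Q 0) (T (h n)))"
        using T[OF elim(1)] epos[of "h n"] by (simp add: norm_power)
      then show ?case using A(3)[OF elim(2)] by simp
    qed
    have 5: "\<forall>\<^sub>F n in sequentially. lo \<le> norm (Z (T (h n))) powi (- b) * norm (ratio C D (Z (T (h n)))) * \<epsilon> (h n) ^ q \<and>
       norm (Z (T (h n))) powi (- b) * norm (ratio C D (Z (T (h n)))) * \<epsilon> (h n) ^ q \<le> hi"
      using hN T0 by eventually_elim (use T C(3) in metis)
    have 6: "norm (ratio A B 0) > 0" "norm (ratio C D 0) > 0" using A C unfolding ratio_def by auto
    show ?thesis
      using exponent_balance[OF 1 2 tendsto_norm_ratio[OF A(2) Z(1)] 6(1) tendsto_norm_ratio[OF C(2) Z(1)] 6(2) 3 4 5 lo pq(1)]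
      unfolding edge_order_def by simp
  qed
  show ?thesis
  proof (cases "\<exists>K. \<forall>n\<ge>N. norm (T n) \<le> K")
    case True
    then obtain K where K: "\<forall>n\<ge>N. norm (T n) \<le> K" by blast
    then have "bounded (range (\<lambda>n. T (n + N)))" unfolding bounded_iff by (intro exI[of _ K]) auto
    then obtain \<tau> h where h: "strict_mono h" "((\<lambda>n. T (n + N)) \<circ> h) \<longlonglongrightarrow> \<tau>"
      using bounded_imp_convergent_subsequence by blast
    define g where "g n = h n + N" for n
    have g: "strict_mono g" using h(1) unfolding g_def strict_mono_def by simp
    have Tg: "(\<lambda>n. T (g n)) \<longlonglongrightarrow> \<tau>" using h(2) unfolding g_def by (simp add: o_def)
    have gN: "g n \<ge> N" for n unfolding g_def by simp
    have eg: "(\<lambda>n. \<epsilon> (g n)) \<longlonglongrightarrow> 0" using LIMSEQ_subseq_LIMSEQ[OF elim g] by (simp add: o_def)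
    have dom: "poly (Q 0) (T (g n)) \<noteq> 0" "poly (Q 1) (T (g n)) \<noteq> 0" for n
      using T[OF gN] unfolding param_domain_def by auto
    have "poly (P 0) \<tau> = 0"
    proof -
      have "(\<lambda>n. complex_of_real (\<epsilon> (g n)) ^ p * poly (Q 0) (T (g n))) \<longlonglongrightarrow> complex_of_real 0 ^ p * poly (Q 0) \<tau>"
        by (intro tendsto_intros eg Tg)
      moreover have "complex_of_real (\<epsilon> (g n)) ^ p * poly (Q 0) (T (g n)) = poly (P 0) (T (g n))" for n
        using T[OF gN, of n] dom(1)[of n] unfolding ratio_def by (metis nonzero_divide_eq_eq)
      moreover have "(\<lambda>n. poly (P 0) (T (g n))) \<longlonglongrightarrow> poly (P 0) \<tau>" by (intro tendsto_intros Tg)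
      ultimately have "poly (P 0) \<tau> = complex_of_real 0 ^ p * poly (Q 0) \<tau>" using LIMSEQ_unique by fastforce
      then show ?thesis using pq(1) by simp
    qed
    moreover have "poly (Q 1) \<tau> = 0"
    proof -
      have "(\<lambda>n. norm (poly (P 1) (T (g n))) * \<epsilon> (g n) ^ q) \<longlonglongrightarrow> norm (poly (P 1) \<tau>) * 0 ^ q"
        by (intro tendsto_intros eg Tg)
      then have "(\<lambda>n. norm (poly (P 1) (T (g n))) * \<epsilon> (g n) ^ q) \<longlonglongrightarrow> 0" using pq(2) by (simp add: zero_power)
      moreover have "(\<lambda>n. lo * norm (poly (Q 1) (T (g n)))) \<longlonglongrightarrow> lo * norm (poly (Q 1) \<tau>)" by (intro tendsto_intros Tg)
      moreover have "lo * norm (poly (Q 1) (T (g n))) \<le> norm (poly (P 1) (T (g n))) * \<epsilon> (g n) ^ q" for n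
      proof -
        have "lo * norm (poly (Q 1) (T (g n))) \<le> norm (ratio (P 1) (Q 1) (T (g n))) * \<epsilon> (g n) ^ q * norm (poly (Q 1) (T (g n)))"
          using T[OF gN, of n] by (intro mult_right_mono) auto
        then show ?thesis unfolding ratio_def norm_divide using dom(2)[of n] by (simp add: field_simps)
      qed
      ultimately have "lo * norm (poly (Q 1) \<tau>) \<le> 0" by (meson LIMSEQ_le)
      then show ?thesis using lo by (simp add: mult_le_0_iff)
    qed
    ultimately have "\<tau> = 0" using common by blast
    obtain A B where A: "poly A 0 \<noteq> 0" "poly B 0 \<noteq> 0"
      "\<And>t. t \<noteq> 0 \<Longrightarrow> norm (ratio (P 0) (Q 0) t) = norm t powi (int (order 0 (P 0)) - int (order 0 (Q 0))) * norm (ratio A B t)"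
      using ratio_at_0[OF nz(1)[of 0] nz(2)[of 0]] by auto
    obtain C D where C: "poly C 0 \<noteq> 0" "poly D 0 \<noteq> 0"
      "\<And>t. t \<noteq> 0 \<Longrightarrow> norm (ratio (P 1) (Q 1) t) = norm t powi (int (order 0 (P 1)) - int (order 0 (Q 1))) * norm (ratio C D t)"
      using ratio_at_0[OF nz(1)[of 1] nz(2)[of 1]] by auto
    have T0: "\<forall>\<^sub>F n in sequentially. T (g n) \<noteq> 0"
    proof -
      have "(\<lambda>n. complex_of_real (\<epsilon> (g n)) ^ p) \<longlonglongrightarrow> complex_of_real 0 ^ p" by (intro tendsto_intros eg)
      then have "(\<lambda>n. complex_of_real (\<epsilon> (g n)) ^ p) \<longlonglongrightarrow> 0" using pq(1) by (simp add: zero_power)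
      then have "\<forall>\<^sub>F n in sequentially. complex_of_real (\<epsilon> (g n)) ^ p \<notin> {ratio (P 0) (Q 0) 0}"
        using epos by (intro eventually_avoids_finite) (auto simp: less_imp_neq[THEN not_sym])
      then show ?thesis by eventually_elim (metis T gN singletonI)
    qed
    have "edge_order (int (order 0 (P 0)) - int (order 0 (Q 0))) (int (order 0 (Q 1)) - int (order 0 (P 1))) p q"
      using local[of g "\<lambda>t. t" A B "int (order 0 (P 0)) - int (order 0 (Q 0))" C D "int (order 0 (Q 1)) - int (order 0 (P 1))"]
        g Tg T0 A C \<open>\<tau> = 0\<close> by simp
    then show ?thesis unfolding p_q_def by blast
  next
    case False
    then have "\<forall>m. \<exists>n\<ge>N. norm (T n) > real m" by (metis linorder_not_le)
    then obtain f where f: "\<And>m. f m \<ge> N \<and> norm (T (f m)) > real m" by metis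
    have "infinite (range f)"
    proof
      assume "finite (range f)"
      then have "finite ((\<lambda>n. norm (T n)) ` range f)" by blast
      then obtain K where K: "\<And>m. norm (T (f m)) \<le> K" by (metis bdd_above.E bdd_above_finite imageI rangeI)
      obtain m where "K < real m" using reals_Archimedean2 by blast
      then show False using f[of m] K[of m] by linarith
    qed
    \<comment> \<open>An unbounded sequence has a subsequence that tends to infinity.\<close>
    have "\<forall>m n0. \<exists>n>n0. n \<ge> N \<and> norm (T n) > real m"
    proof (intro allI)
      fix m n0 :: nat
      define K where "K = Max ((\<lambda>n. norm (T n)) ` {..n0})"
      obtain m' where m': "max K (real m) < real m'" using reals_Archimedean2 by blast
      have "f m' > n0"
      proof (rule ccontr)
        assume "\<not> n0 < f m'"
        then have "norm (T (f m')) \<le> K" unfolding K_def by (intro Max_ge) auto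
        then show False using f[of m'] m' by linarith
      qed
      then show "\<exists>n>n0. n \<ge> N \<and> norm (T n) > real m" using f[of m'] m' by (intro exI[of _ "f m'"]) auto
    qed
    then obtain nx where nx: "\<And>m n0. nx m n0 > n0 \<and> nx m n0 \<ge> N \<and> norm (T (nx m n0)) > real m" by metis
    define h where "h = rec_nat (nx 0 0) (\<lambda>m x. nx (Suc m) x)"
    have hS: "h (Suc m) = nx (Suc m) (h m)" "h 0 = nx 0 0" for m unfolding h_def by simp_all
    have h: "strict_mono h" unfolding strict_mono_Suc_iff using hS nx by simp
    have big: "norm (T (h m)) > real m" for m by (cases m) (metis hS(2) nx, metis hS(1) nx)
    have T0: "\<forall>\<^sub>F n in sequentially. T (h n) \<noteq> 0" using big by (metis (mono_tags) always_eventually norm_zero of_nat_0_le_iff not_le)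
    have inv: "(\<lambda>n. inverse (T (h n))) \<longlonglongrightarrow> 0"
    proof -
      have "filterlim (\<lambda>n. norm (T (h n))) at_top sequentially"
        using filterlim_at_top_mono[OF filterlim_real_sequentially] big by (metis (mono_tags, lifting) always_eventually less_imp_le)
      then have "filterlim (\<lambda>n. T (h n)) at_infinity sequentially" by (rule filterlim_norm_at_top_imp_at_infinity)
      then show ?thesis by (rule filterlim_compose[OF tendsto_inverse_0])
    qed
    obtain A B where A: "poly A 0 \<noteq> 0" "poly B 0 \<noteq> 0"
      "\<And>t. t \<noteq> 0 \<Longrightarrow> norm (ratio (P 0) (Q 0) t) = norm (inverse t) powi (int (degree (Q 0)) - int (degree (P 0))) * norm (ratio A B (inverse t))"
      using ratio_at_infinity[OF nz(1)[of 0] nz(2)[of 0]] by auto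
    obtain C D where C: "poly C 0 \<noteq> 0" "poly D 0 \<noteq> 0"
      "\<And>t. t \<noteq> 0 \<Longrightarrow> norm (ratio (P 1) (Q 1) t) = norm (inverse t) powi (int (degree (Q 1)) - int (degree (P 1))) * norm (ratio C D (inverse t))"
      using ratio_at_infinity[OF nz(1)[of 1] nz(2)[of 1]] by auto
    have "edge_order (int (degree (Q 0)) - int (degree (P 0))) (int (degree (P 1)) - int (degree (Q 1))) p q"
      using local[of h inverse A B "int (degree (Q 0)) - int (degree (P 0))" C D "int (degree (P 1)) - int (degree (Q 1))"]
        h inv T0 A C by simp
    then show ?thesis unfolding p_q_def by blast
  qed
qed

end

section \<open>The corner in terms of orders at zero and infinity\<close>

lemma degree_prod_linear_mset:
  "degree (\<Prod>\<rho>\<in>#M. [:f \<rho>, g \<rho> :: complex:]) = size (filter_mset (\<lambda>\<rho>. g \<rho> \<noteq> 0) M)"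
  if "\<And>\<rho>. \<rho> \<in># M \<Longrightarrow> f \<rho> \<noteq> 0 \<or> g \<rho> \<noteq> 0"
  using that
proof (induction M)
  case (add \<rho> M)
  have "(\<Prod>\<rho>\<in>#M. [:f \<rho>, g \<rho>:]) \<noteq> 0" using add.prems by (auto simp: pCons_eq_0_iff)
  moreover have "[:f \<rho>, g \<rho>:] \<noteq> 0" using add.prems by auto
  ultimately have "degree ([:f \<rho>, g \<rho>:] * (\<Prod>\<rho>\<in>#M. [:f \<rho>, g \<rho>:])) = degree [:f \<rho>, g \<rho>:] + degree (\<Prod>\<rho>\<in>#M. [:f \<rho>, g \<rho>:])"
    by (intro degree_mult_eq)
  then show ?case using add by (simp del: mult_pCons_left)
qed simp

lemma order_prod_linear_mset:
  "order 0 (\<Prod>\<rho>\<in>#M. [:f \<rho>, g \<rho> :: complex:]) = size (filter_mset (\<lambda>\<rho>. f \<rho> = 0) M)"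
  if "\<And>\<rho>. \<rho> \<in># M \<Longrightarrow> f \<rho> \<noteq> 0 \<or> g \<rho> \<noteq> 0"
  using that
proof (induction M)
  case (add \<rho> M)
  have "(\<Prod>\<rho>\<in>#M. [:f \<rho>, g \<rho>:]) \<noteq> 0" using add.prems by (auto simp: pCons_eq_0_iff)
  moreover have n: "[:f \<rho>, g \<rho>:] \<noteq> 0" using add.prems by auto
  moreover have "order 0 [:f \<rho>, g \<rho>:] = (if f \<rho> = 0 then 1 else 0)"
  proof (cases "f \<rho> = 0")
    case True
    then have "[:f \<rho>, g \<rho>:] = monom (g \<rho>) 1" by (simp add: monom_Suc monom_0)
    then show ?thesis using True n by simp
  next
    case False
    then show ?thesis by (simp add: order_0I)
  qed
  moreover have "order 0 ([:f \<rho>, g \<rho>:] * (\<Prod>\<rho>\<in>#M. [:f \<rho>, g \<rho>:])) = order 0 [:f \<rho>, g \<rho>:] + order 0 (\<Prod>\<rho>\<in>#M. [:f \<rho>, g \<rho>:])"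
    using calculation(1,2) by (intro order_mult) (simp del: mult_pCons_left)
  ultimately show ?case using add by (simp del: mult_pCons_left)
qed simp

lemma size_filter_proots_0:
  fixes G :: "complex poly"
  assumes "G \<noteq> 0" "\<And>t. poly G t = 0 \<Longrightarrow> R t \<Longrightarrow> t = 0"
  shows "size (filter_mset R (proots G)) = (if R 0 then order 0 G else 0)"
proof -
  have "filter_mset R (proots G) = (if R 0 then replicate_mset (order 0 G) 0 else {#})"
  proof (rule multiset_eqI)
    fix t
    show "count (filter_mset R (proots G)) t = count (if R 0 then replicate_mset (order 0 G) 0 else {#}) t"
    proof (cases "poly G t = 0")
      case True then show ?thesis using assms by (cases "t = 0") auto
    next
      case False
      then have "order t G = 0" by (rule order_0I)
      then show ?thesis using assms(1) by auto
    qed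
  qed
  then show ?thesis by simp
qed

lemma degree_endpoly:
  assumes cop: "coprime A B" and G: "G \<noteq> 0" "degree G \<le> k" and n: "coeff A n \<noteq> 0 \<or> coeff B n \<noteq> 0"
    and c: "\<And>t. poly G t = 0 \<Longrightarrow> poly B t = 0 \<Longrightarrow> t = 0"
  shows "degree (endpoly A B n G k) = k - (if poly B 0 = 0 then order 0 G else 0) - (if coeff B n = 0 then k - degree G else 0)"
proof -
  have ne: "- poly A t \<noteq> 0 \<or> poly B t \<noteq> 0" for t using coprime_poly_0[OF cop, of t] by simp
  have l: "[:- coeff A n, coeff B n:] \<noteq> 0" using n by auto
  have P: "(\<Prod>\<rho>\<in>#proots G. [:- poly A \<rho>, poly B \<rho>:]) \<noteq> 0" using ne by (auto simp: pCons_eq_0_iff)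
  have "size (filter_mset (\<lambda>\<rho>. poly B \<rho> \<noteq> 0) (proots G)) + size (filter_mset (\<lambda>\<rho>. poly B \<rho> = 0) (proots G)) = degree G"
    using size_filter_mset_lesseq multiset_partition[of "proots G" "\<lambda>\<rho>. poly B \<rho> = 0"] size_proots_complex[of G]
    by (metis add.commute size_union)
  then have f: "size (filter_mset (\<lambda>\<rho>. poly B \<rho> \<noteq> 0) (proots G)) = degree G - (if poly B 0 = 0 then order 0 G else 0)"
    using size_filter_proots_0[OF G(1), of "\<lambda>\<rho>. poly B \<rho> = 0"] c by simp
  have d: "degree [:- coeff A n, coeff B n:] = (if coeff B n = 0 then 0 else 1)" by simp
  have o: "order 0 G \<le> degree G" using order_degree[OF G(1)] .
  have "degree ((\<Prod>\<rho>\<in>#proots G. [:- poly A \<rho>, poly B \<rho>:]) * [:- coeff A n, coeff B n:] ^ (k - degree G)) =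
    degree (\<Prod>\<rho>\<in>#proots G. [:- poly A \<rho>, poly B \<rho>:]) + (k - degree G) * degree [:- coeff A n, coeff B n:]"
    using P l by (simp only: degree_mult_eq degree_power_eq power_not_zero not_False_eq_True)
  then show ?thesis unfolding endpoly_def d
    using f G(2) o by (simp add: degree_prod_linear_mset[where f = "\<lambda>t. - poly A t" and g = "poly B", OF ne])
qed

lemma endpoly_nz:
  assumes cop: "coprime A B" and n: "coeff A n \<noteq> 0 \<or> coeff B n \<noteq> 0"
  shows "endpoly A B n G k \<noteq> 0"
proof -
  have ne: "- poly A t \<noteq> 0 \<or> poly B t \<noteq> 0" for t using coprime_poly_0[OF cop, of t] by simp
  then show ?thesis unfolding endpoly_def using n by (auto simp: pCons_eq_0_iff)
qed

lemma order_endpoly: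
  assumes cop: "coprime A B" and G: "G \<noteq> 0" and n: "coeff A n \<noteq> 0 \<or> coeff B n \<noteq> 0"
    and c: "\<And>t. poly A t = 0 \<Longrightarrow> poly G t = 0 \<Longrightarrow> t = 0"
  shows "order 0 (endpoly A B n G k) = (if poly A 0 = 0 then order 0 G else 0) + (if coeff A n = 0 then k - degree G else 0)"
proof -
  have ne: "- poly A t \<noteq> 0 \<or> poly B t \<noteq> 0" for t using coprime_poly_0[OF cop, of t] by simp
  have l: "[:- coeff A n, coeff B n:] \<noteq> 0" using n by auto
  have f: "size (filter_mset (\<lambda>\<rho>. - poly A \<rho> = 0) (proots G)) = (if poly A 0 = 0 then order 0 G else 0)"
    using size_filter_proots_0[OF G(1), of "\<lambda>\<rho>. - poly A \<rho> = 0"] c by simp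
  have pw: "order 0 ([:- coeff A n, coeff B n:] ^ i) = (if coeff A n = 0 then i else 0)" for i
  proof (cases "coeff A n = 0")
    case True
    then have "[:- coeff A n, coeff B n:] ^ i = monom (coeff B n ^ i) i"
      by (simp add: monom_Suc[symmetric] monom_0[symmetric] monom_power)
    then show ?thesis using n True by simp
  next
    case False then show ?thesis by (simp add: order_0I)
  qed
  show ?thesis
    using endpoly_nz[OF cop n, of G k] pw f order_prod_linear_mset[where f = "\<lambda>t. - poly A t" and g = "poly B" and M = "proots G", OF ne] unfolding endpoly_def
    by (simp add: order_mult)
qed

lemma coeff_order_0:
  fixes q :: "complex poly"
  assumes "q \<noteq> 0"
  shows "coeff q (order 0 q) \<noteq> 0" "coeff q i \<noteq> 0 \<Longrightarrow> order 0 q \<le> i"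
proof -
  have *: "n \<le> order 0 q \<longleftrightarrow> (\<forall>k<n. coeff q k = 0)" for n
    using monom_1_dvd_iff[OF assms, of n] monom_1_dvd_iff'[of n q] by simp
  show "coeff q i \<noteq> 0 \<Longrightarrow> order 0 q \<le> i" using *[of "order 0 q"] by (meson linorder_not_le order_refl)
  show "coeff q (order 0 q) \<noteq> 0" using *[of "Suc (order 0 q)"] *[of "order 0 q"] by (metis Suc_n_not_le_n less_SucE order_refl)
qed

definition support_points :: "complex poly poly \<Rightarrow> (real \<times> real) set" where
  "support_points \<phi> = (\<lambda>(i, j). (real i, real j)) ` supp \<phi>"

lemma newton_polygon_support_points: "newton_polygon \<phi> = convex hull (support_points \<phi>)"
  unfolding newton_polygon_def support_points_def supp_def by (rule arg_cong[where f = "\<lambda>S. convex hull S"]) auto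

context rational_curve
begin

text \<open>\<open>\<alpha>'\<close> and \<open>\<beta>'\<close> are the orders of \<open>P 0\<close> and \<open>Q 1\<close> at infinity relative to the degrees of the maps \<open>x\<close> and \<open>y\<close>;
\<open>Ey\<close> and \<open>Fx\<close> are the nontrivial coordinates of the end points \<open>E\<close> and \<open>F\<close> of the corner.\<close>

definition "\<alpha> = order 0 (P 0)"
definition "\<beta> = order 0 (Q 1)"
definition "\<alpha>' = coord_degree 0 - degree (P 0)"
definition "\<beta>' = coord_degree 1 - degree (Q 1)"
definition "Ey = coord_degree 0 - (if 0 < \<beta> then \<alpha> else 0) - (if 0 < \<beta>' then \<alpha>' else 0)"
definition "Fx = (if 0 < \<alpha> then \<beta> else 0) + (if 0 < \<alpha>' then \<beta>' else 0)"

lemma coeff_coord_degree: "coeff (P 0) (coord_degree 0) \<noteq> 0 \<or> coeff (Q 0) (coord_degree 0) \<noteq> 0" "coeff (P 1) (coord_degree 1) \<noteq> 0 \<or> coeff (Q 1) (coord_degree 1) \<noteq> 0"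
  using nz(1)[of 0] nz(2)[of 0] nz(1)[of 1] nz(2)[of 1] unfolding coord_degree_def by (auto simp: max_def)

lemma top_order:
  assumes "\<forall>t. poly (P 0) t = 0 \<longrightarrow> poly (Q 1) t = 0 \<longrightarrow> t = 0"
  shows "order 0 (coeff \<phi> (coord_degree 0)) = Fx"
proof -
  obtain \<kappa> where k: "\<kappa> \<noteq> 0" "coeff \<phi> (coord_degree 0) = smult \<kappa> (endpoly (P 0) (Q 0) (coord_degree 0) (Q 1) (coord_degree 1))"
    using top_coeff by blast
  have "poly (P 0) 0 = 0 \<longleftrightarrow> 0 < \<alpha>" using nz(1)[of 0] unfolding \<alpha>_def by (simp add: order_root)
  moreover have "coeff (P 0) (coord_degree 0) = 0 \<longleftrightarrow> 0 < \<alpha>'"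
  proof
    assume "coeff (P 0) (coord_degree 0) = 0"
    then have "degree (P 0) \<noteq> coord_degree 0" using nz(1)[of 0] by (metis leading_coeff_0_iff pos2)
    then show "0 < \<alpha>'" unfolding \<alpha>'_def coord_degree_def by simp
  qed (simp add: \<alpha>'_def coeff_eq_0)
  ultimately show ?thesis
    unfolding k(2) order_smult[OF k(1)] Fx_def \<beta>_def \<beta>'_def
    using order_endpoly[OF cop[of 0] nz(2)[of 1] coeff_coord_degree(1), of "coord_degree 1"] assms by simp
qed

lemma left_degree:
  assumes "\<forall>t. poly (P 0) t = 0 \<longrightarrow> poly (Q 1) t = 0 \<longrightarrow> t = 0"
  shows "degree (coeff (swap_vars \<phi>) 0) = Ey" "coeff (swap_vars \<phi>) 0 \<noteq> 0"
proof -
  interpret sw: rational_curve "flip P" "flip Q" "swap_vars \<phi>" by (rule swap)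
  obtain \<kappa> where k: "\<kappa> \<noteq> 0" "coeff (swap_vars \<phi>) 0 = smult \<kappa> (endpoly (P 1) (Q 1) (coord_degree 1) (P 0) (coord_degree 0))"
    using sw.bottom_coeff by (auto simp: sw_coord_degree sw_coord_degree(2)[unfolded One_nat_def])
  have "poly (Q 1) 0 = 0 \<longleftrightarrow> 0 < \<beta>" using nz(2)[of 1] unfolding \<beta>_def by (simp add: order_root)
  moreover have "coeff (Q 1) (coord_degree 1) = 0 \<longleftrightarrow> 0 < \<beta>'"
  proof
    assume "coeff (Q 1) (coord_degree 1) = 0"
    then have "degree (Q 1) \<noteq> coord_degree 1" using nz(2)[of 1] by (metis leading_coeff_0_iff one_less_numeral_iff semiring_norm(76))
    then show "0 < \<beta>'" unfolding \<beta>'_def coord_degree_def by simp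
  qed (simp add: \<beta>'_def coeff_eq_0)
  moreover have "degree (P 0) \<le> coord_degree 0" unfolding coord_degree_def by simp
  ultimately show "degree (coeff (swap_vars \<phi>) 0) = Ey"
    unfolding k(2) degree_smult_eq Ey_def \<alpha>_def \<alpha>'_def
    using degree_endpoly[OF cop[of 1] nz(1)[of 0] _ coeff_coord_degree(2), of "coord_degree 0"] assms k(1) by simp
  show "coeff (swap_vars \<phi>) 0 \<noteq> 0" using endpoly_nz[OF cop[of 1] coeff_coord_degree(2)] k by simp
qed

text \<open>Coprimality of numerator and denominator turns the differences of orders in \<open>edge_valuation\<close> into
\<open>\<alpha>\<close>, \<open>\<beta>\<close>, respectively their counterparts at infinity.\<close>

lemma edge_slopes:
  assumes "\<forall>t. poly (P 0) t = 0 \<longrightarrow> poly (Q 1) t = 0 \<longrightarrow> t = 0"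
    and "0 < \<tau>" "has_upper_left_edge (support_points \<phi>) \<tau>"
  shows "0 < \<alpha> \<and> 0 < \<beta> \<and> \<tau> = real \<alpha> / real \<beta> \<or> 0 < \<alpha>' \<and> 0 < \<beta>' \<and> \<tau> = real \<alpha>' / real \<beta>'"
proof -
  obtain i1 j1 i2 j2 where z: "(i1, j1) \<in> supp \<phi>" "(i2, j2) \<in> supp \<phi>" "real i1 < real i2"
    "real j2 - real j1 = \<tau> * (real i2 - real i1)"
    and un: "\<And>i j. (i, j) \<in> supp \<phi> \<Longrightarrow> real j - real j1 \<le> \<tau> * (real i - real i1)"
    using assms(3) unfolding has_upper_left_edge_def support_points_def by (auto simp: image_iff) fastforce
  have i: "i1 < i2" using z by simp
  have "0 < \<tau> * (real i2 - real i1)" using z assms(2) by simp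
  then have j: "j1 < j2" using z(4) by linarith
  have edge: "int (i2 - i1) * (int j - int j1) \<le> int (j2 - j1) * (int i - int i1)" if "(i, j) \<in> supp \<phi>" for i j
  proof -
    have "(real i2 - real i1) * (real j - real j1) \<le> (real i2 - real i1) * (\<tau> * (real i - real i1))"
      using un[OF that] z(3) by (intro mult_left_mono) auto
    also have "\<dots> = (real j2 - real j1) * (real i - real i1)" unfolding z(4) by simp
    finally have "real_of_int (int (i2 - i1) * (int j - int j1)) \<le> real_of_int (int (j2 - j1) * (int i - int i1))"
      using i j by (simp add: of_nat_diff)
    then show ?thesis by linarith
  qed
  have fin: "\<tau> = real A / real B \<and> 0 < A \<and> 0 < B" if "edge_order (int A) (int B) (j2 - j1) (i2 - i1)" for A B :: nat
  proof -
    have e: "0 < A" "int A * int (i2 - i1) = int B * int (j2 - j1)" using that unfolding edge_order_def by auto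
    then have "real A * real (i2 - i1) = real B * real (j2 - j1)" by (metis of_int_mult of_int_of_nat_eq)
    then have e2: "real A * (real i2 - real i1) = real B * (\<tau> * (real i2 - real i1))" using i j z(4) by (simp add: of_nat_diff)
    then have e3: "real A = real B * \<tau>" using z(3) by simp
    then have "0 < B" using e(1) by (cases B) auto
    then show ?thesis using e3 e(1) by (simp add: field_simps)
  qed
  have pos: "0 < b" if "edge_order a b (j2 - j1) (i2 - i1)" for a b
  proof -
    have e: "0 < a" "a * int (i2 - i1) = b * int (j2 - j1)" using that unfolding edge_order_def by auto
    have "0 < a * int (i2 - i1)" using e(1) i by (intro mult_pos_pos) auto
    then show ?thesis unfolding e(2) using j by (simp add: zero_less_mult_iff)
  qed
  consider "edge_order (int (order 0 (P 0)) - int (order 0 (Q 0))) (int (order 0 (Q 1)) - int (order 0 (P 1))) (j2 - j1) (i2 - i1)" |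
    "edge_order (int (degree (Q 0)) - int (degree (P 0))) (int (degree (P 1)) - int (degree (Q 1))) (j2 - j1) (i2 - i1)"
    using edge_valuation[of i1 j1 i2 j2] assms(1) z(1,2) i j edge by blast
  then show ?thesis
  proof cases
    case 1
    have "0 < order 0 (P 0)" "0 < order 0 (Q 1)" using 1 pos[OF 1] unfolding edge_order_def by linarith+
    then have "poly (P 0) 0 = 0" "poly (Q 1) 0 = 0" using nz(1)[of 0] nz(2)[of 1] by (simp_all add: order_root)
    then have "order 0 (Q 0) = 0" "order 0 (P 1) = 0"
      using coprime_poly_0[OF cop[of 0], of 0] coprime_poly_0[OF cop[of 1], of 0] by (simp_all add: order_0I)
    then have "edge_order (int \<alpha>) (int \<beta>) (j2 - j1) (i2 - i1)" using 1 unfolding \<alpha>_def \<beta>_def by simp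
    then show ?thesis using fin by blast
  next
    case 2
    have "degree (P 0) < degree (Q 0)" "degree (Q 1) < degree (P 1)" using 2 pos[OF 2] unfolding edge_order_def by linarith+
    then have "edge_order (int \<alpha>') (int \<beta>') (j2 - j1) (i2 - i1)" using 2 unfolding \<alpha>'_def \<beta>'_def coord_degree_def by (simp add: of_nat_diff)
    then show ?thesis using fin by blast
  qed
qed

lemma support_chain:
  assumes "\<forall>t. poly (P 0) t = 0 \<longrightarrow> poly (Q 1) t = 0 \<longrightarrow> t = 0" and "0 < Fx" "Ey < coord_degree 0"
  shows "upper_left_chain (support_points \<phi>) (0, real Ey) (real Fx, real (coord_degree 0))"
proof
  show "finite (support_points \<phi>)" unfolding support_points_def using finite_supp by simp
  have "coeff (coeff (swap_vars \<phi>) 0) Ey \<noteq> 0" using left_degree[OF assms(1)] by (metis leading_coeff_0_iff)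
  then have "(0, Ey) \<in> supp \<phi>" unfolding supp_def coeff_swap_vars by simp
  then show "(0, real Ey) \<in> support_points \<phi>" unfolding support_points_def by force
  have "coeff (coeff \<phi> (coord_degree 0)) Fx \<noteq> 0" using coeff_order_0(1)[OF top_coeff_nonzero] top_order[OF assms(1)] by simp
  then have "(Fx, coord_degree 0) \<in> supp \<phi>" unfolding supp_def by simp
  then show "(real Fx, real (coord_degree 0)) \<in> support_points \<phi>" unfolding support_points_def by force
  show "fst (0, real Ey) < fst (real Fx, real (coord_degree 0))" "snd (0, real Ey) < snd (real Fx, real (coord_degree 0))" using assms by simp_all
  fix w assume "w \<in> support_points \<phi>"
  then obtain i j where w: "w = (real i, real j)" "(i, j) \<in> supp \<phi>" unfolding support_points_def by auto
  show "fst (0, real Ey) \<le> fst w" unfolding w by simp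
  have "j \<le> coord_degree 0" using supp_le(1)[OF w(2)] implicit_equation_props(2) by simp
  then show "snd w \<le> snd (real Fx, real (coord_degree 0))" unfolding w by simp
  show "snd w \<le> snd (0, real Ey)" if "fst w = fst (0, real Ey)"
  proof -
    have "i = 0" using that unfolding w by simp
    then have "coeff (coeff (swap_vars \<phi>) 0) j \<noteq> 0" using w(2) unfolding supp_def coeff_swap_vars by simp
    then have "j \<le> degree (coeff (swap_vars \<phi>) 0)" by (rule le_degree)
    then show ?thesis using left_degree(1)[OF assms(1)] unfolding w by simp
  qed
  show "fst (real Fx, real (coord_degree 0)) \<le> fst w" if "snd w = snd (real Fx, real (coord_degree 0))"
  proof -
    have "j = coord_degree 0" using that unfolding w by simp
    then have "order 0 (coeff \<phi> (coord_degree 0)) \<le> i"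
      using w(2) coeff_order_0(2)[OF top_coeff_nonzero] unfolding supp_def by simp
    then show ?thesis using top_order[OF assms(1)] unfolding w by simp
  qed
qed

lemma alpha_le: "\<alpha> + \<alpha>' \<le> coord_degree 0"
  using order_degree[OF nz(1)[of 0], of 0] unfolding \<alpha>_def \<alpha>'_def coord_degree_def by simp

theorem corner_is_single_edge:
  assumes common: "\<forall>t. poly (P 0) t = 0 \<longrightarrow> poly (Q 1) t = 0 \<longrightarrow> t = 0"
    and some: "0 < \<alpha> \<and> 0 < \<beta> \<or> 0 < \<alpha>' \<and> 0 < \<beta>'"
    and one: "0 < \<alpha> \<and> 0 < \<beta> \<and> 0 < \<alpha>' \<and> 0 < \<beta>' \<Longrightarrow> \<alpha> * \<beta>' = \<alpha>' * \<beta>"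
    and F: "F = (real Fx, real (coord_degree 0))" and E: "E = (0, real Ey)"
  shows "is_single_edge (newton_polygon \<phi>) (upper_left_corner (newton_polygon \<phi>) E F) E F"
proof -
  have "0 < Fx" "Ey < coord_degree 0" using some coord_degree_pos unfolding Fx_def Ey_def by auto
  then interpret upper_left_chain "support_points \<phi>" E F unfolding E F by (rule support_chain[OF common])
  define s where "s = (if 0 < \<alpha> \<and> 0 < \<beta> then real \<alpha> / real \<beta> else real \<alpha>' / real \<beta>')"
  have "\<tau> = s" if "0 < \<tau>" "has_upper_left_edge (support_points \<phi>) \<tau>" for \<tau>
  proof -
    have "real \<alpha> / real \<beta> = real \<alpha>' / real \<beta>'" if "0 < \<alpha> \<and> 0 < \<beta> \<and> 0 < \<alpha>' \<and> 0 < \<beta>'"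
    proof -
      have "real \<alpha> * real \<beta>' = real \<alpha>' * real \<beta>" using one[OF that] by (metis of_nat_mult)
      then show ?thesis using that by (simp add: frac_eq_eq)
    qed
    then show ?thesis using edge_slopes[OF common that] unfolding s_def by auto
  qed
  then show ?thesis unfolding newton_polygon_support_points by (rule corner_single_edge)
qed

theorem corner_is_two_edges:
  assumes common: "\<forall>t. poly (P 0) t = 0 \<longrightarrow> poly (Q 1) t = 0 \<longrightarrow> t = 0"
    and pos: "0 < \<alpha>" "0 < \<beta>" "0 < \<alpha>'" "0 < \<beta>'" and ne: "\<alpha> * \<beta>' \<noteq> \<alpha>' * \<beta>"
    and F: "F = (real Fx, real (coord_degree 0))" and E: "E = (0, real Ey)"
    and p: "p = (if \<alpha>' * \<beta> < \<alpha> * \<beta>' then (real \<beta>, real (Ey + \<alpha>)) else (real \<beta>', real (Ey + \<alpha>')))"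
  shows "is_two_edges (newton_polygon \<phi>) (upper_left_corner (newton_polygon \<phi>) E F) E p F"
proof -
  have FE: "Fx = \<beta> + \<beta>'" "coord_degree 0 = Ey + \<alpha> + \<alpha>'" using pos alpha_le unfolding Fx_def Ey_def by auto
  have "0 < Fx" "Ey < coord_degree 0" using pos FE by auto
  then interpret upper_left_chain "support_points \<phi>" E F unfolding E F by (rule support_chain[OF common])
  have sl: "\<tau> = real \<alpha> / real \<beta> \<or> \<tau> = real \<alpha>' / real \<beta>'" if "0 < \<tau>" "has_upper_left_edge (support_points \<phi>) \<tau>" for \<tau>
    using edge_slopes[OF common that] by blast
  have sl': "\<tau> = real \<alpha>' / real \<beta>' \<or> \<tau> = real \<alpha> / real \<beta>" if "0 < \<tau>" "has_upper_left_edge (support_points \<phi>) \<tau>" for \<tau>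
    using sl[OF that] by blast
  have lt: "a / b < a' / b'" if "a * b' < a' * b" "0 < b" "0 < b'" for a b a' b' :: real
    using that by (simp add: field_simps)
  show ?thesis
  proof (cases "\<alpha>' * \<beta> < \<alpha> * \<beta>'")
    case True
    then have "real \<alpha>' * real \<beta> < real \<alpha> * real \<beta>'" by (metis of_nat_less_iff of_nat_mult)
    then have l: "real \<alpha>' / real \<beta>' < real \<alpha> / real \<beta>" using pos by (intro lt) auto
    have "is_two_edges (convex hull support_points \<phi>) (upper_left_corner (convex hull support_points \<phi>) E F) E
      (fst E + real \<beta>, snd E + real \<alpha> / real \<beta> * real \<beta>) F"
      by (rule corner_two_edges[OF sl _ l, where x' = "real \<beta>'"]) (use pos FE in \<open>auto simp: E F\<close>)
    then show ?thesis unfolding newton_polygon_support_points p using True pos by (simp add: E)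
  next
    case False
    then have "\<alpha> * \<beta>' < \<alpha>' * \<beta>" using ne by simp
    then have "real \<alpha> * real \<beta>' < real \<alpha>' * real \<beta>" by (metis of_nat_less_iff of_nat_mult)
    then have l: "real \<alpha> / real \<beta> < real \<alpha>' / real \<beta>'" using pos by (intro lt) auto
    have "is_two_edges (convex hull support_points \<phi>) (upper_left_corner (convex hull support_points \<phi>) E F) E
      (fst E + real \<beta>', snd E + real \<alpha>' / real \<beta>' * real \<beta>') F"
      by (rule corner_two_edges[OF sl' _ l, where x' = "real \<beta>"]) (use pos FE in \<open>auto simp: E F\<close>)
    then show ?thesis unfolding newton_polygon_support_points p using False pos by (simp add: E)
  qed
qed

end

section \<open>Generic coefficients\<close>

text \<open>By the tube lemma.\<close>

lemma open_forall_compact: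
  fixes f :: "'a::topological_space \<Rightarrow> 'b::topological_space \<Rightarrow> real"
  assumes "compact K" "continuous_on UNIV (\<lambda>(c, \<tau>). f c \<tau>)"
  shows "open {c. \<forall>\<tau>\<in>K. f c \<tau> \<noteq> 0}"
proof -
  let ?W = "{z. (\<lambda>(c, \<tau>). f c \<tau>) z \<noteq> 0}"
  have W: "open ?W" using open_Collect_neq[OF assms(2) continuous_on_const[of UNIV 0]] by simp
  have "\<exists>X. open X \<and> c \<in> X \<and> X \<subseteq> {c. \<forall>\<tau>\<in>K. f c \<tau> \<noteq> 0}" if "\<forall>\<tau>\<in>K. f c \<tau> \<noteq> 0" for c
  proof -
    have "{c} \<times> K \<subseteq> ?W" using that by auto
    from Elementary_Topology.tube_lemma[OF assms(1) W this] obtain X where "c \<in> X" "open X" "X \<times> K \<subseteq> ?W" by blast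
    then show ?thesis by (intro exI[of _ X]) auto
  qed
  then show ?thesis by (subst open_subopen) auto
qed

lemma poly_poly_with_coeffs: "finite S \<Longrightarrow> poly (poly_with_coeffs S c) t = (\<Sum>k\<in>S. c k * t ^ k)"
  unfolding poly_with_coeffs_def by (simp add: poly_sum poly_monom)

lemma coeff_poly_with_coeffs: "finite S \<Longrightarrow> coeff (poly_with_coeffs S c) k = (if k \<in> S then c k else 0)"
  unfolding poly_with_coeffs_def by (simp add: coeff_sum)

text \<open>With \<open>near_infinity\<close>, this covers the Riemann sphere by two compact disks on which the nonzero roots of a
polynomial with fixed support can be followed, including limits at 0 and infinity.\<close>

definition near_zero :: "nat set \<Rightarrow> (nat \<Rightarrow> complex) \<Rightarrow> complex \<Rightarrow> complex" where
  "near_zero S c \<tau> = (\<Sum>k\<in>S. c k * \<tau> ^ (k - Min S))"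

definition near_infinity :: "nat set \<Rightarrow> (nat \<Rightarrow> complex) \<Rightarrow> complex \<Rightarrow> complex" where
  "near_infinity S c \<tau> = (\<Sum>k\<in>S. c k * \<tau> ^ (Max S - k))"

lemma poly_near_zero:
  assumes "finite S"
  shows "poly (poly_with_coeffs S c) t = t ^ Min S * near_zero S c t"
  unfolding near_zero_def poly_poly_with_coeffs[OF assms] sum_distrib_left
  by (intro sum.cong refl) (simp add: assms mult.left_commute power_add[symmetric])

lemma poly_near_infinity:
  assumes "finite S" "t \<noteq> 0"
  shows "poly (poly_with_coeffs S c) t = t ^ Max S * near_infinity S c (inverse t)"
  unfolding near_infinity_def poly_poly_with_coeffs[OF assms(1)] sum_distrib_left
proof (intro sum.cong refl)
  fix k assume "k \<in> S"
  then have "t ^ Max S = t ^ k * t ^ (Max S - k)" using assms by (simp add: power_add[symmetric])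
  then show "c k * t ^ k = t ^ Max S * (c k * inverse t ^ (Max S - k))"
    using assms(2) by (simp add: power_inverse field_simps)
qed

lemma near_zero_0:
  assumes "finite S" "S \<noteq> {}"
  shows "near_zero S c 0 = c (Min S)"
proof -
  have "near_zero S c 0 = (\<Sum>k\<in>S. if k = Min S then c k else 0)"
    unfolding near_zero_def
  proof (intro sum.cong refl)
    fix k assume "k \<in> S"
    then have "Min S \<le> k" using assms by simp
    then show "c k * 0 ^ (k - Min S) = (if k = Min S then c k else 0)" by (auto simp: power_0_left)
  qed
  also have "\<dots> = c (Min S)" using assms by (subst sum.delta) auto
  finally show ?thesis .
qed

lemma near_infinity_0:
  assumes "finite S" "S \<noteq> {}"
  shows "near_infinity S c 0 = c (Max S)"
proof -
  have "near_infinity S c 0 = (\<Sum>k\<in>S. if k = Max S then c k else 0)"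
    unfolding near_infinity_def
  proof (intro sum.cong refl)
    fix k assume "k \<in> S"
    then have "k \<le> Max S" using assms by simp
    then show "c k * 0 ^ (Max S - k) = (if k = Max S then c k else 0)" by (auto simp: power_0_left)
  qed
  also have "\<dots> = c (Max S)" using assms by (subst sum.delta) auto
  finally show ?thesis .
qed

definition no_common_root :: "nat set \<Rightarrow> nat set \<Rightarrow> (nat \<Rightarrow> complex) \<Rightarrow> (nat \<Rightarrow> complex) \<Rightarrow> bool" where
  "no_common_root S S' c c' \<longleftrightarrow>
     (\<forall>t. poly (poly_with_coeffs S c) t = 0 \<longrightarrow> poly (poly_with_coeffs S' c') t = 0 \<longrightarrow> t = 0)"

lemma no_common_root_iff:
  assumes S: "finite S" "S \<noteq> {}" "finite S'" "S' \<noteq> {}" and c: "\<forall>k\<in>S. c k \<noteq> 0"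
  shows "no_common_root S S' c c' \<longleftrightarrow>
     (\<forall>\<tau>\<in>cball 0 1. norm (near_zero S c \<tau>) + norm (near_zero S' c' \<tau>) \<noteq> 0) \<and>
     (\<forall>\<tau>\<in>cball 0 1. norm (near_infinity S c \<tau>) + norm (near_infinity S' c' \<tau>) \<noteq> 0)" (is "_ \<longleftrightarrow> ?R")
proof
  assume n: "no_common_root S S' c c'"
  have "norm (near_zero S c \<tau>) + norm (near_zero S' c' \<tau>) \<noteq> 0" for \<tau>
  proof
    assume "norm (near_zero S c \<tau>) + norm (near_zero S' c' \<tau>) = 0"
    then have z: "near_zero S c \<tau> = 0" "near_zero S' c' \<tau> = 0" by (simp_all add: add_nonneg_eq_0_iff)
    then have "\<tau> = 0" using n poly_near_zero[OF S(1), of c \<tau>] poly_near_zero[OF S(3), of c' \<tau>] unfolding no_common_root_def by (metis mult_zero_right)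
    then show False using z near_zero_0[OF S(1,2), of c] c S by simp
  qed
  moreover have "norm (near_infinity S c \<tau>) + norm (near_infinity S' c' \<tau>) \<noteq> 0" for \<tau>
  proof
    assume "norm (near_infinity S c \<tau>) + norm (near_infinity S' c' \<tau>) = 0"
    then have z: "near_infinity S c \<tau> = 0" "near_infinity S' c' \<tau> = 0" by (simp_all add: add_nonneg_eq_0_iff)
    have "\<tau> = 0"
    proof (rule ccontr)
      assume "\<tau> \<noteq> 0"
      then have "poly (poly_with_coeffs S c) (inverse \<tau>) = 0" "poly (poly_with_coeffs S' c') (inverse \<tau>) = 0"
        using z \<open>\<tau> \<noteq> 0\<close> poly_near_infinity[OF S(1), of "inverse \<tau>" c] poly_near_infinity[OF S(3), of "inverse \<tau>" c'] by auto
      then have "inverse \<tau> = 0" using n unfolding no_common_root_def by blast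
      then show False using \<open>\<tau> \<noteq> 0\<close> by simp
    qed
    then show False using z near_infinity_0[OF S(1,2), of c] c S by simp
  qed
  ultimately show ?R by blast
next
  assume R: ?R
  show "no_common_root S S' c c'"
    unfolding no_common_root_def
  proof (intro allI impI, rule ccontr)
    fix t assume t: "poly (poly_with_coeffs S c) t = 0" "poly (poly_with_coeffs S' c') t = 0" "t \<noteq> 0"
    show False
    proof (cases "norm t \<le> 1")
      case True
      then have "norm (near_zero S c t) + norm (near_zero S' c' t) = 0" using t S by (simp add: poly_near_zero)
      then show False using R True by (metis dist_0_norm mem_cball)
    next
      case False
      then have "norm (near_infinity S c (inverse t)) + norm (near_infinity S' c' (inverse t)) = 0" using t S by (simp add: poly_near_infinity)
      moreover have "inverse t \<in> cball 0 1" using False by (simp add: norm_inverse inverse_le_1_iff)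
      ultimately show False using R by blast
    qed
  qed
qed

text \<open>All coefficients in the supports are nonzero, so that orders and degrees are determined by the
supports, and for \<open>j = 1 - i\<close> zeros of the coordinate \<open>i\<close> are not poles of the coordinate \<open>j\<close>,
except possibly \<open>t = 0\<close> and \<open>t = \<infinity>\<close>.\<close>

definition generic_coeffs ::
  "(nat \<Rightarrow> nat set) \<Rightarrow> (nat \<Rightarrow> nat set) \<Rightarrow> nat \<Rightarrow> nat \<Rightarrow> ((nat \<Rightarrow> nat \<Rightarrow> complex) \<times> (nat \<Rightarrow> nat \<Rightarrow> complex)) set" where
  "generic_coeffs SP SQ i j = {(p, q) \<in> coeff_space SP SQ.
     (\<forall>l<2. (\<forall>k\<in>SP l. p l k \<noteq> 0) \<and> (\<forall>k\<in>SQ l. q l k \<noteq> 0)) \<and> no_common_root (SP i) (SQ j) (p i) (q j)}"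

lemma continuous_apply2:
  fixes g :: "'a::topological_space \<Rightarrow> 'b \<Rightarrow> 'c \<Rightarrow> 'd::topological_space"
  assumes "continuous_on X g"
  shows "continuous_on X (\<lambda>x. g x i k)"
  by (intro continuous_on_product_then_coordinatewise[of X "\<lambda>x. g x i"] continuous_on_product_then_coordinatewise[of X g] assms)

lemma continuous_apply2_iff:
  fixes g :: "'a::topological_space \<Rightarrow> 'b \<Rightarrow> 'c \<Rightarrow> 'd::topological_space"
  shows "continuous_on X g \<longleftrightarrow> (\<forall>i k. continuous_on X (\<lambda>x. g x i k))"
  by (metis continuous_apply2 continuous_on_coordinatewise_then_product)

context
  fixes SP SQ :: "nat \<Rightarrow> nat set" and i j :: nat
  assumes fin: "\<And>i. i < 2 \<Longrightarrow> finite (SP i) \<and> finite (SQ i)" and ne: "\<And>i. i < 2 \<Longrightarrow> SP i \<noteq> {} \<and> SQ i \<noteq> {}"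
    and ij: "i < 2" "j < 2"
begin

text \<open>Absence of common roots is the nonvanishing of a continuous function on two compact disks (\<open>no_common_root_iff\<close>).\<close>

lemma openin_generic_coeffs: "openin (top_of_set (coeff_space SP SQ)) (generic_coeffs SP SQ i j)"
proof -
  let ?T = "UNIV :: ((nat \<Rightarrow> nat \<Rightarrow> complex) \<times> (nat \<Rightarrow> nat \<Rightarrow> complex)) set"
  define W1 where "W1 = (\<Inter>l\<in>{..<2}. (\<Inter>k\<in>SP l. {c \<in> ?T. fst c l k \<noteq> 0}) \<inter> (\<Inter>k\<in>SQ l. {c \<in> ?T. snd c l k \<noteq> 0}))"
  have o: "open {c \<in> ?T. fst c l k \<noteq> 0}" "open {c \<in> ?T. snd c l k \<noteq> 0}" for l k
  proof -
    have "continuous_on ?T (\<lambda>c. fst c l k)" "continuous_on ?T (\<lambda>c. snd c l k)"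
      by (rule continuous_apply2, intro continuous_intros)+
    then show "open {c \<in> ?T. fst c l k \<noteq> 0}" "open {c \<in> ?T. snd c l k \<noteq> 0}"
      by (simp_all add: open_Collect_neq)
  qed
  have "open W1" unfolding W1_def using fin o by (intro open_INT ballI open_Int) auto
  define f where "f = (\<lambda>c \<tau>. norm (near_zero (SP i) (fst c i) \<tau>) + norm (near_zero (SQ j) (snd c j) \<tau>))"
  define g where "g = (\<lambda>c \<tau>. norm (near_infinity (SP i) (fst c i) \<tau>) + norm (near_infinity (SQ j) (snd c j) \<tau>))"
  have ct: "continuous_on UNIV (\<lambda>z. fst (fst z) l k)" "continuous_on UNIV (\<lambda>z. snd (fst z) l k)"
    for l k :: nat
    by (rule continuous_apply2, intro continuous_intros)+
  have "continuous_on UNIV (\<lambda>(c, \<tau>). f c \<tau>)" "continuous_on UNIV (\<lambda>(c, \<tau>). g c \<tau>)"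
    unfolding f_def g_def near_zero_def near_infinity_def case_prod_beta by (intro continuous_intros ct)+
  then have "open ({c. \<forall>\<tau>\<in>cball 0 1. f c \<tau> \<noteq> 0} \<inter> {c. \<forall>\<tau>\<in>cball 0 1. g c \<tau> \<noteq> 0})"
    by (intro open_Int open_forall_compact) auto
  then have "open (W1 \<inter> ({c. \<forall>\<tau>\<in>cball 0 1. f c \<tau> \<noteq> 0} \<inter> {c. \<forall>\<tau>\<in>cball 0 1. g c \<tau> \<noteq> 0}))" (is "open ?W")
    using \<open>open W1\<close> by blast
  moreover have "generic_coeffs SP SQ i j = coeff_space SP SQ \<inter> ?W"
  proof (rule set_eqI)
    fix c :: "(nat \<Rightarrow> nat \<Rightarrow> complex) \<times> (nat \<Rightarrow> nat \<Rightarrow> complex)"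
    have W1: "c \<in> W1 \<longleftrightarrow> (\<forall>l<2. (\<forall>k\<in>SP l. fst c l k \<noteq> 0) \<and> (\<forall>k\<in>SQ l. snd c l k \<noteq> 0))"
      unfolding W1_def by auto
    have "no_common_root (SP i) (SQ j) (fst c i) (snd c j) \<longleftrightarrow> (\<forall>\<tau>\<in>cball 0 1. f c \<tau> \<noteq> 0) \<and> (\<forall>\<tau>\<in>cball 0 1. g c \<tau> \<noteq> 0)" if "c \<in> W1"
      using no_common_root_iff[of "SP i" "SQ j" "fst c i" "snd c j"] that fin ne ij unfolding W1 f_def g_def by blast
    then show "c \<in> generic_coeffs SP SQ i j \<longleftrightarrow> c \<in> coeff_space SP SQ \<inter> ?W"
      unfolding generic_coeffs_def using W1 by (auto simp: case_prod_beta)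
  qed
  ultimately show ?thesis unfolding openin_open by blast
qed

text \<open>Density is shown along real one-parameter families of coefficients of which all but finitely many
members are generic.\<close>

lemma perturbation_closure:
  fixes g :: "real \<Rightarrow> 'a::topological_space"
  assumes "continuous_on UNIV g" "finite {\<epsilon>. g \<epsilon> \<notin> U}"
  shows "g 0 \<in> closure U"
proof -
  have "interior {\<epsilon>. g \<epsilon> \<notin> U} = {}" using assms(2) by (rule empty_interior_finite)
  then have "closure {\<epsilon>. g \<epsilon> \<in> U} = UNIV"
    by (metis Collect_neg_eq Compl_empty_eq closure_complement double_complement)
  moreover have "g ` closure {\<epsilon>. g \<epsilon> \<in> U} \<subseteq> closure U"
    using closure_subset assms(1) by (intro image_closure_subset) (auto intro: continuous_on_subset)
  ultimately show ?thesis by auto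
qed

lemma generic_coeffs_dense: "coeff_space SP SQ \<subseteq> closure (generic_coeffs SP SQ i j)"
proof -
  define V1 where "V1 = {(p, q) \<in> coeff_space SP SQ. \<forall>l<2. (\<forall>k\<in>SP l. p l k \<noteq> 0) \<and> (\<forall>k\<in>SQ l. q l k \<noteq> 0)}"
  \<comment> \<open>Vanishing coefficients are replaced by a small number.\<close>
  have "coeff_space SP SQ \<subseteq> closure V1"
  proof clarify
    fix p q :: "nat \<Rightarrow> nat \<Rightarrow> complex" assume pq: "(p, q) \<in> coeff_space SP SQ"
    define h where "h S r \<epsilon> = (\<lambda>l k. if l < 2 \<and> k \<in> S l \<and> r l k = 0 then complex_of_real \<epsilon> else r l k)"
      for S :: "nat \<Rightarrow> nat set" and r \<epsilon>
    define g where "g = (\<lambda>\<epsilon>. (h SP p \<epsilon>, h SQ q \<epsilon>))"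
    have ch: "continuous_on UNIV (h S r)" for S r
      unfolding continuous_apply2_iff
    proof (intro allI)
      fix l k show "continuous_on UNIV (\<lambda>\<epsilon>. h S r \<epsilon> l k)"
        unfolding h_def by (cases "l < 2 \<and> k \<in> S l \<and> r l k = 0") (auto intro!: continuous_intros)
    qed
    have "continuous_on UNIV g" unfolding g_def by (intro continuous_on_Pair ch)
    moreover have "{\<epsilon>. g \<epsilon> \<notin> V1} \<subseteq> {0}"
    proof (rule subsetI, rule ccontr)
      fix \<epsilon> assume e: "\<epsilon> \<in> {\<epsilon>. g \<epsilon> \<notin> V1}" "\<epsilon> \<notin> {0}"
      have "g \<epsilon> \<in> V1" using pq e(2) unfolding V1_def g_def h_def coeff_space_def by auto
      then show False using e by simp
    qed
    then have "finite {\<epsilon>. g \<epsilon> \<notin> V1}" using finite_subset by blast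
    ultimately have "g 0 \<in> closure V1" by (rule perturbation_closure)
    moreover have "g 0 = (p, q)" unfolding g_def h_def by (auto simp: fun_eq_iff)
    ultimately show "(p, q) \<in> closure V1" by simp
  qed
  \<comment> \<open>Changing the lowest coefficient of \<open>Q j\<close> moves its value at the finitely many nonzero roots of \<open>P i\<close> away from 0.\<close>
  moreover have "V1 \<subseteq> closure (generic_coeffs SP SQ i j)"
  proof clarify
    fix p q assume pq: "(p, q) \<in> V1"
    define m where "m = Min (SQ j)"
    have m: "m \<in> SQ j" using fin ne ij unfolding m_def by simp
    define h where "h \<epsilon> = q(j := (q j)(m := q j m + complex_of_real \<epsilon>))" for \<epsilon>
    define g where "g \<epsilon> = (p, h \<epsilon>)" for \<epsilon>
    have ch: "continuous_on UNIV h" unfolding continuous_apply2_iff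
    proof (intro allI)
      fix l k show "continuous_on UNIV (\<lambda>\<epsilon>. h \<epsilon> l k)"
        unfolding h_def by (cases "l = j"; cases "k = m") (auto intro!: continuous_intros)
    qed
    then have "continuous_on UNIV g" unfolding g_def by (intro continuous_on_Pair continuous_on_const)
    moreover have "finite {\<epsilon>. g \<epsilon> \<notin> generic_coeffs SP SQ i j}"
    proof -
      let ?P = "poly_with_coeffs (SP i) (p i)" and ?Q = "poly_with_coeffs (SQ j) (q j)"
      define B where "B = insert (- q j m) ((\<lambda>t. - poly ?Q t / t ^ m) ` {t. poly ?P t = 0})"
      obtain k where k: "k \<in> SP i" using ne ij by blast
      then have "coeff ?P k \<noteq> 0" using pq fin ij unfolding V1_def by (auto simp: coeff_poly_with_coeffs)
      then have "?P \<noteq> 0" by auto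
      then have fB: "finite B" unfolding B_def by (intro finite.insertI finite_imageI poly_roots_finite)
      have "g \<epsilon> \<in> generic_coeffs SP SQ i j" if e: "complex_of_real \<epsilon> \<notin> B" for \<epsilon>
      proof -
        have "h \<epsilon> l k \<noteq> 0" if "l < 2" "k \<in> SQ l" for l k
          using pq that e unfolding V1_def h_def B_def by (auto simp: add_eq_0_iff)
        moreover have "no_common_root (SP i) (SQ j) (p i) (h \<epsilon> j)"
          unfolding no_common_root_def
        proof (intro allI impI, rule ccontr)
          fix t assume t: "poly ?P t = 0" "poly (poly_with_coeffs (SQ j) (h \<epsilon> j)) t = 0" "t \<noteq> 0"
          have "poly (poly_with_coeffs (SQ j) (h \<epsilon> j)) t = (\<Sum>k\<in>SQ j. q j k * t ^ k + (if k = m then complex_of_real \<epsilon> * t ^ k else 0))"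
            using fin ij unfolding h_def by (subst poly_poly_with_coeffs) (auto intro!: sum.cong simp: algebra_simps)
          also have "\<dots> = poly ?Q t + complex_of_real \<epsilon> * t ^ m"
            using fin ij m by (simp add: sum.distrib poly_poly_with_coeffs sum.delta)
          finally have "complex_of_real \<epsilon> = - poly ?Q t / t ^ m" using t(2,3) by (simp add: field_simps add_eq_0_iff)
          then show False using e t(1) unfolding B_def by blast
        qed
        moreover have "(p, h \<epsilon>) \<in> coeff_space SP SQ"
        proof -
          have pq': "(p, q) \<in> coeff_space SP SQ" using pq unfolding V1_def by blast
          have "l < 2 \<and> k \<in> SQ l" if "h \<epsilon> l k \<noteq> 0" for l k
          proof (cases "l = j \<and> k = m")
            case True then show ?thesis using m ij by simp
          next
            case False
            then have "q l k \<noteq> 0" using that unfolding h_def by (auto split: if_splits)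
            then show ?thesis using pq' unfolding coeff_space_def by blast
          qed
          then show ?thesis using pq' unfolding coeff_space_def by blast
        qed
        moreover have "\<forall>l<2. \<forall>k\<in>SP l. p l k \<noteq> 0" using pq unfolding V1_def by blast
        ultimately show ?thesis unfolding generic_coeffs_def g_def by blast
      qed
      then have "{\<epsilon>. g \<epsilon> \<notin> generic_coeffs SP SQ i j} \<subseteq> complex_of_real -` B" by blast
      moreover have "finite (complex_of_real -` B)" using fB by (intro finite_vimageI) (auto simp: inj_on_def)
      ultimately show ?thesis using finite_subset by blast
    qed
    ultimately have "g 0 \<in> closure (generic_coeffs SP SQ i j)" by (rule perturbation_closure)
    moreover have "g 0 = (p, q)" unfolding g_def h_def by simp
    ultimately show "(p, q) \<in> closure (generic_coeffs SP SQ i j)" by simp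
  qed
  ultimately show ?thesis using closure_minimal closed_closure by blast
qed

lemma for_generic_implicit_equationI:
  assumes "\<And>p q \<phi> P Q. (p, q) \<in> generic_coeffs SP SQ i j \<Longrightarrow>
    P = (\<lambda>i. poly_with_coeffs (SP i) (p i)) \<Longrightarrow> Q = (\<lambda>i. poly_with_coeffs (SQ i) (q i)) \<Longrightarrow>
    coprime (P 0) (Q 0) \<Longrightarrow> coprime (P 1) (Q 1) \<Longrightarrow> has_param_degree P Q 1 \<Longrightarrow> is_implicit_equation P Q \<phi> \<Longrightarrow> R \<phi>"
  shows "for_generic_implicit_equation SP SQ R"
  unfolding for_generic_implicit_equation_def generically_def
  by (intro exI[of _ "generic_coeffs SP SQ i j"] conjI openin_generic_coeffs generic_coeffs_dense)
    (use assms in \<open>auto simp: Let_def\<close>)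

end

section \<open>The corner in terms of supports\<close>

lemma order_degree_poly_with_coeffs:
  assumes "finite S" "S \<noteq> {}" "\<forall>k\<in>S. c k \<noteq> 0"
  shows "order 0 (poly_with_coeffs S c) = Min S" "degree (poly_with_coeffs S c) = Max S" "poly_with_coeffs S c \<noteq> 0"
proof -
  let ?p = "poly_with_coeffs S c"
  have cf: "coeff ?p k \<noteq> 0 \<longleftrightarrow> k \<in> S" for k using assms by (auto simp: coeff_poly_with_coeffs)
  have mM: "Min S \<in> S" "Max S \<in> S" using assms by auto
  then show nz: "?p \<noteq> 0" using cf[of "Min S"] by auto
  show "order 0 ?p = Min S"
  proof (rule antisym)
    show "order 0 ?p \<le> Min S" using coeff_order_0(2)[OF nz] cf mM by blast
    show "Min S \<le> order 0 ?p" using coeff_order_0(1)[OF nz] cf assms(1) by simp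
  qed
  show "degree ?p = Max S"
  proof (rule antisym)
    show "Max S \<le> degree ?p" using cf mM by (intro le_degree) blast
    have "degree ?p \<in> S" using cf nz leading_coeff_0_iff by blast
    then show "degree ?p \<le> Max S" using assms(1) by simp
  qed
qed

text \<open>For generic coefficients, orders and degrees are extreme points of the supports. The condition \<open>ends\<close>
ensures that at the ends of the rows where \<open>x\<close> vanishes, the extreme exponents of \<open>Q 1\<close> are selected
points, so that \<open>\<beta>\<close> and its counterpart at infinity are the distances of the extreme selected
points from the ends of \<open>A 1\<close>.\<close>

lemma corner_of_supports:
  fixes SP SQ A Sel :: "nat \<Rightarrow> nat set" and P Q :: "nat \<Rightarrow> complex poly" and p q :: "nat \<Rightarrow> nat \<Rightarrow> complex"
    and \<delta> :: int and E F pL pR :: "real \<times> real"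
  assumes curve: "rational_curve P Q \<phi>"
    and fin: "\<And>i. i < 2 \<Longrightarrow> finite (SP i) \<and> finite (SQ i)" and ne: "\<And>i. i < 2 \<Longrightarrow> SP i \<noteq> {} \<and> SQ i \<noteq> {}"
    and P: "\<And>i. i < 2 \<Longrightarrow> P i = poly_with_coeffs (SP i) (p i) \<and> (\<forall>k\<in>SP i. p i k \<noteq> 0)"
    and Q: "\<And>i. i < 2 \<Longrightarrow> Q i = poly_with_coeffs (SQ i) (q i) \<and> (\<forall>k\<in>SQ i. q i k \<noteq> 0)"
    and common: "\<forall>t. poly (P 0) t = 0 \<longrightarrow> poly (Q 1) t = 0 \<longrightarrow> t = 0"
    and A: "\<And>i. i < 2 \<Longrightarrow> A i = SP i \<union> SQ i" and Sel: "\<And>i. i < 2 \<Longrightarrow> Sel i = SQ i - SP i"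
    and ends: "Min (A 0) \<in> Sel 0 \<Longrightarrow> Min (SQ 1) \<in> Sel 1" "Max (A 0) \<in> Sel 0 \<Longrightarrow> Max (SQ 1) \<in> Sel 1"
    and some: "Min (A 0) \<in> Sel 0 \<and> Min (A 1) \<notin> Sel 1 \<or> Max (A 0) \<in> Sel 0 \<and> Max (A 1) \<notin> Sel 1"
    and E: "E = (0, real ((if Max (A 1) \<in> Sel 1 then Max (A 0) else Max (SP 0)) - (if Min (A 1) \<in> Sel 1 then Min (A 0) else Min (SP 0))))"
    and F: "F = (real ((if Min (A 0) \<in> Sel 0 then Min (Sel 1) - Min (A 1) else 0) + (if Max (A 0) \<in> Sel 0 then Max (A 1) - Max (Sel 1) else 0)),
        real (Max (A 0) - Min (A 0)))"
    and \<delta>: "\<delta> = (int (Max (A 0)) - int (Max (SP 0))) * (int (Min (Sel 1)) - int (Min (A 1)))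
              - (int (Min (SP 0)) - int (Min (A 0))) * (int (Max (A 1)) - int (Max (Sel 1)))"
    and pL: "pL = (real (Min (Sel 1) - Min (A 1)), real (Max (SP 0) - Min (A 0)))"
    and pR: "pR = (real (Max (A 1) - Max (Sel 1)), real (Max (A 0) - Min (SP 0)))"
    and special: "special \<longleftrightarrow> Min (A 0) \<in> Sel 0 \<and> Max (A 0) \<in> Sel 0 \<and> Min (A 1) \<in> SP 1 \<and> Max (A 1) \<in> SP 1"
    and K: "K = newton_polygon \<phi>"
  shows "if special \<and> \<delta> \<noteq> 0 then is_two_edges K (upper_left_corner K E F) E (if \<delta> < 0 then pL else pR) F
    else is_single_edge K (upper_left_corner K E F) E F"
proof -
  interpret rational_curve P Q \<phi> by (rule curve)
  have fA: "finite (A i)" "A i \<noteq> {}" if "i < 2" for i using A[OF that] fin[OF that] ne[OF that] by auto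
  have P0: "order 0 (P i) = Min (SP i)" "degree (P i) = Max (SP i)" if "i < 2" for i
    using order_degree_poly_with_coeffs[of "SP i" "p i"] P[OF that] fin[OF that] ne[OF that] by auto
  have Q0: "order 0 (Q i) = Min (SQ i)" "degree (Q i) = Max (SQ i)" if "i < 2" for i
    using order_degree_poly_with_coeffs[of "SQ i" "q i"] Q[OF that] fin[OF that] ne[OF that] by auto
  have A0: "Min (A i) = 0" if "i < 2" for i
  proof -
    have "order 0 (P i) = 0 \<or> order 0 (Q i) = 0" using coprime_poly_0[OF cop[OF that], of 0] by (metis order_0I)
    then have "0 \<in> A i" unfolding P0(1)[OF that] Q0(1)[OF that] A[OF that] using fin[OF that] ne[OF that] by (metis Min_in UnI1 UnI2)
    then show ?thesis using fA[OF that] by (metis Min_le le_zero_eq)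
  qed
  have dgA: "coord_degree i = Max (A i)" if "i < 2" for i
    unfolding coord_degree_def P0(2)[OF that] Q0(2)[OF that] A[OF that] using fin[OF that] ne[OF that] by (simp add: Max_Un)
  have in0: "0 \<in> A i" "Max (A i) \<in> A i" if "i < 2" for i using A0[OF that] fA[OF that] by (metis Min_in, simp)
  have abs: "\<alpha> = Min (SP 0)" "\<beta> = Min (SQ 1)" "\<alpha>' = Max (A 0) - Max (SP 0)" "\<beta>' = Max (A 1) - Max (SQ 1)"
    unfolding \<alpha>_def \<beta>_def \<alpha>'_def \<beta>'_def using P0[of 0] Q0[of 1] dgA[of 0] dgA[of 1] by simp_all
  have zero_in: "0 \<in> S \<longleftrightarrow> Min S = 0" if "finite S" "S \<noteq> {}" for S :: "nat set"
    using that by (metis Min_in Min_le le_zero_eq)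
  have max_in: "n \<in> S \<longleftrightarrow> n - Max S = 0" if "finite S" "S \<noteq> {}" "\<forall>k\<in>S. k \<le> n" for S :: "nat set" and n
  proof
    show "n \<in> S \<Longrightarrow> n - Max S = 0" using that by simp
    assume "n - Max S = 0"
    then have "Max S = n" using that Max_in[of S] by (meson diff_is_0_eq le_antisym)
    then show "n \<in> S" using that Max_in by metis
  qed
  have SPA: "\<forall>k\<in>SP i. k \<le> Max (A i)" "\<forall>k\<in>SQ i. k \<le> Max (A i)" if "i < 2" for i
    using fA[OF that] A[OF that] by auto
  have a1: "Min (A 0) \<in> Sel 0 \<longleftrightarrow> 0 < \<alpha>"
    unfolding A0[OF pos2] Sel[OF pos2] abs using in0(1)[of 0] A[of 0] zero_in[of "SP 0"] fin[of 0] ne[of 0] by auto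
  have a2: "Max (A 0) \<in> Sel 0 \<longleftrightarrow> 0 < \<alpha>'"
  proof -
    have "Max (A 0) \<in> SP 0 \<longleftrightarrow> Max (A 0) - Max (SP 0) = 0"
      using SPA(1)[of 0] fin[of 0] ne[of 0] by (intro max_in) simp_all
    moreover have "Max (A 0) \<in> Sel 0 \<longleftrightarrow> Max (A 0) \<notin> SP 0" using in0(2)[OF pos2] A[OF pos2] Sel[OF pos2] by blast
    ultimately show ?thesis unfolding abs by auto
  qed
  have s1: "Sel 1 \<subseteq> SQ 1" "finite (SQ 1)" "finite (Sel 1)" "SQ 1 \<noteq> {}" using Sel[of 1] fin[of 1] ne[of 1] by auto
  have b1: "Min (Sel 1) = \<beta> \<and> (Min (A 1) \<in> Sel 1 \<longleftrightarrow> \<not> 0 < \<beta>)" if "0 < \<alpha>"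
  proof -
    have m: "Min (SQ 1) \<in> Sel 1" using ends(1) a1 that by blast
    then have "Min (Sel 1) = \<beta>" unfolding abs using s1 by (intro Min_eqI) auto
    moreover have "Min (A 1) \<in> Sel 1 \<longleftrightarrow> \<not> 0 < \<beta>"
      using m A0[of 1] zero_in[OF s1(2,4)] s1(1) unfolding abs by auto
    ultimately show ?thesis by blast
  qed
  have b2: "Max (A 1) - Max (Sel 1) = \<beta>' \<and> (Max (A 1) \<in> Sel 1 \<longleftrightarrow> \<not> 0 < \<beta>') \<and> Max (Sel 1) \<le> Max (A 1)" if "0 < \<alpha>'"
  proof -
    have m: "Max (SQ 1) \<in> Sel 1" using ends(2) a2 that by blast
    then have M: "Max (Sel 1) = Max (SQ 1)" using s1 by (intro Max_eqI) auto
    moreover have "Max (SQ 1) \<le> Max (A 1)" using SPA(2)[of 1] Max_in[OF s1(2,4)] by simp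
    moreover have "Max (A 1) \<in> Sel 1 \<longleftrightarrow> \<not> 0 < \<beta>'"
    proof
      assume "Max (A 1) \<in> Sel 1"
      then have "Max (A 1) \<in> SQ 1" using s1 by blast
      then show "\<not> 0 < \<beta>'" using max_in[OF s1(2,4), of "Max (A 1)"] SPA(2)[of 1] unfolding abs by simp
    next
      assume "\<not> 0 < \<beta>'"
      then have "Max (A 1) = Max (SQ 1)" using \<open>Max (SQ 1) \<le> Max (A 1)\<close> unfolding abs by simp
      then show "Max (A 1) \<in> Sel 1" using m by simp
    qed
    ultimately show ?thesis unfolding abs by simp
  qed
  have sp1: "Min (A 1) \<in> SP 1 \<longleftrightarrow> Min (A 1) \<notin> Sel 1" "Max (A 1) \<in> SP 1 \<longleftrightarrow> Max (A 1) \<notin> Sel 1"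
    using in0[of 1] A0[of 1] A[of 1] Sel[of 1] by auto
  have some': "0 < \<alpha> \<and> 0 < \<beta> \<or> 0 < \<alpha>' \<and> 0 < \<beta>'" using some b1 b2 unfolding a1 a2 by auto
  have SP0: "Max (SP 0) \<le> Max (A 0)" "Min (SP 0) \<le> Max (SP 0)" using SPA(1)[of 0] fin[of 0] ne[of 0] by auto
  have d0: "coord_degree 0 = Max (A 0)" "Min (A 0) = 0" "Min (A 1) = 0" using dgA[of 0] A0[of 0] A0[of 1] by simp_all
  have mxd: "Max (SP 0) = coord_degree 0 - \<alpha>'" "\<alpha>' \<le> coord_degree 0" unfolding abs d0 using SP0 by simp_all
  have Fx: "F = (real Fx, real (coord_degree 0))" unfolding F Fx_def a1 a2 unfolding d0 using b1 b2 by auto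
  have Ey: "E = (0, real Ey)"
  proof -
    have 1: "(if Max (A 1) \<in> Sel 1 then Max (A 0) else Max (SP 0)) = coord_degree 0 - (if 0 < \<beta>' then \<alpha>' else 0)"
      using b2 mxd d0 by (cases "0 < \<alpha>'") auto
    have 2: "(if Min (A 1) \<in> Sel 1 then Min (A 0) else Min (SP 0)) = (if 0 < \<beta> then \<alpha> else 0)"
      using b1 d0 abs(1) by (cases "0 < \<alpha>") auto
    show ?thesis unfolding E 1 2 Ey_def by simp
  qed
  have special': "special \<longleftrightarrow> 0 < \<alpha> \<and> 0 < \<alpha>' \<and> 0 < \<beta> \<and> 0 < \<beta>'" unfolding special a1 a2 sp1 using b1 b2 by auto
  have \<delta>': "\<delta> = int (\<alpha>' * \<beta>) - int (\<alpha> * \<beta>')" if special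
  proof -
    have "int (Max (A 0)) - int (Max (SP 0)) = int \<alpha>'" unfolding abs using SP0 by simp
    moreover have "int (Max (A 1)) - int (Max (Sel 1)) = int \<beta>'" using b2 that special' by (metis of_nat_diff)
    moreover have "Min (Sel 1) = \<beta>" using b1 that special' by simp
    ultimately show ?thesis unfolding \<delta> d0 abs(1)[symmetric] by simp
  qed
  show ?thesis
  proof (cases "special \<and> \<delta> \<noteq> 0")
    case True
    then have pos: "0 < \<alpha>" "0 < \<beta>" "0 < \<alpha>'" "0 < \<beta>'" using special' by auto
    have d: "\<delta> < 0 \<longleftrightarrow> \<alpha>' * \<beta> < \<alpha> * \<beta>'" "\<alpha> * \<beta>' \<noteq> \<alpha>' * \<beta>"
      using \<delta>' True by (simp_all only: ) linarith+
    have EyA: "coord_degree 0 = Ey + \<alpha> + \<alpha>'" using pos alpha_le unfolding Ey_def by simp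
    have "pL = (real \<beta>, real (Ey + \<alpha>))" unfolding pL mxd(1) d0(2,3) using b1 pos EyA by simp
    moreover have "pR = (real \<beta>', real (Ey + \<alpha>'))" unfolding pR abs(1)[symmetric] d0(1)[symmetric] using b2 pos EyA by simp
    ultimately have "is_two_edges K (upper_left_corner K E F) E (if \<delta> < 0 then pL else pR) F"
      unfolding K by (intro corner_is_two_edges[OF common pos d(2) Fx Ey]) (simp add: d(1))
    then show ?thesis using True by simp
  next
    case False
    have "is_single_edge K (upper_left_corner K E F) E F"
      unfolding K
    proof (rule corner_is_single_edge[OF common some' _ Fx Ey])
      assume "0 < \<alpha> \<and> 0 < \<beta> \<and> 0 < \<alpha>' \<and> 0 < \<beta>'"
      then have "int (\<alpha> * \<beta>') = int (\<alpha>' * \<beta>)" using False special' \<delta>' by auto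
      then show "\<alpha> * \<beta>' = \<alpha>' * \<beta>" by (simp only: of_nat_eq_iff)
    qed
    then show ?thesis using False by auto
  qed
qed

lemma linear_swap: "linear (prod.swap :: real \<times> real \<Rightarrow> real \<times> real)"
  by (rule linearI) auto

lemma inj_swap: "inj (prod.swap :: real \<times> real \<Rightarrow> real \<times> real)"
  by (rule inj_swap)

lemma closed_segment_swap: "closed_segment (prod.swap E) (prod.swap F) = prod.swap ` closed_segment E (F :: real \<times> real)"
  by (rule closed_segment_linear_image[OF linear_swap])

lemma edge_of_swap:
  fixes c K :: "(real \<times> real) set"
  shows "(prod.swap ` c) edge_of (prod.swap ` K) \<longleftrightarrow> c edge_of K"
  unfolding edge_of_def
  using face_of_linear_image[OF linear_swap inj_swap, of c K] aff_dim_injective_linear_image[OF linear_swap inj_swap, of c] by simp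

lemma frontier_swap: "frontier (prod.swap ` K) = prod.swap ` frontier (K :: (real \<times> real) set)"
proof -
  have "bij (prod.swap :: real \<times> real \<Rightarrow> real \<times> real)" using bij_swap .
  then show ?thesis
    unfolding frontier_def closure_injective_linear_image[OF linear_swap inj_swap, symmetric]
      interior_bijective_linear_image[OF linear_swap \<open>bij _\<close>]
    using image_set_diff[OF inj_swap, of "closure K" "interior K"] by simp
qed

lemma upper_left_corner_swap:
  "upper_left_corner (prod.swap ` K) (prod.swap E) (prod.swap F) = prod.swap ` lower_right_corner K E F"
proof (rule set_eqI)
  fix z :: "real \<times> real"
  have m: "z \<in> prod.swap ` X \<longleftrightarrow> prod.swap z \<in> X" for X :: "(real \<times> real) set"
    by (metis image_iff swap_swap)
  show "z \<in> upper_left_corner (prod.swap ` K) (prod.swap E) (prod.swap F) \<longleftrightarrow> z \<in> prod.swap ` lower_right_corner K E F"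
    unfolding upper_left_corner_def m unfolding lower_right_corner_def frontier_swap by (auto simp: m)
qed

lemma corner_edges_swap:
  "is_single_edge (prod.swap ` K) (upper_left_corner (prod.swap ` K) (prod.swap E) (prod.swap F)) (prod.swap E) (prod.swap F)
   \<longleftrightarrow> is_single_edge K (lower_right_corner K E F) E F"
  "is_two_edges (prod.swap ` K) (upper_left_corner (prod.swap ` K) (prod.swap E) (prod.swap F)) (prod.swap E) (prod.swap p) (prod.swap F)
   \<longleftrightarrow> is_two_edges K (lower_right_corner K E F) E p F"
  unfolding is_single_edge_def is_two_edges_def upper_left_corner_swap closed_segment_swap edge_of_swap
    image_Un[symmetric] inj_image_eq_iff[OF inj_swap] by simp_all

lemma newton_polygon_swap: "newton_polygon (swap_vars \<phi>) = prod.swap ` newton_polygon \<phi>"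
proof -
  have "{(real i, real j) |i j. coeff (coeff (swap_vars \<phi>) j) i \<noteq> 0} = prod.swap ` {(real i, real j) |i j. coeff (coeff \<phi> j) i \<noteq> 0}"
    unfolding coeff_swap_vars by force
  then show ?thesis unfolding newton_polygon_def using convex_hull_linear_image[OF linear_swap] by simp
qed

text \<open>The path from \<open>(0, e)\<close> through the point to the other end consists of the vectors \<open>(b, a)\<close> and \<open>(b', a')\<close>;
it is straight iff these are parallel.\<close>

lemma middle_point_on_segment:
  fixes a b a' b' e :: real
  assumes "0 < a" "0 < b" "0 < a'" "0 < b'"
  shows "(b, e + a) \<in> closed_segment (0, e) (b + b', e + a + a') \<longleftrightarrow> a' * b = a * b'"
proof -
  define s where "s = (a + a') / (b + b')"
  have "s * (b + b') = a + a'" using assms unfolding s_def by simp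
  then have "(b, e + a) \<in> closed_segment (0, e) (b + b', e + a + a') \<longleftrightarrow> a = s * b"
    using in_closed_segment_iff_on_line[of "(0, e)" "(b + b', e + a + a')" s "(b, e + a)"] assms by simp
  also have "\<dots> \<longleftrightarrow> a * (b + b') = (a + a') * b" using assms unfolding s_def by (simp add: field_simps)
  also have "\<dots> \<longleftrightarrow> a' * b = a * b'" by (auto simp: algebra_simps)
  finally show ?thesis .
qed

text \<open>The part of the theorem that concerns triangulations only, for the corner whose horizontal
lengths come from row \<open>k\<close> and vertical lengths from row \<open>i\<close>: the indices 0 and 1 are exchanged for
the lower right corner.\<close>

lemma corner_from_triangulations:
  fixes A Sel :: "nat \<Rightarrow> nat set" and i k :: nat and \<delta> :: int and E F pL pR :: "real \<times> real"
  assumes fin: "\<And>i. i < 2 \<Longrightarrow> finite (A i)"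
    and Sel: "\<And>i. i < 2 \<Longrightarrow> Sel i \<subseteq> A i" "\<And>i. i < 2 \<Longrightarrow> Sel i \<noteq> {}" "\<And>i. i < 2 \<Longrightarrow> A i - Sel i \<noteq> {}"
    and ik: "i < 2" "k < 2" "1 - i = k" "1 - k = i"
    and ne: "e_max_at_min A Sel k \<noteq> Max (A i) - Min (A i)"
    and Non: "\<And>i. Non i = A i - Sel i"
    and E: "E = (0, real (e_max_at_min A Sel k))"
    and F: "F = (real (e_min_at_max A Sel i), real (Max (A i) - Min (A i)))"
    and \<delta>: "\<delta> = (int (Max (A i)) - int (Max (Non i))) * (int (Min (Sel k)) - int (Min (A k)))
              - (int (Min (Non i)) - int (Min (A i))) * (int (Max (A k)) - int (Max (Sel k)))"
    and pL: "pL = (real (Min (Sel k) - Min (A k)), real (Max (Non i) - Min (A i)))"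
    and pR: "pR = (real (Max (A k) - Max (Sel k)), real (Max (A i) - Min (Non i)))"
  shows "Min (A i) \<in> Sel i \<and> Min (A k) \<notin> Sel k \<or> Max (A i) \<in> Sel i \<and> Max (A k) \<notin> Sel k"
    "e_min_at_max A Sel i \<noteq> 0"
    "Min (A i) \<in> Sel i \<and> Max (A i) \<in> Sel i \<and> Min (A k) \<in> Non k \<and> Max (A k) \<in> Non k \<Longrightarrow>
       (pL \<in> closed_segment E F \<longleftrightarrow> \<delta> = 0) \<and> (pR \<in> closed_segment E F \<longleftrightarrow> \<delta> = 0)"
proof -
  have e1: "e_max_at_min A Sel k = (if Max (A k) \<in> Sel k then Max (A i) else Max (A i - Sel i)) -
     (if Min (A k) \<in> Sel k then Min (A i) else Min (A i - Sel i))"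
    using e_max_at_min_eq[of A Sel k] fin Sel ik(2) unfolding ik(4) by blast
  have e0: "e_min_at_max A Sel i = (if Min (A i) \<in> Sel i then Min (Sel k) - Min (A k) else 0) +
     (if Max (A i) \<in> Sel i then Max (A k) - Max (Sel k) else 0)"
    using e_min_at_max_eq[of A Sel i] fin Sel ik(1) unfolding ik(3) by blast
  have mm: "Min (A i) \<notin> Sel i \<Longrightarrow> Min (A i - Sel i) = Min (A i)" "Max (A i) \<notin> Sel i \<Longrightarrow> Max (A i - Sel i) = Max (A i)"
    using Min_Non[of A Sel i] Max_Non[of A Sel i] fin Sel ik(1) by blast+
  show cond: "Min (A i) \<in> Sel i \<and> Min (A k) \<notin> Sel k \<or> Max (A i) \<in> Sel i \<and> Max (A k) \<notin> Sel k"
    using ne mm unfolding e1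
    by (cases "Min (A i) \<in> Sel i"; cases "Max (A i) \<in> Sel i"; cases "Min (A k) \<in> Sel k"; cases "Max (A k) \<in> Sel k") simp_all
  have fi: "finite (A i)" "finite (A k)" "finite (Sel k)" "Sel k \<noteq> {}" "finite (Non i)" "Non i \<noteq> {}"
    using fin Sel ik finite_subset unfolding Non by blast+
  have S: "Min (Sel k) \<in> A k" "Max (Sel k) \<in> A k" "Min (Sel k) \<in> Sel k" "Max (Sel k) \<in> Sel k"
    using fi Sel(1)[OF ik(2)] Min_in[OF fi(3,4)] Max_in[OF fi(3,4)] by blast+
  have lo: "Min (A k) < Min (Sel k)" if "Min (A k) \<notin> Sel k" using S that fi by (metis Min_le order_le_less)
  have hi: "Max (Sel k) < Max (A k)" if "Max (A k) \<notin> Sel k" using S that fi by (metis Max_ge order_le_less)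
  show "e_min_at_max A Sel i \<noteq> 0" unfolding e0 using cond lo hi by auto
  assume sp: "Min (A i) \<in> Sel i \<and> Max (A i) \<in> Sel i \<and> Min (A k) \<in> Non k \<and> Max (A k) \<in> Non k"
  then have nk: "Min (A k) \<notin> Sel k" "Max (A k) \<notin> Sel k" unfolding Non by auto
  have N: "Min (Non i) \<in> Non i" "Max (Non i) \<in> Non i" "Min (Non i) \<le> Max (Non i)" using fi(5,6) by simp_all
  then have N': "Min (Non i) \<in> A i" "Max (Non i) \<in> A i" "Min (Non i) \<notin> Sel i" "Max (Non i) \<notin> Sel i" unfolding Non by auto
  define a where "a = Min (Non i) - Min (A i)"
  define a' where "a' = Max (A i) - Max (Non i)"
  define b where "b = Min (Sel k) - Min (A k)"
  define b' where "b' = Max (A k) - Max (Sel k)"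
  define e where "e = Max (Non i) - Min (Non i)"
  have nl: "Min (A i) < Min (Non i)" "Max (Non i) < Max (A i)"
    using N' sp fi by (metis Min_le order_le_less, metis Max_ge order_le_less)
  have pos: "0 < a" "0 < a'" "0 < b" "0 < b'" unfolding a_def a'_def b_def b'_def using nl lo hi nk by auto
  have Ee: "E = (0, real e)" unfolding E e1 e_def using nk by (simp add: Non)
  have Fe: "F = (real b + real b', real e + real a + real a')"
    unfolding F e0 using sp nl N(3) unfolding a_def a'_def b_def b'_def e_def by simp
  have pe: "pL = (real b, real e + real a)" "pR = (real b', real e + real a')"
    unfolding pL pR using nl N(3) unfolding a_def a'_def b_def b'_def e_def by simp_all
  have d: "\<delta> = int (a' * b) - int (a * b')"
    unfolding \<delta> using nl lo[OF nk(1)] hi[OF nk(2)] unfolding a_def a'_def b_def b'_def by (simp add: of_nat_diff)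
  have d0: "\<delta> = 0 \<longleftrightarrow> real a' * real b = real a * real b'"
    unfolding d by (metis eq_iff_diff_eq_0 of_nat_eq_iff of_nat_mult)
  have "pL \<in> closed_segment E F \<longleftrightarrow> \<delta> = 0"
    unfolding d0 pe Ee Fe using middle_point_on_segment[of "real a" "real b" "real a'" "real b'" "real e"] pos by simp
  moreover have "pR \<in> closed_segment E F \<longleftrightarrow> \<delta> = 0"
    unfolding d0 pe Ee Fe using middle_point_on_segment[of "real a'" "real b'" "real a" "real b" "real e"] pos
    by (auto simp: add_ac)
  ultimately show "(pL \<in> closed_segment E F \<longleftrightarrow> \<delta> = 0) \<and> (pR \<in> closed_segment E F \<longleftrightarrow> \<delta> = 0)" by blast
qed

lemma curve_of_generic_coeffs:
  assumes "(p, q) \<in> generic_coeffs SP SQ i j"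
    and fin: "\<And>i. i < 2 \<Longrightarrow> finite (SP i) \<and> finite (SQ i)" and ne: "\<And>i. i < 2 \<Longrightarrow> SP i \<noteq> {} \<and> SQ i \<noteq> {}"
    and non: "\<And>i. i < 2 \<Longrightarrow> SQ i - SP i \<noteq> {}"
    and P: "P = (\<lambda>i. poly_with_coeffs (SP i) (p i))" and Q: "Q = (\<lambda>i. poly_with_coeffs (SQ i) (q i))"
    and cop: "coprime (P 0) (Q 0)" "coprime (P 1) (Q 1)" and deg: "has_param_degree P Q 1" "is_implicit_equation P Q \<phi>"
  shows "rational_curve P Q \<phi>"
proof
  have nz: "\<forall>l<2. (\<forall>k\<in>SP l. p l k \<noteq> 0) \<and> (\<forall>k\<in>SQ l. q l k \<noteq> 0)" using assms(1) unfolding generic_coeffs_def by auto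
  fix i :: nat assume i: "i < 2"
  show "coprime (P i) (Q i)" using i cop by (auto simp: less_2_cases_iff)
  show "P i \<noteq> 0" "Q i \<noteq> 0" unfolding P Q
    using order_degree_poly_with_coeffs(3)[of "SP i" "p i"] order_degree_poly_with_coeffs(3)[of "SQ i" "q i"] fin[OF i] ne[OF i] nz i by blast+
  show "0 < max (degree (P i)) (degree (Q i))"
  proof (rule ccontr)
    assume "\<not> 0 < max (degree (P i)) (degree (Q i))"
    then have "Max (SP i) = 0" "Max (SQ i) = 0"
      using order_degree_poly_with_coeffs(2)[of "SP i" "p i"] order_degree_poly_with_coeffs(2)[of "SQ i" "q i"] fin[OF i] ne[OF i] nz i
      unfolding P Q by auto
    then have "SP i \<subseteq> {0}" "SQ i \<subseteq> {0}" using fin[OF i] by (metis Max_ge le_zero_eq singletonI subsetI)+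
    then have "SQ i - SP i = {}" using ne[OF i] by blast
    then show False using non[OF i] by simp
  qed
qed (use deg in simp_all)

theorem theorem28:
  fixes SP SQ A Sel Non :: "nat \<Rightarrow> nat set"
    and \<delta> \<delta>' :: int
    and E F pL pR E' F' pL' pR' :: "real \<times> real"
  assumes supports: "\<And>i. i < 2 \<Longrightarrow> finite (SP i) \<and> finite (SQ i)"
    and A: "A = (\<lambda>i. SP i \<union> SQ i)"
    and Sel: "Sel = (\<lambda>i. SQ i - SP i)"
    and Non: "Non = (\<lambda>i. A i - Sel i)"
    and nonempty: "\<And>i. i < 2 \<Longrightarrow> Sel i \<noteq> {} \<and> Non i \<noteq> {}"
    and \<delta>: "\<delta> = (int (Max (A 0)) - int (Max (Non 0))) * (int (Min (Sel 1)) - int (Min (A 1)))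
              - (int (Min (Non 0)) - int (Min (A 0))) * (int (Max (A 1)) - int (Max (Sel 1)))"
    and E: "E = (0, real (e_max_at_min A Sel 1))"
    and F: "F = (real (e_min_at_max A Sel 0), real (Max (A 0) - Min (A 0)))"
    and pL: "pL = (real (Min (Sel 1) - Min (A 1)), real (Max (Non 0) - Min (A 0)))"
    and pR: "pR = (real (Max (A 1) - Max (Sel 1)), real (Max (A 0) - Min (Non 0)))"
    and \<delta>': "\<delta>' = (int (Max (A 1)) - int (Max (Non 1))) * (int (Min (Sel 0)) - int (Min (A 0)))
               - (int (Min (Non 1)) - int (Min (A 1))) * (int (Max (A 0)) - int (Max (Sel 0)))"
    and E': "E' = (real (e_max_at_min A Sel 0), 0)"
    and F': "F' = (real (Max (A 1) - Min (A 1)), real (e_min_at_max A Sel 1))"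
    and pL': "pL' = (real (Max (Non 1) - Min (A 1)), real (Min (Sel 0) - Min (A 0)))"
    and pR': "pR' = (real (Max (A 1) - Min (Non 1)), real (Max (A 0) - Max (Sel 0)))"
  shows
    "(e_max_at_min A Sel 1 \<noteq> Max (A 0) - Min (A 0) \<longrightarrow>
        (Min (A 0) \<in> Sel 0 \<and> Min (A 1) \<notin> Sel 1 \<or> Max (A 0) \<in> Sel 0 \<and> Max (A 1) \<notin> Sel 1) \<and>
        e_min_at_max A Sel 0 \<noteq> 0 \<and>
        (let special = Min (A 0) \<in> Sel 0 \<and> Max (A 0) \<in> Sel 0 \<and>
                       Min (A 1) \<in> Non 1 \<and> Max (A 1) \<in> Non 1
         in (special \<longrightarrow> (pL \<in> closed_segment E F \<longleftrightarrow> \<delta> = 0) \<and>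
                          (pR \<in> closed_segment E F \<longleftrightarrow> \<delta> = 0)) \<and>
            (denominator_ends_selected SQ A Sel 0 \<longrightarrow>
             for_generic_implicit_equation SP SQ (\<lambda>\<phi>.
               let K = newton_polygon \<phi>; B = upper_left_corner K E F
               in if special \<and> \<delta> \<noteq> 0
                  then is_two_edges K B E (if \<delta> < 0 then pL else pR) F
                  else is_single_edge K B E F)))) \<and>
     (e_max_at_min A Sel 0 \<noteq> Max (A 1) - Min (A 1) \<longrightarrow>
        (Min (A 1) \<in> Sel 1 \<and> Min (A 0) \<notin> Sel 0 \<or> Max (A 1) \<in> Sel 1 \<and> Max (A 0) \<notin> Sel 0) \<and>
        e_min_at_max A Sel 1 \<noteq> 0 \<and>
        (let special = Min (A 1) \<in> Sel 1 \<and> Max (A 1) \<in> Sel 1 \<and>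
                       Min (A 0) \<in> Non 0 \<and> Max (A 0) \<in> Non 0
         in (special \<longrightarrow> (pL' \<in> closed_segment E' F' \<longleftrightarrow> \<delta>' = 0) \<and>
                          (pR' \<in> closed_segment E' F' \<longleftrightarrow> \<delta>' = 0)) \<and>
            (denominator_ends_selected SQ A Sel 1 \<longrightarrow>
             for_generic_implicit_equation SP SQ (\<lambda>\<phi>.
               let K = newton_polygon \<phi>; B = lower_right_corner K E' F'
               in if special \<and> \<delta>' \<noteq> 0
                  then is_two_edges K B E' (if \<delta>' < 0 then pL' else pR') F'
                  else is_single_edge K B E' F'))))"
proof -
  have S: "Sel i = SQ i - SP i" "A i = SP i \<union> SQ i" "Non i = SP i" for i
    unfolding Non Sel A by auto
  have NonA: "\<And>i. Non i = A i - Sel i" unfolding Non by simp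
  have finA: "\<And>i. i < 2 \<Longrightarrow> finite (A i)" using supports unfolding S by simp
  have Sel3: "\<And>i. i < 2 \<Longrightarrow> Sel i \<subseteq> A i" "\<And>i. i < 2 \<Longrightarrow> Sel i \<noteq> {}" "\<And>i. i < 2 \<Longrightarrow> A i - Sel i \<noteq> {}"
    using nonempty unfolding NonA[symmetric] unfolding S by blast+
  have ne: "\<And>i. i < 2 \<Longrightarrow> SP i \<noteq> {} \<and> SQ i \<noteq> {}" and non: "\<And>i. i < 2 \<Longrightarrow> SQ i - SP i \<noteq> {}"
    using nonempty unfolding S by blast+
  have emm: "e_max_at_min A Sel i =
     (if Max (A i) \<in> Sel i then Max (A (1 - i)) else Max (SP (1 - i))) -
     (if Min (A i) \<in> Sel i then Min (A (1 - i)) else Min (SP (1 - i)))" if "i < 2" for i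
    using e_max_at_min_eq[of A Sel i] finA Sel3 that unfolding NonA[symmetric] S(3) by blast
  have emx: "e_min_at_max A Sel i = (if Min (A i) \<in> Sel i then Min (Sel (1 - i)) - Min (A (1 - i)) else 0) +
     (if Max (A i) \<in> Sel i then Max (A (1 - i)) - Max (Sel (1 - i)) else 0)" if "i < 2" for i
    using e_min_at_max_eq[of A Sel i] finA Sel3 that by blast
  show ?thesis
  proof (intro conjI impI)
    assume ne0: "e_max_at_min A Sel 1 \<noteq> Max (A 0) - Min (A 0)"
    note c = corner_from_triangulations[of A Sel 0 1 Non E F \<delta> pL pR, OF finA Sel3 _ _ _ _ ne0 NonA E F \<delta> pL pR]
    let ?special = "Min (A 0) \<in> Sel 0 \<and> Max (A 0) \<in> Sel 0 \<and> Min (A 1) \<in> Non 1 \<and> Max (A 1) \<in> Non 1"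
    show cond: "Min (A 0) \<in> Sel 0 \<and> Min (A 1) \<notin> Sel 1 \<or> Max (A 0) \<in> Sel 0 \<and> Max (A 1) \<notin> Sel 1"
      by (rule c(1)) simp_all
    show "e_min_at_max A Sel 0 \<noteq> 0" by (rule c(2)) simp_all
    have seg: "?special \<Longrightarrow> (pL \<in> closed_segment E F \<longleftrightarrow> \<delta> = 0) \<and> (pR \<in> closed_segment E F \<longleftrightarrow> \<delta> = 0)"
      by (rule c(3)) simp_all
    have gen: "for_generic_implicit_equation SP SQ (\<lambda>\<phi>.
        let K = newton_polygon \<phi>; B = upper_left_corner K E F
        in if ?special \<and> \<delta> \<noteq> 0 then is_two_edges K B E (if \<delta> < 0 then pL else pR) F else is_single_edge K B E F)"
      if ends: "denominator_ends_selected SQ A Sel 0"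
    proof (rule for_generic_implicit_equationI[where i = 0 and j = 1])
      fix p q \<phi> P Q
      assume g: "(p, q) \<in> generic_coeffs SP SQ 0 1" and P: "P = (\<lambda>i. poly_with_coeffs (SP i) (p i))"
        and Q: "Q = (\<lambda>i. poly_with_coeffs (SQ i) (q i))" and h: "coprime (P 0) (Q 0)" "coprime (P 1) (Q 1)"
          "has_param_degree P Q 1" "is_implicit_equation P Q \<phi>"
      have gc: "\<forall>l<2. (\<forall>k\<in>SP l. p l k \<noteq> 0) \<and> (\<forall>k\<in>SQ l. q l k \<noteq> 0)" "no_common_root (SP 0) (SQ 1) (p 0) (q 1)"
        using g unfolding generic_coeffs_def by auto
      have curve: "rational_curve P Q \<phi>" by (rule curve_of_generic_coeffs[OF g supports ne non P Q h])
      show "let K = newton_polygon \<phi>; B = upper_left_corner K E F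
        in if ?special \<and> \<delta> \<noteq> 0 then is_two_edges K B E (if \<delta> < 0 then pL else pR) F else is_single_edge K B E F"
        unfolding Let_def
      proof (rule corner_of_supports[OF curve])
        show "\<forall>t. poly (P 0) t = 0 \<longrightarrow> poly (Q 1) t = 0 \<longrightarrow> t = 0" using gc(2) unfolding no_common_root_def P Q .
        show "E = (0, real ((if Max (A 1) \<in> Sel 1 then Max (A 0) else Max (SP 0)) - (if Min (A 1) \<in> Sel 1 then Min (A 0) else Min (SP 0))))"
          unfolding E using emm[of 1] by simp
        show "F = (real ((if Min (A 0) \<in> Sel 0 then Min (Sel 1) - Min (A 1) else 0) + (if Max (A 0) \<in> Sel 0 then Max (A 1) - Max (Sel 1) else 0)),
          real (Max (A 0) - Min (A 0)))" unfolding F using emx[of 0] by simp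
      qed (use supports ne gc(1) cond ends in \<open>auto simp: P Q S \<delta> pL pR denominator_ends_selected_def\<close>)
    qed (use supports ne in simp_all)
    show "let special = ?special
         in (special \<longrightarrow> (pL \<in> closed_segment E F \<longleftrightarrow> \<delta> = 0) \<and> (pR \<in> closed_segment E F \<longleftrightarrow> \<delta> = 0)) \<and>
            (denominator_ends_selected SQ A Sel 0 \<longrightarrow>
             for_generic_implicit_equation SP SQ (\<lambda>\<phi>.
               let K = newton_polygon \<phi>; B = upper_left_corner K E F
               in if special \<and> \<delta> \<noteq> 0
                  then is_two_edges K B E (if \<delta> < 0 then pL else pR) F
                  else is_single_edge K B E F))"
      using seg gen by (simp only: Let_def) blast
  next
    assume ne1: "e_max_at_min A Sel 0 \<noteq> Max (A 1) - Min (A 1)"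
    have sw: "prod.swap E' = (0, real (e_max_at_min A Sel 0))"
      "prod.swap F' = (real (e_min_at_max A Sel 1), real (Max (A 1) - Min (A 1)))"
      "prod.swap pL' = (real (Min (Sel 0) - Min (A 0)), real (Max (Non 1) - Min (A 1)))"
      "prod.swap pR' = (real (Max (A 0) - Max (Sel 0)), real (Max (A 1) - Min (Non 1)))"
      unfolding E' F' pL' pR' by simp_all
    note c = corner_from_triangulations[of A Sel 1 0 Non _ _ \<delta>', OF finA Sel3 _ _ _ _ ne1 NonA sw(1,2) \<delta>' sw(3,4)]
    let ?special = "Min (A 1) \<in> Sel 1 \<and> Max (A 1) \<in> Sel 1 \<and> Min (A 0) \<in> Non 0 \<and> Max (A 0) \<in> Non 0"
    show cond: "Min (A 1) \<in> Sel 1 \<and> Min (A 0) \<notin> Sel 0 \<or> Max (A 1) \<in> Sel 1 \<and> Max (A 0) \<notin> Sel 0"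
      by (rule c(1)) simp_all
    show "e_min_at_max A Sel 1 \<noteq> 0" by (rule c(2)) simp_all
    have seg: "?special \<Longrightarrow> (pL' \<in> closed_segment E' F' \<longleftrightarrow> \<delta>' = 0) \<and> (pR' \<in> closed_segment E' F' \<longleftrightarrow> \<delta>' = 0)"
    proof -
      assume ?special
      then have "(prod.swap pL' \<in> closed_segment (prod.swap E') (prod.swap F') \<longleftrightarrow> \<delta>' = 0) \<and>
        (prod.swap pR' \<in> closed_segment (prod.swap E') (prod.swap F') \<longleftrightarrow> \<delta>' = 0)"
        by (intro c(3)) simp_all
      then show ?thesis unfolding closed_segment_swap inj_image_mem_iff[OF inj_swap] .
    qed
    have gen: "for_generic_implicit_equation SP SQ (\<lambda>\<phi>.
        let K = newton_polygon \<phi>; B = lower_right_corner K E' F'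
        in if ?special \<and> \<delta>' \<noteq> 0 then is_two_edges K B E' (if \<delta>' < 0 then pL' else pR') F' else is_single_edge K B E' F')"
      if ends: "denominator_ends_selected SQ A Sel 1"
    proof (rule for_generic_implicit_equationI[where i = 1 and j = 0])
      fix p q \<phi> P Q
      assume g: "(p, q) \<in> generic_coeffs SP SQ 1 0" and P: "P = (\<lambda>i. poly_with_coeffs (SP i) (p i))"
        and Q: "Q = (\<lambda>i. poly_with_coeffs (SQ i) (q i))" and h: "coprime (P 0) (Q 0)" "coprime (P 1) (Q 1)"
          "has_param_degree P Q 1" "is_implicit_equation P Q \<phi>"
      have gc: "\<forall>l<2. (\<forall>k\<in>SP l. p l k \<noteq> 0) \<and> (\<forall>k\<in>SQ l. q l k \<noteq> 0)" "no_common_root (SP 1) (SQ 0) (p 1) (q 0)"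
        using g unfolding generic_coeffs_def by auto
      interpret rational_curve P Q \<phi> by (rule curve_of_generic_coeffs[OF g supports ne non P Q h])
      let ?K = "newton_polygon (swap_vars \<phi>)"
      have "if ?special \<and> \<delta>' \<noteq> 0
        then is_two_edges ?K (upper_left_corner ?K (prod.swap E') (prod.swap F')) (prod.swap E') (if \<delta>' < 0 then prod.swap pL' else prod.swap pR') (prod.swap F')
        else is_single_edge ?K (upper_left_corner ?K (prod.swap E') (prod.swap F')) (prod.swap E') (prod.swap F')"
      proof (rule corner_of_supports[OF swap, where SP = "flip SP" and SQ = "flip SQ" and A = "flip A" and Sel = "flip Sel" and p = "flip p" and q = "flip q"])
        show "\<forall>t. poly (flip P 0) t = 0 \<longrightarrow> poly (flip Q 1) t = 0 \<longrightarrow> t = 0"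
          using gc(2) unfolding no_common_root_def P Q flip_def by simp
        show "prod.swap E' = (0, real ((if Max (flip A 1) \<in> flip Sel 1 then Max (flip A 0) else Max (flip SP 0)) -
            (if Min (flip A 1) \<in> flip Sel 1 then Min (flip A 0) else Min (flip SP 0))))"
          unfolding sw using emm[of 0] by (simp add: flip_def)
        show "prod.swap F' = (real ((if Min (flip A 0) \<in> flip Sel 0 then Min (flip Sel 1) - Min (flip A 1) else 0) +
            (if Max (flip A 0) \<in> flip Sel 0 then Max (flip A 1) - Max (flip Sel 1) else 0)), real (Max (flip A 0) - Min (flip A 0)))"
          unfolding sw using emx[of 1] by (simp add: flip_def)
        fix i :: nat assume "i < 2"
        then have i: "1 - i < 2" by simp
        show "finite (flip SP i) \<and> finite (flip SQ i)" unfolding flip_def by (rule supports[OF i])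
        show "flip SP i \<noteq> {} \<and> flip SQ i \<noteq> {}" unfolding flip_def by (rule ne[OF i])
        show "flip P i = poly_with_coeffs (flip SP i) (flip p i) \<and> (\<forall>k\<in>flip SP i. flip p i k \<noteq> 0)"
          "flip Q i = poly_with_coeffs (flip SQ i) (flip q i) \<and> (\<forall>k\<in>flip SQ i. flip q i k \<noteq> 0)"
          using gc(1) i unfolding flip_def P Q by blast+
        show "flip A i = flip SP i \<union> flip SQ i" "flip Sel i = flip SQ i - flip SP i" unfolding flip_def S by simp_all
      qed (use cond ends in \<open>simp_all add: flip_def sw \<delta>' S(3) denominator_ends_selected_def\<close>)
      then show "let K = newton_polygon \<phi>; B = lower_right_corner K E' F'
        in if ?special \<and> \<delta>' \<noteq> 0 then is_two_edges K B E' (if \<delta>' < 0 then pL' else pR') F' else is_single_edge K B E' F'"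
        unfolding Let_def newton_polygon_swap if_distrib[of prod.swap, symmetric] corner_edges_swap .
    qed (use supports ne in simp_all)
    show "let special = ?special
         in (special \<longrightarrow> (pL' \<in> closed_segment E' F' \<longleftrightarrow> \<delta>' = 0) \<and> (pR' \<in> closed_segment E' F' \<longleftrightarrow> \<delta>' = 0)) \<and>
            (denominator_ends_selected SQ A Sel 1 \<longrightarrow>
             for_generic_implicit_equation SP SQ (\<lambda>\<phi>.
               let K = newton_polygon \<phi>; B = lower_right_corner K E' F'
               in if special \<and> \<delta>' \<noteq> 0
                  then is_two_edges K B E' (if \<delta>' < 0 then pL' else pR') F'
                  else is_single_edge K B E' F'))"
      using seg gen by (simp only: Let_def) blast
  qed
qed

end
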